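(* Let $k$ be an algebraically closed field of characteristic zero and $R=k[x_1,\ldots,x_n]$ with $n\ge3$. Let $J\subseteq R$ be a $3$-equigenerated ideal of codimension $2$ with minimal graded free resolution $$0\to\bigoplus_{i=1}^2R(-3-\delta_{i+2}-\epsilon_i)\to\bigoplus_{i=1}^4R(-3-\delta_i)\to R(-3)^3\to J\to0.$$ Then the list of all possible vectors $\underline\delta=(\delta_1,\ldots,\delta_4)$ and $\underline\epsilon=(\epsilon_1,\epsilon_2)$ and their respective values $\deg(R/J)$ and $\mathrm{Bour}(J)$ is: - $\underline\delta=(2,3,3,3)$, $\underline\epsilon=(1,1)$, $\deg(R/J)=4$, $\mathrm{Bour}(J)=3$; - $\underline\delta=(3,3,3,3)$, $\underline\epsilon=(1,2)$, $\deg(R/J)=2$, $\mathrm{Bour}(J)=7$; - $\underline\delta=(3,3,3,4)$, $\underline\epsilon=(2,1)$, $\deg(R/J)=1$, $\mathrm{Bour}(J)=8$.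
   Context: $J=(f_1,f_2,f_3)$ is minimally generated by three forms of degree $d=3$. Conventions for the resolution: $1\le\delta_1\le\delta_2\le\delta_3\le\delta_4$, the $\epsilon_i$ are positive integers, and $\delta_3+\epsilon_1\le\delta_4+\epsilon_2$. $\deg(R/J)$ is the multiplicity of $R/J$. Bourbaki degree: $\mathrm{Syz}(J)\subseteq R^3$ carries the standard grading, $e=\mathrm{indeg}(\mathrm{Syz}(J))$ is the least degree of a nonzero homogeneous syzygy (so $e=\delta_1$), and $\nu$ is a minimal generator of degree $e$. If $J$ is perfect of height two put $\mathrm{Bour}(J)=0$; otherwise $\mathrm{Syz}(J)/R\nu$ is isomorphic, up to shift, to an unmixed homogeneous ideal $I_\nu$ of height $2$ and $\mathrm{Bour}(J)=\deg(R/I_\nu)$. In all cases $\mathrm{Bour}(J)=d^2-ed+e^2-\deg(R/J)$. *)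

theory Defs
  imports
    "HOL-Library.Poly_Mapping"
    "HOL-Library.Extended_Nat"
    "HOL-Library.Cardinality"
    "HOL-Computational_Algebra.Polynomial"
    "Jordan_Normal_Form.Matrix_Kernel"
begin

text \<open>
  The polynomial ring \<open>R = k[x\<^sub>1, \<dots>, x\<^sub>n]\<close> is the whole type \<open>('n, 'k) mpoly\<close>, with the elements of
  \<open>'n\<close> as variables. HOL-Algebra also has a locale called \<open>module\<close>, so the one for type class
  rings is qualified below.
\<close>

type_synonym ('n, 'k) mpoly = "('n \<Rightarrow>\<^sub>0 nat) \<Rightarrow>\<^sub>0 'k"

definition mdeg :: "('n \<Rightarrow>\<^sub>0 nat) \<Rightarrow> nat" where
  "mdeg m = (\<Sum>x\<in>Poly_Mapping.keys m. Poly_Mapping.lookup m x)"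

text \<open>Degrees are integers so that twists may have any sign; \<open>0\<close> is a form of every degree and the
  only form of a negative degree.\<close>

definition form :: "int \<Rightarrow> ('n, 'k::zero) mpoly \<Rightarrow> bool" where
  "form d p \<longleftrightarrow> (\<forall>m\<in>Poly_Mapping.keys p. int (mdeg m) = d)"

section \<open>Ideals\<close>

abbreviation is_ideal :: "'a::comm_ring_1 set \<Rightarrow> bool" where
  "is_ideal \<equiv> Modules.module.subspace (*)"

abbreviation ideal_gen :: "'a::comm_ring_1 set \<Rightarrow> 'a set" where
  "ideal_gen \<equiv> Modules.module.span (*)"

definition homogeneous_ideal :: "('n, 'k::comm_ring_1) mpoly set \<Rightarrow> bool" where
  "homogeneous_ideal I \<longleftrightarrow> is_ideal I \<and> ideal_gen {p \<in> I. \<exists>d. form d p} = I"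

definition prime_ideal :: "'a::comm_ring_1 set \<Rightarrow> bool" where
  "prime_ideal P \<longleftrightarrow> is_ideal P \<and> P \<noteq> UNIV \<and> (\<forall>a b. a * b \<in> P \<longrightarrow> a \<in> P \<or> b \<in> P)"

definition prime_height :: "'a::comm_ring_1 set \<Rightarrow> enat" where
  "prime_height P = Sup {enat l | l. \<exists>Q :: nat \<Rightarrow> 'a set.
     (\<forall>i\<le>l. prime_ideal (Q i)) \<and> (\<forall>i<l. Q i \<subset> Q (Suc i)) \<and> Q l = P}"

text \<open>The height (codimension) of an ideal; it is \<open>\<infinity>\<close> for the unit ideal.\<close>

definition height :: "'a::comm_ring_1 set \<Rightarrow> enat" where
  "height I = Inf {prime_height P | P. prime_ideal P \<and> I \<subseteq> P}"

definition associated_prime :: "'a::comm_ring_1 set \<Rightarrow> 'a set \<Rightarrow> bool" where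
  "associated_prime I P \<longleftrightarrow> prime_ideal P \<and> (\<exists>a. P = {r. r * a \<in> I})"

definition unmixed :: "'a::comm_ring_1 set \<Rightarrow> bool" where
  "unmixed I \<longleftrightarrow> (\<forall>P. associated_prime I P \<longrightarrow> prime_height P = height I)"

text \<open>The entries of \<open>f\<close> are forms of degree \<open>d\<close> generating \<open>J\<close>, none of which can be omitted.\<close>

definition min_gens :: "int \<Rightarrow> ('n, 'k::comm_ring_1) mpoly set \<Rightarrow> ('n, 'k) mpoly vec \<Rightarrow> bool" where
  "min_gens d J f \<longleftrightarrow> (\<forall>i<dim_vec f. form d (f $ i)) \<and>
     ideal_gen (set\<^sub>v f) = J \<and>
     (\<forall>i<dim_vec f. f $ i \<notin> ideal_gen {f $ j | j. j < dim_vec f \<and> j \<noteq> i})"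

section \<open>Multiplicity\<close>

abbreviation k_dim :: "('n, 'k::field) mpoly set \<Rightarrow> nat" where
  "k_dim \<equiv> vector_space.dim (\<lambda>(c::'k) p. Poly_Mapping.single 0 c * p)"

definition hilbert_fun :: "('n, 'k::field) mpoly set \<Rightarrow> nat \<Rightarrow> nat" where
  "hilbert_fun I i = k_dim {p::('n, 'k) mpoly. form (int i) p} - k_dim {p \<in> I. form (int i) p}"

definition hilbert_poly :: "('n, 'k::field) mpoly set \<Rightarrow> rat poly" where
  "hilbert_poly I = (THE h. \<forall>\<^sub>F i in sequentially. of_nat (hilbert_fun I i) = poly h (of_nat i))"

text \<open>The multiplicity of \<open>R/I\<close> for a homogeneous ideal \<open>I\<close>. The Hilbert polynomial is \<open>0\<close> exactly
  when \<open>R/I\<close> has finite length, and then the multiplicity is that length.\<close>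

definition quot_multiplicity :: "('n, 'k::field) mpoly set \<Rightarrow> rat" where
  "quot_multiplicity I = (let h = hilbert_poly I in
     if h = 0 then of_nat (\<Sum>i | hilbert_fun I i \<noteq> 0. hilbert_fun I i)
     else fact (Polynomial.degree h) * lead_coeff h)"

section \<open>Graded free resolutions\<close>

text \<open>\<open>M\<close> is the matrix of a homomorphism \<open>\<Oplus>\<^sub>j R(-a\<^sub>j) \<rightarrow> \<Oplus>\<^sub>i R(-b\<^sub>i)\<close> of degree \<open>0\<close>, acting on column
  vectors.\<close>

definition graded_map :: "int list \<Rightarrow> int list \<Rightarrow> ('n, 'k::zero) mpoly mat \<Rightarrow> bool" where
  "graded_map b a M \<longleftrightarrow> M \<in> carrier_mat (length b) (length a) \<and>
     (\<forall>i<length b. \<forall>j<length a. form (a ! j - b ! i) (M $$ (i, j)))"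

definition mat_image :: "'a::comm_ring_1 mat \<Rightarrow> 'a vec set" where
  "mat_image M = {M *\<^sub>v v | v. v \<in> carrier_vec (dim_col M)}"

text \<open>A finite graded free resolution \<open>0 \<rightarrow> F\<^sub>r \<rightarrow> \<cdots> \<rightarrow> F\<^sub>0 \<rightarrow> J \<rightarrow> 0\<close> with \<open>F\<^sub>i = \<Oplus>\<^sub>a R(-a)\<close>, where \<open>a\<close> ranges over
  the list \<open>as ! i\<close>. The matrix \<open>Ms ! 0\<close> describes \<open>F\<^sub>0 \<rightarrow> J \<subseteq> R\<close>, and \<open>Ms ! i\<close> describes
  \<open>F\<^sub>i \<rightarrow> F\<^sub>i\<^sub>-\<^sub>1\<close> for \<open>i > 0\<close>.\<close>

definition graded_free_resolution ::
    "('n, 'k::comm_ring_1) mpoly set \<Rightarrow> int list list \<Rightarrow> ('n, 'k) mpoly mat list \<Rightarrow> bool" where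
  "graded_free_resolution J as Ms \<longleftrightarrow> length Ms = length as \<and>
     (\<forall>i<length as. graded_map (([0] # as) ! i) (as ! i) (Ms ! i)) \<and>
     J = (if Ms = [] then {0} else (\<lambda>v. v $ 0) ` mat_image (Ms ! 0)) \<and>
     (\<forall>i<length Ms. mat_kernel (Ms ! i) =
        (if Suc i < length Ms then mat_image (Ms ! Suc i) else {0\<^sub>v (dim_col (Ms ! i))}))"

text \<open>Minimality: the entries of the maps \<open>F\<^sub>i \<rightarrow> F\<^sub>i\<^sub>-\<^sub>1\<close> with \<open>i > 0\<close> lie in \<open>(x\<^sub>1, \<dots>, x\<^sub>n)\<close>, that is,
  they have no constant term.\<close>

definition minimal_graded_free_resolution ::
    "('n, 'k::comm_ring_1) mpoly set \<Rightarrow> int list list \<Rightarrow> ('n, 'k) mpoly mat list \<Rightarrow> bool" where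
  "minimal_graded_free_resolution J as Ms \<longleftrightarrow> graded_free_resolution J as Ms \<and>
     (\<forall>i. 0 < i \<and> i < length Ms \<longrightarrow> (\<forall>p\<in>elements_mat (Ms ! i). Poly_Mapping.lookup p 0 = 0))"

text \<open>The projective dimension of \<open>R/J\<close> for a homogeneous ideal \<open>J\<close>; for finitely generated graded
  modules over \<open>R\<close> it is computed by finite graded free resolutions. A resolution of \<open>J\<close> with \<open>r\<close>
  free modules is a resolution of \<open>R/J\<close> of length \<open>r\<close>.\<close>

definition proj_dim_quot :: "('n, 'k::comm_ring_1) mpoly set \<Rightarrow> nat" where
  "proj_dim_quot J = (LEAST r. \<exists>as Ms. length as = r \<and> graded_free_resolution J as Ms)"

definition perfect_of_height_two :: "('n, 'k::comm_ring_1) mpoly set \<Rightarrow> bool" where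
  "perfect_of_height_two J \<longleftrightarrow> height J = 2 \<and> proj_dim_quot J = 2"

section \<open>Bourbaki degree\<close>

definition syzygies :: "('n, 'k::comm_ring_1) mpoly vec \<Rightarrow> ('n, 'k) mpoly vec set" where
  "syzygies f = {v \<in> carrier_vec (dim_vec f). f \<bullet> v = 0}"

definition vec_form :: "int \<Rightarrow> ('n, 'k::zero) mpoly vec \<Rightarrow> bool" where
  "vec_form d v \<longleftrightarrow> (\<forall>i<dim_vec v. form d (v $ i))"

definition indeg :: "('n, 'k::zero) mpoly vec set \<Rightarrow> nat" where
  "indeg S = (LEAST d. \<exists>v\<in>S. v \<noteq> 0\<^sub>v (dim_vec v) \<and> vec_form (int d) v)"

text \<open>\<open>S/R\<nu>\<close> is isomorphic to the ideal \<open>I\<close> up to a shift. The isomorphism is given as a homogeneous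
  \<open>R\<close>-linear map on \<open>S\<close> with kernel \<open>R\<nu>\<close> and image \<open>I\<close>.\<close>

definition quot_iso_ideal ::
    "('n, 'k::comm_ring_1) mpoly vec set \<Rightarrow> ('n, 'k) mpoly vec \<Rightarrow> ('n, 'k) mpoly set \<Rightarrow> bool" where
  "quot_iso_ideal S \<nu> I \<longleftrightarrow> (\<exists>(\<phi> :: ('n, 'k) mpoly vec \<Rightarrow> ('n, 'k) mpoly) (s :: int).
     (\<forall>v\<in>S. \<forall>w\<in>S. \<phi> (v + w) = \<phi> v + \<phi> w) \<and>
     (\<forall>r. \<forall>v\<in>S. \<phi> (r \<cdot>\<^sub>v v) = r * \<phi> v) \<and>
     (\<forall>d. \<forall>v\<in>S. vec_form d v \<longrightarrow> form (d + s) (\<phi> v)) \<and>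
     {v \<in> S. \<phi> v = 0} = {r \<cdot>\<^sub>v \<nu> | r. True} \<and>
     \<phi> ` S = I)"

text \<open>\<open>I\<close> is an ideal \<open>I\<^sub>\<nu>\<close> for an ideal \<open>J\<close> minimally generated by three forms of equal degree. A
  nonzero homogeneous syzygy \<open>\<nu>\<close> of the least degree is automatically a minimal generator.\<close>

definition bourbaki_ideal :: "('n, 'k::comm_ring_1) mpoly set \<Rightarrow> ('n, 'k) mpoly set \<Rightarrow> bool" where
  "bourbaki_ideal J I \<longleftrightarrow> (\<exists>d. \<exists>f \<in> carrier_vec 3. \<exists>\<nu> \<in> syzygies f.
     min_gens d J f \<and>
     \<nu> \<noteq> 0\<^sub>v 3 \<and> vec_form (int (indeg (syzygies f))) \<nu> \<and>
     homogeneous_ideal I \<and> height I = 2 \<and> unmixed I \<and>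
     quot_iso_ideal (syzygies f) \<nu> I)"

text \<open>The description by \<open>THE\<close> includes that the value does not depend on the choices of the
  generators, of \<open>\<nu>\<close> and of \<open>I\<^sub>\<nu>\<close>.\<close>

definition bourbaki_degree :: "('n, 'k::field) mpoly set \<Rightarrow> rat" where
  "bourbaki_degree J = (if perfect_of_height_two J then 0
     else (THE b. \<exists>I. bourbaki_ideal J I \<and> b = quot_multiplicity I))"

end

theory Submission
  imports Defs "HOL-Library.Function_Algebras"
begin

text \<open>
  Let \<open>f\<close> be the vector of generators and \<open>\<nu>\<close> a syzygy of least degree; the entries of each have no common
  factor. As \<open>f \<bullet> \<nu> = 0\<close>, for a syzygy \<open>w\<close> the cross product \<open>\<nu> \<times> w\<close> is a multiple \<open>\<phi>(w) f\<close> of \<open>f\<close>. The map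
  \<open>\<phi>\<close> has kernel \<open>R\<nu>\<close>, and its image is the Bourbaki ideal, which contains the entries of \<open>\<nu>\<close>. Hence both
  multiplicities can be read off the Hilbert function of the resolution. Since \<open>J\<close> has codimension two, the
  linear coefficient of the numerator of the Hilbert series vanishes, that is,
  \<open>\<delta>\<^sub>1 + \<delta>\<^sub>2 = 3 + \<epsilon>\<^sub>1 + \<epsilon>\<^sub>2\<close>.

  The Koszul syzygies are mapped by \<open>\<phi>\<close> to the entries of \<open>\<nu>\<close>, so if the \<open>\<eta>\<^sub>j\<close> are the generating
  syzygies and \<open>\<nu> = \<eta>\<^sub>1\<close>, then each entry of \<open>\<nu>\<close> is a combination of \<open>\<phi>(\<eta>\<^sub>2), \<phi>(\<eta>\<^sub>3), \<phi>(\<eta>\<^sub>4)\<close> whose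
  coefficients have the degrees \<open>3 - \<delta>\<^sub>j\<close>. This gives \<open>\<delta>\<^sub>2 \<le> 3\<close>; if \<open>\<delta>\<^sub>3 > 3\<close>, the form \<open>\<phi>(\<eta>\<^sub>2)\<close> of
  positive degree would divide all entries of \<open>\<nu>\<close>. So \<open>\<delta>\<^sub>2 = \<delta>\<^sub>3 = 3\<close> and \<open>\<delta>\<^sub>1 \<in> {2, 3}\<close>. A similar
  divisibility argument for the first relation among the \<open>\<eta>\<^sub>j\<close> gives \<open>\<delta>\<^sub>4 < 3 + \<epsilon>\<^sub>1\<close>, which leaves three
  cases. They are realised by the ideals \<open>(x\<^sup>3, x\<^bsup>3-p\<^esup>z\<^sup>p + y\<^sup>3, y\<^bsup>3-q\<^esup>z\<^sup>q)\<close>, where \<open>(p, q)\<close> is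
  \<open>(1, 1)\<close>, \<open>(2, 1)\<close> or \<open>(2, 2)\<close>.

  To see that every associated prime \<open>P = I : a\<close> of the Bourbaki ideal \<open>I\<close> has height two, choose a
  maximal set \<open>Y\<close> of variables such that \<open>P\<close> contains no nonzero polynomial in \<open>Y\<close>. The residue ring of
  \<open>P\<close> grows at least like a polynomial of degree \<open>|Y|\<close>, and each step down a chain of primes raises
  this degree, so the height of \<open>P\<close> is at most \<open>n - |Y|\<close>. If there were three variables outside \<open>Y\<close>, then
  \<open>P\<close> would contain a polynomial in \<open>Y\<close> and each one of them, and since these three
  polynomials form a regular sequence after inverting the polynomials in \<open>Y\<close>, some nonzero polynomial in
  \<open>Y\<close> would multiply \<open>a\<close> into \<open>I\<close>.
\<close>

section \<open>Gradings\<close>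

text \<open>The Bourbaki degree is a definite description over all generating vectors, all \<nu> and
  all ideals isomorphic to the quotient, so every choice must give the same value. The dimensions of
  the graded pieces of the syzygy module depend only on J. Two embeddings of the quotient by \<nu>
  are proportional, and if both images have height two, hence no common factor, the ratio is a unit,
  so the images coincide. The branch of the definition for perfect J is excluded by comparing the
  given resolution with a shorter one.

  The linear coefficient vanishes by a sandwich: over an infinite field some combination of two
  generators is coprime to the third, so the Hilbert function of R/J lies between 0 and that of a
  complete intersection of two cubics.

  Absence of common factors stands in for height at least two, which is why unique factorization is
  established by Gauss's lemma.

  In the examples let a = (x^p, z^p, 0) and b = (0, y^q, z^q). The generators are the entries of
  x^(3-p) a + y^(3-q) b, and the syzygy of degree p + q is the cross product of a and b.\<close>

abbreviation (input) "lookup \<equiv> Poly_Mapping.lookup"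

abbreviation (input) "keys \<equiv> Poly_Mapping.keys"

lemma keys_empty_iff: "keys p = {} \<longleftrightarrow> p = 0"
proof
  assume "keys p = {}"
  then show "p = 0" by (intro poly_mapping_eqI) (auto simp: in_keys_iff)
qed simp

text \<open>The weight \<open>w\<close> is left open: total degree, degree in one variable and, for
  the prime ideal in \<open>height_J\<close>, degree in two variables are all instances.\<close>

definition wcomp :: "(('n \<Rightarrow>\<^sub>0 nat) \<Rightarrow> 'w) \<Rightarrow> 'w \<Rightarrow> ('n, 'k::zero) mpoly \<Rightarrow> ('n, 'k) mpoly" where
  "wcomp w d p = Poly_Mapping.mapp (\<lambda>m c. c when w m = d) p"

definition whom :: "(('n \<Rightarrow>\<^sub>0 nat) \<Rightarrow> 'w) \<Rightarrow> 'w \<Rightarrow> ('n, 'k::zero) mpoly \<Rightarrow> bool" where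
  "whom w d p \<longleftrightarrow> (\<forall>m\<in>keys p. w m = d)"

lemma lookup_wcomp: "lookup (wcomp w d p) m = (lookup p m when w m = d)"
  by (cases "m \<in> keys p") (auto simp: wcomp_def lookup_mapp when_def in_keys_iff)

lemma keys_wcomp: "keys (wcomp w d p) = {m \<in> keys p. w m = d}"
  by (auto simp: in_keys_iff lookup_wcomp)

lemma whom_wcomp [simp]: "whom w d (wcomp w d p)"
  by (auto simp: whom_def keys_wcomp)

lemma wcomp_0 [simp]: "wcomp w d 0 = 0"
  by (rule poly_mapping_eqI) (simp add: lookup_wcomp)

lemma wcomp_add: "wcomp w d (p + q) = wcomp w d p + wcomp w d (q :: ('n, 'k::comm_ring_1) mpoly)"
  by (rule poly_mapping_eqI) (simp add: lookup_wcomp lookup_add when_def)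

lemma wcomp_minus: "wcomp w d (p - q) = wcomp w d p - wcomp w d (q :: ('n, 'k::comm_ring_1) mpoly)"
  by (rule poly_mapping_eqI) (simp add: lookup_wcomp lookup_minus when_def)

lemma wcomp_sum: "wcomp w d (sum f A) = (\<Sum>a\<in>A. wcomp w d (f a :: ('n, 'k::comm_ring_1) mpoly))"
  by (induction A rule: infinite_finite_induct) (auto simp: wcomp_add)

lemma whom_0 [simp]: "whom w d 0"
  by (simp add: whom_def)

lemma whom_add: "whom w d p \<Longrightarrow> whom w d q \<Longrightarrow> whom w d (p + q :: ('n, 'k::comm_ring_1) mpoly)"
  using Poly_Mapping.keys_add[of p q] by (auto simp: whom_def)

lemma whom_uminus: "whom w d p \<Longrightarrow> whom w d (- p :: ('n, 'k::comm_ring_1) mpoly)"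
  by (auto simp: whom_def in_keys_iff)

lemma whom_sum:
  "(\<And>a. a \<in> A \<Longrightarrow> whom w d (f a)) \<Longrightarrow> whom w d (\<Sum>a\<in>A. f a :: ('n, 'k::comm_ring_1) mpoly)"
  by (induction A rule: infinite_finite_induct) (auto intro: whom_add)

lemma whom_mult:
  fixes p q :: "('n, 'k::comm_ring_1) mpoly"
  assumes "\<And>a b. w (a + b) = w a + w b" "whom w d p" "whom w e q"
  shows "whom w (d + e) (p * q)"
  using keys_mult[of p q] assms by (fastforce simp: whom_def)

lemma wcomp_whom: "whom w d p \<Longrightarrow> wcomp w e p = (p when e = d)"
  by (rule poly_mapping_eqI) (auto simp: lookup_wcomp whom_def when_def in_keys_iff)

lemma wcomp_eq_0: "(\<And>m. m \<in> keys p \<Longrightarrow> w m \<noteq> d) \<Longrightarrow> wcomp w d p = 0"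
  by (rule poly_mapping_eqI) (auto simp: lookup_wcomp when_def in_keys_iff)

lemma wcomp_decomp:
  fixes p :: "('n, 'k::comm_ring_1) mpoly"
  assumes "finite D" "w ` keys p \<subseteq> D"
  shows "p = (\<Sum>d\<in>D. wcomp w d p)"
proof (rule poly_mapping_eqI)
  fix m
  show "lookup p m = lookup (\<Sum>d\<in>D. wcomp w d p) m"
    using assms by (auto simp: lookup_sum lookup_wcomp when_def in_keys_iff image_subset_iff)
qed

locale weight =
  fixes w :: "('n \<Rightarrow>\<^sub>0 nat) \<Rightarrow> 'w::linordered_semidom"
  assumes weight_add: "w (a + b) = w a + w b"
begin

text \<open>The rest of \<open>p\<close> has no monomial of weight \<open>b\<close>, so its product
  with \<open>q\<close> has none of weight \<open>a + b\<close>.\<close>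

lemma wcomp_mult_whom:
  fixes p q :: "('n, 'k::comm_ring_1) mpoly"
  assumes "whom w a q"
  shows "wcomp w (a + b) (q * p) = q * wcomp w b p"
proof -
  have 1: "wcomp w (a + b) (q * wcomp w b p) = q * wcomp w b p"
    using wcomp_whom[OF whom_mult[OF weight_add assms whom_wcomp[of w b p]]] by simp
  have 2: "wcomp w (a + b) (q * (p - wcomp w b p)) = 0"
  proof (rule wcomp_eq_0)
    fix m assume "m \<in> keys (q * (p - wcomp w b p))"
    then obtain i j where "m = i + j" "i \<in> keys q" "j \<in> keys (p - wcomp w b p)"
      using keys_mult[of q "p - wcomp w b p"] by blast
    moreover then have "w j \<noteq> b"
      by (auto simp: in_keys_iff lookup_minus lookup_wcomp)
    ultimately show "w m \<noteq> a + b"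
      using assms by (auto simp: weight_add whom_def)
  qed
  have "q * p = q * wcomp w b p + q * (p - wcomp w b p)"
    by (simp add: algebra_simps)
  then show ?thesis
    using 1 2 by (metis wcomp_add add_0_right)
qed

text \<open>The monomials of \<open>p\<close> outside the part of weight \<open>a\<close> have
  smaller weight and cannot reach \<open>a + b\<close> in the product.\<close>

lemma wcomp_mult_top:
  fixes p q :: "('n, 'k::comm_ring_1) mpoly"
  assumes "\<And>m. m \<in> keys p \<Longrightarrow> w m \<le> a" "\<And>m. m \<in> keys q \<Longrightarrow> w m \<le> b"
  shows "wcomp w (a + b) (p * q) = wcomp w a p * wcomp w b q"
proof -
  have "wcomp w (a + b) ((p - wcomp w a p) * q) = 0"
  proof (rule wcomp_eq_0)
    fix m assume "m \<in> keys ((p - wcomp w a p) * q)"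
    then obtain i j where m: "m = i + j" "i \<in> keys (p - wcomp w a p)" "j \<in> keys q"
      using keys_mult[of "p - wcomp w a p" q] by blast
    have "i \<in> keys p \<and> w i \<noteq> a"
      using m(2) by (auto simp: in_keys_iff lookup_minus lookup_wcomp when_def split: if_splits)
    then have "w i < a" using assms(1)[of i] by auto
    then show "w m \<noteq> a + b"
      using assms(2)[OF m(3)] m(1) by (simp add: weight_add add_less_le_mono less_imp_neq)
  qed
  moreover have "p * q = wcomp w a p * q + (p - wcomp w a p) * q"
    by (simp add: algebra_simps)
  ultimately have "wcomp w (a + b) (p * q) = wcomp w (a + b) (wcomp w a p * q)"
    by (metis wcomp_add add_0_right)
  then show ?thesis
    using wcomp_mult_whom[OF whom_wcomp[of w a p]] by metis
qed

text \<open>Mirror image of \<open>wcomp_mult_top\<close>. With both bounds equal to 0 it makes the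
  part of weight 0 multiplicative, which gives constant terms and the substitution of 0 for some
  variables.\<close>

lemma wcomp_mult_bot:
  fixes p q :: "('n, 'k::comm_ring_1) mpoly"
  assumes "\<And>m. m \<in> keys p \<Longrightarrow> a \<le> w m" "\<And>m. m \<in> keys q \<Longrightarrow> b \<le> w m"
  shows "wcomp w (a + b) (p * q) = wcomp w a p * wcomp w b q"
proof -
  have "wcomp w (a + b) ((p - wcomp w a p) * q) = 0"
  proof (rule wcomp_eq_0)
    fix m assume "m \<in> keys ((p - wcomp w a p) * q)"
    then obtain i j where m: "m = i + j" "i \<in> keys (p - wcomp w a p)" "j \<in> keys q"
      using keys_mult[of "p - wcomp w a p" q] by blast
    have "i \<in> keys p \<and> w i \<noteq> a"
      using m(2) by (auto simp: in_keys_iff lookup_minus lookup_wcomp when_def split: if_splits)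
    then have "a < w i" using assms(1)[of i] by auto
    then have "a + b < w m"
      using assms(2)[OF m(3)] m(1) by (simp add: weight_add add_less_le_mono)
    then show "w m \<noteq> a + b" by simp
  qed
  moreover have "p * q = wcomp w a p * q + (p - wcomp w a p) * q"
    by (simp add: algebra_simps)
  ultimately have "wcomp w (a + b) (p * q) = wcomp w (a + b) (wcomp w a p * q)"
    by (metis wcomp_add add_0_right)
  then show ?thesis
    using wcomp_mult_whom[OF whom_wcomp[of w a p]] by metis
qed

end

text \<open>For \<open>p = 0\<close> this is the maximum of the empty set, hence unspecified;
  statements about degrees therefore treat 0 separately.\<close>

definition wdeg :: "(('n \<Rightarrow>\<^sub>0 nat) \<Rightarrow> 'w::linorder) \<Rightarrow> ('n, 'k::zero) mpoly \<Rightarrow> 'w" where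
  "wdeg w p = Max (w ` keys p)"

definition wlow :: "(('n \<Rightarrow>\<^sub>0 nat) \<Rightarrow> 'w::linorder) \<Rightarrow> ('n, 'k::zero) mpoly \<Rightarrow> 'w" where
  "wlow w p = Min (w ` keys p)"

lemma wdeg_ge: "m \<in> keys p \<Longrightarrow> w m \<le> wdeg w p"
  by (simp add: wdeg_def)

lemma wlow_le: "m \<in> keys p \<Longrightarrow> wlow w p \<le> w m"
  by (simp add: wlow_def)

lemma wdeg_in: "p \<noteq> 0 \<Longrightarrow> \<exists>m\<in>keys p. w m = wdeg w p"
proof -
  assume "p \<noteq> 0"
  then have "Max (w ` keys p) \<in> w ` keys p" by (intro Max_in) (auto simp: keys_empty_iff)
  then show ?thesis unfolding wdeg_def by (metis imageE)
qed

lemma wlow_in: "p \<noteq> 0 \<Longrightarrow> \<exists>m\<in>keys p. w m = wlow w p"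
proof -
  assume "p \<noteq> 0"
  then have "Min (w ` keys p) \<in> w ` keys p" by (intro Min_in) (auto simp: keys_empty_iff)
  then show ?thesis unfolding wlow_def by (metis imageE)
qed

lemma wcomp_wdeg_neq_0: "p \<noteq> 0 \<Longrightarrow> wcomp w (wdeg w p) p \<noteq> 0"
  using wdeg_in[of p w] keys_wcomp[of w "wdeg w p" p] by fastforce

lemma wcomp_wlow_neq_0: "p \<noteq> 0 \<Longrightarrow> wcomp w (wlow w p) p \<noteq> 0"
  using wlow_in[of p w] keys_wcomp[of w "wlow w p" p] by fastforce

lemma wdeg_eqI: "wcomp w d p \<noteq> 0 \<Longrightarrow> (\<And>m. m \<in> keys p \<Longrightarrow> w m \<le> d) \<Longrightarrow> wdeg w p = d"
  unfolding wdeg_def by (rule Max_eqI) (use keys_wcomp[of w d p] keys_empty_iff[of "wcomp w d p"] in auto)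

lemma wlow_eqI: "wcomp w d p \<noteq> 0 \<Longrightarrow> (\<And>m. m \<in> keys p \<Longrightarrow> d \<le> w m) \<Longrightarrow> wlow w p = d"
  unfolding wlow_def by (rule Min_eqI) (use keys_wcomp[of w d p] keys_empty_iff[of "wcomp w d p"] in auto)

lemma whom_wdeg: "whom w d p \<Longrightarrow> p \<noteq> 0 \<Longrightarrow> wdeg w p = d"
  using wdeg_in[of p w] by (auto simp: whom_def)

lemma whom_iff_wdeg_wlow: "p \<noteq> 0 \<Longrightarrow> whom w d p \<longleftrightarrow> wdeg w p = d \<and> wlow w p = d"
  using wdeg_in[of p w] wlow_in[of p w] wdeg_ge[of _ p w] wlow_le[of _ p w] unfolding whom_def
  by (metis order_antisym)

lemma wdeg_le: "p \<noteq> 0 \<Longrightarrow> (\<And>m. m \<in> keys p \<Longrightarrow> w m \<le> d) \<Longrightarrow> wdeg w p \<le> d"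
  using wdeg_in[of p w] by metis

lemma wlow_le_wdeg: "p \<noteq> 0 \<Longrightarrow> wlow w p \<le> wdeg w p"
  using wdeg_in[of p w] wlow_le[of _ p w] by metis

lemma wdeg_mult:
  fixes w :: "('n::linorder \<Rightarrow>\<^sub>0 nat) \<Rightarrow> 'w::linordered_semidom" and p q :: "('n::linorder, 'k::idom) mpoly"
  assumes w: "weight w" and "p \<noteq> 0" "q \<noteq> 0"
  shows "wdeg w (p * q) = wdeg w p + wdeg w q"
proof (rule wdeg_eqI)
  have "wcomp w (wdeg w p + wdeg w q) (p * q) = wcomp w (wdeg w p) p * wcomp w (wdeg w q) q"
    by (rule weight.wcomp_mult_top[OF w]) (auto simp: wdeg_ge)
  then show "wcomp w (wdeg w p + wdeg w q) (p * q) \<noteq> 0"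
    using assms wcomp_wdeg_neq_0 by auto
  fix m assume "m \<in> keys (p * q)"
  then show "w m \<le> wdeg w p + wdeg w q"
    using keys_mult[of p q] by (auto simp: weight.weight_add[OF w] intro!: add_mono wdeg_ge)
qed

lemma wlow_mult:
  fixes w :: "('n::linorder \<Rightarrow>\<^sub>0 nat) \<Rightarrow> 'w::linordered_semidom" and p q :: "('n::linorder, 'k::idom) mpoly"
  assumes w: "weight w" and "p \<noteq> 0" "q \<noteq> 0"
  shows "wlow w (p * q) = wlow w p + wlow w q"
proof (rule wlow_eqI)
  have "wcomp w (wlow w p + wlow w q) (p * q) = wcomp w (wlow w p) p * wcomp w (wlow w q) q"
    by (rule weight.wcomp_mult_bot[OF w]) (auto simp: wlow_le)
  then show "wcomp w (wlow w p + wlow w q) (p * q) \<noteq> 0"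
    using assms wcomp_wlow_neq_0 by auto
  fix m assume "m \<in> keys (p * q)"
  then show "wlow w p + wlow w q \<le> w m"
    using keys_mult[of p q] by (auto simp: weight.weight_add[OF w] intro!: add_mono wlow_le)
qed

text \<open>Highest and lowest weight are both additive. In a homogeneous product they agree, which
  leaves no gap between them in either factor.\<close>

lemma whom_factor:
  fixes w :: "('n::linorder \<Rightarrow>\<^sub>0 nat) \<Rightarrow> 'w::linordered_semidom" and p q :: "('n::linorder, 'k::idom) mpoly"
  assumes w: "weight w" and "whom w d (p * q)" "p * q \<noteq> 0"
  shows "whom w (wdeg w p) p"
proof -
  have nz: "p \<noteq> 0" "q \<noteq> 0" using assms(3) by auto
  have "wdeg w p + wdeg w q = wlow w p + wlow w q"
    using whom_iff_wdeg_wlow[OF assms(3), of w d] assms(2) wdeg_mult[OF w nz] wlow_mult[OF w nz] by metis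
  moreover have "wlow w p \<le> wdeg w p" "wlow w q \<le> wdeg w q"
    using wlow_le_wdeg nz by auto
  ultimately have "wlow w p = wdeg w p"
    by (metis add_less_le_mono less_irrefl order_le_less)
  then show ?thesis using whom_iff_wdeg_wlow[OF nz(1)] by metis
qed

subsection \<open>Total degree\<close>

lemma mdeg_eq: "mdeg (m :: 'n::finite \<Rightarrow>\<^sub>0 nat) = (\<Sum>x\<in>UNIV. lookup m x)"
  unfolding mdeg_def by (rule sum.mono_neutral_left) (auto simp: in_keys_iff)

lemma mdeg_add: "mdeg (a + b) = mdeg a + mdeg (b :: 'n::finite \<Rightarrow>\<^sub>0 nat)"
  by (simp add: mdeg_eq lookup_add sum.distrib)

lemma mdeg_0 [simp]: "mdeg 0 = 0"
  by (simp add: mdeg_def)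

lemma mdeg_eq_0: "mdeg m = 0 \<longleftrightarrow> m = 0"
  unfolding mdeg_def by (auto simp: in_keys_iff intro: poly_mapping_eqI)

interpretation tdeg: weight "\<lambda>m :: 'n::finite \<Rightarrow>\<^sub>0 nat. int (mdeg m)"
  by standard (simp add: mdeg_add)

interpretation zdeg: weight "\<lambda>m :: 'n \<Rightarrow>\<^sub>0 nat. lookup m z" for z
  by standard (simp add: lookup_add)

abbreviation hcomp :: "int \<Rightarrow> ('n, 'k::zero) mpoly \<Rightarrow> ('n, 'k) mpoly" where
  "hcomp \<equiv> wcomp (\<lambda>m. int (mdeg m))"

abbreviation tdeg :: "('n, 'k::zero) mpoly \<Rightarrow> int" where
  "tdeg \<equiv> wdeg (\<lambda>m. int (mdeg m))"

lemma form_eq_whom: "form d p \<longleftrightarrow> whom (\<lambda>m. int (mdeg m)) d p"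
  by (simp add: form_def whom_def)

abbreviation Const :: "'k::zero \<Rightarrow> ('n, 'k) mpoly" where
  "Const c \<equiv> Poly_Mapping.single 0 c"

lemma tdeg_nonneg: "p \<noteq> 0 \<Longrightarrow> 0 \<le> tdeg p"
  using wdeg_in[of p "\<lambda>m. int (mdeg m)"] by auto

lemma tdeg_eq_0: 
  assumes "p \<noteq> 0" "tdeg p = 0" shows "p = Const (lookup p 0)"
proof (rule poly_mapping_eqI)
  fix m show "lookup p m = lookup (Const (lookup p 0)) m"
  proof (cases "m \<in> keys p")
    case True
    then have "int (mdeg m) \<le> 0" using wdeg_ge[OF True, of "\<lambda>m. int (mdeg m)"] assms by simp
    then have "m = 0" using mdeg_eq_0[of m] by simp
    then show ?thesis by simp
  next
    case False
    then show ?thesis by (auto simp: lookup_single when_def in_keys_iff)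
  qed
qed

lemma Const_mult: "Const a * Const b = (Const (a * b) :: ('n, 'k::comm_ring_1) mpoly)"
  by (simp add: mult_single)

lemma Const_eq_0 [simp]: "Const a = 0 \<longleftrightarrow> a = 0"
  by (metis lookup_single_eq lookup_zero single_zero)

lemma Const_unit: 
  assumes "(c::'k::field) \<noteq> 0" shows "(Const c :: ('n, 'k) mpoly) dvd 1"
proof -
  have "Const c * Const (inverse c) = (1 :: ('n, 'k) mpoly)"
    using assms by (simp add: Const_mult single_one)
  then show ?thesis by (metis dvd_triv_left)
qed

lemma tdeg_mult:
  fixes p q :: "('n::{finite,linorder}, 'k::idom) mpoly"
  assumes "p \<noteq> 0" "q \<noteq> 0"
  shows "tdeg (p * q) = tdeg p + tdeg q"
  using wdeg_mult[OF tdeg.weight_axioms assms] .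

lemma tdeg_Const: "c \<noteq> 0 \<Longrightarrow> tdeg (Const c) = 0"
  by (simp add: wdeg_def)

text \<open>Degrees are nonnegative and add up in a product, so a unit has degree 0; a nonzero
  polynomial of degree 0 is an invertible constant.\<close>

lemma is_unit_iff_tdeg:
  fixes p :: "('n::{finite,linorder}, 'k::field) mpoly"
  shows "p dvd 1 \<longleftrightarrow> p \<noteq> 0 \<and> tdeg p = 0"
proof
  assume "p dvd 1"
  then obtain q where q: "p * q = 1" by (metis dvdE)
  then have nz: "p \<noteq> 0" "q \<noteq> 0" by (metis mult_zero_left zero_neq_one, metis mult_zero_right zero_neq_one)
  have "tdeg (p * q) = 0" using q tdeg_Const[of "1::'k"] by simp
  then show "p \<noteq> 0 \<and> tdeg p = 0"
    using tdeg_mult[OF nz] tdeg_nonneg[OF nz(1)] tdeg_nonneg[OF nz(2)] nz by simp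
next
  assume "p \<noteq> 0 \<and> tdeg p = 0"
  then show "p dvd 1" using tdeg_eq_0[of p] Const_unit[of "lookup p 0"] by (metis Const_eq_0)
qed

lemma irreducible_factor_exists:
  fixes p :: "('n::{finite,linorder}, 'k::field) mpoly"
  assumes "p \<noteq> 0" "\<not> p dvd 1"
  shows "\<exists>q. irreducible q \<and> q dvd p"
  using assms
proof (induction "nat (tdeg p)" arbitrary: p rule: less_induct)
  case less
  show ?case
  proof (cases "irreducible p")
    case False
    then obtain a b where ab: "p = a * b" "\<not> a dvd 1" "\<not> b dvd 1"
      using less.prems by (auto simp: irreducible_def)
    then have nz: "a \<noteq> 0" "b \<noteq> 0" using less.prems by auto
    have "tdeg b > 0" using ab(3) nz tdeg_nonneg[OF nz(2)] is_unit_iff_tdeg[of b] by linarith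
    then have "nat (tdeg a) < nat (tdeg p)"
      using tdeg_mult[OF nz] tdeg_nonneg[OF nz(1)] ab(1) by simp
    from less.hyps[OF this nz(1) ab(2)] show ?thesis using ab(1) by (metis dvd_mult2)
  qed (use less.prems in auto)
qed

lemma form_factor:
  fixes p q :: "('n::{finite,linorder}, 'k::idom) mpoly"
  assumes "form d (p * q)" "form e q" "q \<noteq> 0"
  shows "form (d - e) p"
proof (cases "p = 0")
  case False
  have "p * q \<noteq> 0" using False assms by simp
  moreover have "whom (\<lambda>m. int (mdeg m)) d (p * q)" using assms(1) by (simp add: form_eq_whom)
  ultimately have 1: "whom (\<lambda>m. int (mdeg m)) (tdeg p) p" using whom_factor[OF tdeg.weight_axioms] by blast
  have "tdeg p + tdeg q = d" using tdeg_mult[OF False assms(3)] whom_wdeg[OF \<open>whom _ d (p*q)\<close> \<open>p * q \<noteq> 0\<close>] by simp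
  moreover have "tdeg q = e" using whom_wdeg assms by (metis form_eq_whom)
  ultimately have "d - e = tdeg p" by simp
  then show ?thesis using 1 by (simp only: form_eq_whom)
qed (simp add: form_def)

lemma hcomp_mult:
  fixes p q :: "('n::finite, 'k::comm_ring_1) mpoly"
  assumes "form a q"
  shows "hcomp d (q * p) = q * hcomp (d - a) p"
  using tdeg.wcomp_mult_whom[of a q "d - a" p] assms by (simp add: form_eq_whom)

lemma form_hcomp [simp]: "form d (hcomp d p)"
  by (simp add: form_eq_whom)

lemma form_0 [simp]: "form d 0" by (simp add: form_def)

lemma form_add: "form d p \<Longrightarrow> form d q \<Longrightarrow> form d (p + q :: ('n, 'k::comm_ring_1) mpoly)"
  by (simp add: form_eq_whom whom_add)

lemma form_sum: "(\<And>a. a \<in> A \<Longrightarrow> form d (f a)) \<Longrightarrow> form d (\<Sum>a\<in>A. f a :: ('n, 'k::comm_ring_1) mpoly)"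
  by (simp add: form_eq_whom whom_sum)

lemma form_mult: "form d p \<Longrightarrow> form e q \<Longrightarrow> form (d + e) (p * q :: ('n::finite, 'k::comm_ring_1) mpoly)"
  unfolding form_eq_whom by (rule whom_mult) (auto simp: mdeg_add)

lemma form_Const [simp]: "form 0 (Const c)"
  by (simp add: form_def)

lemma form_neg: "form d p \<Longrightarrow> d < 0 \<Longrightarrow> p = 0"
  by (metis ex_in_conv form_def keys_empty_iff not_less of_nat_0_le_iff)

lemma hcomp_form: "form d p \<Longrightarrow> hcomp e p = (p when e = d)"
  by (simp add: form_eq_whom wcomp_whom)

lemma form_0_Const: "form 0 p \<Longrightarrow> p = Const (lookup p 0)"
  by (metis form_eq_whom lookup_zero single_zero tdeg_eq_0 whom_wdeg)

lemma form_tdeg: "form d p \<Longrightarrow> p \<noteq> 0 \<Longrightarrow> tdeg p = d"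
  by (simp add: form_eq_whom whom_wdeg)

lemma form_dvd_tdeg_le:
  fixes p q :: "('n::{finite,linorder}, 'k::idom) mpoly"
  assumes "p dvd q" "q \<noteq> 0"
  shows "tdeg p \<le> tdeg q"
proof -
  obtain r where "q = p * r" using assms(1) by blast
  then show ?thesis using assms(2) tdeg_mult[of p r] tdeg_nonneg[of r] by auto
qed

section \<open>Unique factorization\<close>

text \<open>A subring of one fixed type, so that an induction on the set of variables never changes
  the type.\<close>

definition polys :: "'n set \<Rightarrow> ('n, 'k::zero) mpoly set" where
  "polys A = {p. \<forall>m\<in>keys p. keys m \<subseteq> A}"

lemma polys_UNIV [simp]: "polys UNIV = UNIV"
  by (simp add: polys_def)

lemma polys_0 [simp]: "0 \<in> polys A"
  by (simp add: polys_def)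

lemma polys_Const [simp]: "Const c \<in> polys A"
  by (simp add: polys_def)

lemma polys_1 [simp]: "1 \<in> polys A"
  by (simp add: polys_def)

lemma polys_mono: "A \<subseteq> B \<Longrightarrow> polys A \<subseteq> polys B"
  by (auto simp: polys_def)

lemma polys_add: "p \<in> polys A \<Longrightarrow> q \<in> polys A \<Longrightarrow> p + q \<in> polys A"
  using Poly_Mapping.keys_add[of p q] by (fastforce simp: polys_def)

lemma polys_uminus: "p \<in> polys A \<Longrightarrow> - p \<in> polys A" for p :: "('n, 'k::comm_ring_1) mpoly"
  by (simp add: polys_def in_keys_iff)

lemma polys_minus: "p \<in> polys A \<Longrightarrow> q \<in> polys A \<Longrightarrow> p - q \<in> polys A"
  for p :: "('n, 'k::comm_ring_1) mpoly"
  using polys_add[OF _ polys_uminus, of p A q] by simp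

lemma polys_mult: "p \<in> polys A \<Longrightarrow> q \<in> polys A \<Longrightarrow> p * q \<in> polys A"
  for p :: "('n, 'k::comm_ring_1) mpoly"
proof -
  assume p: "p \<in> polys A" and q: "q \<in> polys A"
  show "p * q \<in> polys A" unfolding polys_def
  proof safe
    fix m x assume m: "m \<in> keys (p * q)" "x \<in> keys m"
    then obtain a b where "m = a + b" "a \<in> keys p" "b \<in> keys q" using keys_mult[of p q] by blast
    then show "x \<in> A" using m(2) p q Poly_Mapping.keys_add[of a b] unfolding polys_def by blast
  qed
qed

lemma polys_power: "p \<in> polys A \<Longrightarrow> p ^ k \<in> polys A" for p :: "('n, 'k::comm_ring_1) mpoly"
  by (induction k) (auto intro: polys_mult)

lemma polys_sum: "(\<And>a. a \<in> S \<Longrightarrow> f a \<in> polys A) \<Longrightarrow> sum f S \<in> polys A"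
  for f :: "'b \<Rightarrow> ('n, 'k::comm_ring_1) mpoly"
  by (induction S rule: infinite_finite_induct) (auto intro: polys_add)

lemma polys_wcomp: "p \<in> polys A \<Longrightarrow> wcomp w d p \<in> polys A"
  by (auto simp: polys_def keys_wcomp)

abbreviation zdeg :: "'n \<Rightarrow> ('n, 'k::zero) mpoly \<Rightarrow> nat" where
  "zdeg z \<equiv> wdeg (\<lambda>m. lookup m z)"

abbreviation zcomp :: "'n \<Rightarrow> nat \<Rightarrow> ('n, 'k::zero) mpoly \<Rightarrow> ('n, 'k) mpoly" where
  "zcomp z \<equiv> wcomp (\<lambda>m. lookup m z)"

abbreviation zhom :: "'n \<Rightarrow> nat \<Rightarrow> ('n, 'k::zero) mpoly \<Rightarrow> bool" where
  "zhom z \<equiv> whom (\<lambda>m. lookup m z)"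

lemma polys_zhom: "p \<in> polys A \<Longrightarrow> z \<notin> A \<Longrightarrow> zhom z 0 p"
  unfolding polys_def whom_def using in_keys_iff[of z] by blast

lemma polys_iff_zdeg: 
  assumes "p \<noteq> 0"
  shows "p \<in> polys A \<longleftrightarrow> (\<forall>z. z \<notin> A \<longrightarrow> zdeg z p = 0)"
proof
  assume "p \<in> polys A"
  then show "\<forall>z. z \<notin> A \<longrightarrow> zdeg z p = 0"
    by (intro allI impI whom_wdeg polys_zhom assms)
next
  assume *: "\<forall>z. z \<notin> A \<longrightarrow> zdeg z p = 0"
  show "p \<in> polys A" unfolding polys_def
  proof safe
    fix m x assume m: "m \<in> keys p" "x \<in> keys m"
    show "x \<in> A"
    proof (rule ccontr)
      assume "x \<notin> A"
      then have "lookup m x \<le> 0" using * wdeg_ge[OF m(1), of "\<lambda>m. lookup m x"] by simp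
      with m(2) show False by (simp add: in_keys_iff)
    qed
  qed
qed

lemma zdeg_mult:
  fixes p q :: "('n::linorder, 'k::idom) mpoly"
  assumes "p \<noteq> 0" "q \<noteq> 0"
  shows "zdeg z (p * q) = zdeg z p + zdeg z q"
  using wdeg_mult[OF zdeg.weight_axioms assms] .

lemma polys_factor:
  fixes p q :: "('n::linorder, 'k::idom) mpoly"
  assumes "p * q \<in> polys A" "p * q \<noteq> 0"
  shows "p \<in> polys A" "q \<in> polys A"
proof -
  have nz: "p \<noteq> 0" "q \<noteq> 0" using assms by auto
  have "\<forall>z. z \<notin> A \<longrightarrow> zdeg z p + zdeg z q = 0"
    using assms zdeg_mult[OF nz] polys_iff_zdeg by metis
  then show "p \<in> polys A" "q \<in> polys A" using polys_iff_zdeg nz by auto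
qed

section \<open>Powers of a variable and coefficients with respect to it\<close>

lemma poly_mapping_sum_single: "p = (\<Sum>m\<in>keys p. Poly_Mapping.single m (lookup p m))"
proof (rule poly_mapping_eqI)
  fix m show "lookup p m = lookup (\<Sum>m\<in>keys p. Poly_Mapping.single m (lookup p m)) m"
    by (auto simp: lookup_sum lookup_single when_def in_keys_iff)
qed

abbreviation Xpow :: "'n \<Rightarrow> nat \<Rightarrow> ('n, 'k::zero_neq_one) mpoly" where
  "Xpow z i \<equiv> Poly_Mapping.single (Poly_Mapping.single z i) 1"

lemma Xpow_neq_0 [simp]: "Xpow z i \<noteq> (0 :: ('n, 'k::zero_neq_one) mpoly)"
  by (metis lookup_single_eq lookup_zero zero_neq_one)

lemma Xpow_mult: "Xpow z i * Xpow z j = (Xpow z (i + j) :: ('n, 'k::comm_ring_1) mpoly)"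
  by (simp add: mult_single single_add)

lemma zhom_Xpow: "zhom z i (Xpow z i)"
  by (auto simp: whom_def)

lemma Xpow_polys: "z \<in> A \<Longrightarrow> Xpow z i \<in> polys A"
  by (auto simp: polys_def)

lemma zcoef_exists:
  fixes p :: "('n, 'k::comm_ring_1) mpoly"
  assumes "p \<in> polys B" "zhom z i p"
  shows "\<exists>c\<in>polys (B - {z}). p = c * Xpow z i"
proof -
  define c where "c = (\<Sum>m\<in>keys p. Poly_Mapping.single (m - Poly_Mapping.single z i) (lookup p m))"
  have "m - Poly_Mapping.single z i + Poly_Mapping.single z i = m" if "m \<in> keys p" for m
    using that assms(2) by (intro poly_mapping_eqI) (auto simp: lookup_add lookup_minus lookup_single when_def whom_def)
  then have "c * Xpow z i = (\<Sum>m\<in>keys p. Poly_Mapping.single m (lookup p m))"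
    unfolding c_def sum_distrib_right by (intro sum.cong) (auto simp: mult_single)
  then have 1: "p = c * Xpow z i" using poly_mapping_sum_single by metis
  have "keys (m - Poly_Mapping.single z i) \<subseteq> B - {z}" if "m \<in> keys p" for m
  proof
    fix x assume x: "x \<in> keys (m - Poly_Mapping.single z i)"
    have "lookup m z = i" "keys m \<subseteq> B" using that assms by (auto simp: whom_def polys_def)
    moreover from this x have "x \<noteq> z" "lookup m x \<noteq> 0"
      by (auto simp: in_keys_iff lookup_minus lookup_single when_def split: if_splits)
    ultimately show "x \<in> B - {z}" using in_keys_iff[of x m] by blast
  qed
  then have "c \<in> polys (B - {z})"
    unfolding c_def by (intro polys_sum) (auto simp: polys_def)
  then show ?thesis using 1 by blast
qed

lemma wcomp_0_wdeg_less:
  assumes "wcomp w d p = 0" "\<And>m. m \<in> keys p \<Longrightarrow> w m \<le> d" "p \<noteq> 0"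
  shows "wdeg w p < d"
proof -
  have "wdeg w p \<le> d" using wdeg_le[OF assms(3), of w d] assms(2) by blast
  moreover have "wdeg w p \<noteq> d" using wcomp_wdeg_neq_0[OF assms(3), of w] assms(1) by auto
  ultimately show ?thesis by simp
qed

lemma keys_minus_le: "m \<in> keys (p - q) \<Longrightarrow> m \<in> keys p \<or> m \<in> keys q"
  for p :: "('n, 'k::comm_ring_1) mpoly"
  by (auto simp: in_keys_iff lookup_minus)

lemma keys_mult_le_wdeg:
  assumes w: "weight w" and "m \<in> keys (p * q)"
  shows "w m \<le> wdeg w p + wdeg w (q :: ('n, 'k::comm_ring_1) mpoly)"
proof -
  obtain a b where "m = a + b" "a \<in> keys p" "b \<in> keys q"
    using assms(2) keys_mult[of p q] by blast
  then show ?thesis using weight.weight_add[OF w] wdeg_ge[of a p w] wdeg_ge[of b q w] by (simp add: add_mono)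
qed

text \<open>Division with remainder in the variable \<open>z\<close>. The leading coefficient
  \<open>l\<close> need not be invertible, so every step of the division costs a factor
  \<open>l\<close>.\<close>

lemma pseudo_division:
  fixes q c l :: "('n::linorder, 'k::idom) mpoly"
  assumes "z \<in> B" "q \<in> polys B" "q \<noteq> 0" "l \<in> polys B" "zhom z 0 l"
    and top: "zcomp z (zdeg z q) q = l * Xpow z (zdeg z q)"
    and "c \<in> polys B"
  shows "\<exists>k. \<exists>a\<in>polys B. \<exists>r\<in>polys B. l ^ k * c = q * a + r \<and> (r = 0 \<or> zdeg z r < zdeg z q)"
  using \<open>c \<in> polys B\<close>
proof (induction "zdeg z c" arbitrary: c rule: less_induct)
  case less
  show ?case
  proof (cases "c = 0 \<or> zdeg z c < zdeg z q")
    case True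
    then show ?thesis using less.prems by (intro exI[of _ 0] bexI[of _ 0] bexI[of _ c]) auto
  next
    case False
    define n where "n = zdeg z c"
    define d where "d = zdeg z q"
    have nd: "d \<le> n" "c \<noteq> 0" using False by (auto simp: n_def d_def)
    obtain c' where c': "c' \<in> polys (B - {z})" "zcomp z n c = c' * Xpow z n"
      using zcoef_exists[OF polys_wcomp[OF less.prems] whom_wcomp] by blast
    define t where "t = c' * Xpow z (n - d)"
    have tz: "zhom z (n - d) t"
      using whom_mult[OF zdeg.weight_add polys_zhom[OF c'(1)] zhom_Xpow[of z "n-d"]] by (simp add: t_def)
    have tB: "t \<in> polys B" using c'(1) assms(1) polys_mono[of "B - {z}" B]
      by (auto simp: t_def intro!: polys_mult Xpow_polys)
    \<comment> \<open>In degree \<open>n\<close> both \<open>l * c\<close> and \<open>t * q\<close>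
      have the coefficient \<open>l * c'\<close>, so their difference has smaller degree in
      \<open>z\<close> or is 0.\<close>
    define c1 where "c1 = l * c - t * q"
    have c1B: "c1 \<in> polys B" unfolding c1_def using assms tB less.prems by (intro polys_minus polys_mult) auto
    have "zcomp z n (l * c) = l * (c' * Xpow z n)"
      using zdeg.wcomp_mult_whom[OF assms(5), of n c] c'(2) by simp
    moreover have "zcomp z n (t * q) = t * (l * Xpow z d)"
      using zdeg.wcomp_mult_whom[OF tz, of d q] top nd by (simp add: d_def)
    moreover have "t * (l * Xpow z d) = l * (c' * (Xpow z (n - d) * Xpow z d))"
      by (simp add: t_def algebra_simps)
    ultimately have 0: "zcomp z n c1 = 0"
      using nd by (simp only: c1_def wcomp_minus Xpow_mult) simp
    have le: "lookup m z \<le> n" if mk: "m \<in> keys c1" for m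
    proof -
      consider "m \<in> keys (l * c)" | "m \<in> keys (t * q)" using keys_minus_le[of m "l * c" "t * q"] mk unfolding c1_def by blast
      then show ?thesis
      proof cases
        case 1
        then show ?thesis using keys_mult_le_wdeg[OF zdeg.weight_axioms[of z] 1] whom_wdeg[OF assms(5)]
          by (cases "l = 0") (auto simp: n_def)
      next
        case 2
        then have "t \<noteq> 0" by auto
        then show ?thesis using keys_mult_le_wdeg[OF zdeg.weight_axioms[of z] 2] whom_wdeg[OF tz] nd by (simp add: d_def)
      qed
    qed
    have "\<exists>k. \<exists>a\<in>polys B. \<exists>r\<in>polys B. l ^ k * c1 = q * a + r \<and> (r = 0 \<or> zdeg z r < zdeg z q)"
    proof (cases "c1 = 0")
      case True
      then show ?thesis by (intro exI[of _ 0] bexI[of _ 0]) auto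
    next
      case False
      from wcomp_0_wdeg_less[OF 0 le False] less.hyps[OF _ c1B] show ?thesis by (simp add: n_def)
    qed
    then obtain k a r where k: "a \<in> polys B" "r \<in> polys B" "l ^ k * c1 = q * a + r" "r = 0 \<or> zdeg z r < zdeg z q"
      by blast
    have "l ^ Suc k * c = q * (a + l ^ k * t) + r"
      using k(3) by (simp add: c1_def algebra_simps)
    moreover have "a + l ^ k * t \<in> polys B" using k tB assms by (intro polys_add polys_mult polys_power)
    ultimately show ?thesis using k by blast
  qed
qed

text \<open>Only the factors are confined to \<open>D\<close>; divisibility refers to the whole
  ring, which avoids tracking where cofactors lie.\<close>

definition prime_on :: "'a::comm_ring_1 set \<Rightarrow> 'a \<Rightarrow> bool" where
  "prime_on D p \<longleftrightarrow> (\<forall>g\<in>D. \<forall>h\<in>D. p dvd g * h \<longrightarrow> p dvd g \<or> p dvd h)"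

lemma dvd_zcomp:
  fixes p e :: "('n, 'k::comm_ring_1) mpoly"
  assumes "zhom z 0 p" "p dvd e"
  shows "p dvd zcomp z i e"
proof -
  obtain t where "e = p * t" using assms(2) by blast
  then show ?thesis using zdeg.wcomp_mult_whom[OF assms(1), of i t] by simp
qed

text \<open>Preparation for Gauss's lemma: the coefficients above the last one not divisible by
  \<open>p\<close> are themselves multiples of \<open>p\<close>. Removing them does not change
  \<open>g\<close> modulo \<open>p\<close> and makes that coefficient the leading one.\<close>

lemma top_nondivisible_comp:
  fixes p g :: "('n, 'k::comm_ring_1) mpoly"
  assumes p: "zhom z 0 p" and "\<not> p dvd g"
  shows "\<exists>i g'. \<not> p dvd zcomp z i g \<and> p dvd g - g' \<and> zcomp z i g' = zcomp z i g \<and> (\<forall>m\<in>keys g'. lookup m z \<le> i)"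
proof -
  define D where "D = (\<lambda>m. lookup m z) ` keys g"
  have D: "finite D" "g = (\<Sum>d\<in>D. zcomp z d g)"
    using wcomp_decomp[of D "\<lambda>m. lookup m z" g] by (auto simp: D_def)
  define S where "S = {d\<in>D. \<not> p dvd zcomp z d g}"
  have "S \<noteq> {}"
  proof
    assume "S = {}"
    then have "p dvd (\<Sum>d\<in>D. zcomp z d g)" by (intro dvd_sum) (auto simp: S_def)
    then show False using D assms by simp
  qed
  moreover have "finite S" using D by (simp add: S_def)
  ultimately have i: "Max S \<in> S" "\<And>d. d \<in> S \<Longrightarrow> d \<le> Max S" by auto
  define i where "i = Max S"
  define e where "e = (\<Sum>d\<in>{d\<in>D. i < d}. zcomp z d g)"
  have lk: "lookup e m = (lookup g m when i < lookup m z)" for m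
    using D(1) by (auto simp: e_def lookup_sum lookup_wcomp when_def in_keys_iff D_def)
  have "p dvd e" unfolding e_def using i by (intro dvd_sum) (force simp: S_def i_def)
  moreover have "zcomp z i (g - e) = zcomp z i g"
    by (rule poly_mapping_eqI) (auto simp: lookup_wcomp lookup_minus lk when_def)
  moreover have "lookup m z \<le> i" if "m \<in> keys (g - e)" for m
    using that by (auto simp: in_keys_iff lookup_minus lk when_def split: if_splits)
  moreover have "\<not> p dvd zcomp z i g" using i by (simp add: S_def i_def)
  ultimately show ?thesis by (intro exI[of _ i] exI[of _ "g - e"]) auto
qed

text \<open>Comparing the parts of degree \<open>n\<close> in \<open>z\<close> replaces the cofactor
  by one that is itself divisible by the power of \<open>z\<close>.\<close>

lemma dvd_mult_Xpow_cancel: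
  fixes p c :: "('n::linorder, 'k::idom) mpoly"
  assumes "zhom z 0 p" "zhom z 0 c" "p dvd c * Xpow z n"
  shows "p dvd c"
proof -
  obtain t where t: "c * Xpow z n = p * t" using assms(3) by blast
  have "zhom z n (c * Xpow z n)"
    using whom_mult[OF zdeg.weight_add assms(2) zhom_Xpow[of z n]] by simp
  from wcomp_whom[OF this, of n] have "c * Xpow z n = zcomp z n (p * t)" using t by simp
  also have "\<dots> = p * zcomp z n t" using zdeg.wcomp_mult_whom[OF assms(1), of n t] by simp
  finally have 1: "c * Xpow z n = p * zcomp z n t" .
  obtain s where "zcomp z n t = s * Xpow z n"
    using zcoef_exists[of "zcomp z n t" UNIV z n] by auto
  then have "c * Xpow z n = (p * s) * Xpow z n" using 1 by (simp add: mult.assoc)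
  then show ?thesis by auto
qed

text \<open>Gauss's lemma. Modulo \<open>p\<close> both factors can be truncated so that their
  leading coefficients in \<open>z\<close> are not divisible by \<open>p\<close>; by primality over
  \<open>A\<close> the leading coefficient of the product is not divisible either.\<close>

lemma prime_on_insert:
  fixes p :: "('n::linorder, 'k::idom) mpoly"
  assumes "p \<in> polys A" "z \<notin> A" "prime_on (polys A) p"
  shows "prime_on (polys (insert z A)) p"
  unfolding prime_on_def
proof (intro ballI impI, rule ccontr)
  fix g h assume gh: "g \<in> polys (insert z A)" "h \<in> polys (insert z A)" "p dvd g * h" "\<not> (p dvd g \<or> p dvd h)"
  have pz: "zhom z 0 p" by (rule polys_zhom[OF assms(1,2)])
  obtain i g' where g: "\<not> p dvd zcomp z i g" "p dvd g - g'" "zcomp z i g' = zcomp z i g" "\<forall>m\<in>keys g'. lookup m z \<le> i"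
    using top_nondivisible_comp[OF pz, of g] gh by blast
  obtain j h' where h: "\<not> p dvd zcomp z j h" "p dvd h - h'" "zcomp z j h' = zcomp z j h" "\<forall>m\<in>keys h'. lookup m z \<le> j"
    using top_nondivisible_comp[OF pz, of h] gh by blast
  have "g' * h' = g * h - (g - g') * h - g' * (h - h')" by (simp add: algebra_simps)
  then have "p dvd g' * h'" using gh(3) g(2) h(2) by auto
  then have "p dvd zcomp z (i + j) (g' * h')" by (rule dvd_zcomp[OF pz])
  then have *: "p dvd zcomp z i g * zcomp z j h"
    using zdeg.wcomp_mult_top[of g' z i h' j] g h by simp
  obtain G where G: "G \<in> polys A" "zcomp z i g = G * Xpow z i"
    using zcoef_exists[OF polys_wcomp[OF gh(1)] whom_wcomp] Diff_insert_absorb[OF assms(2)] by metis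
  obtain H where H: "H \<in> polys A" "zcomp z j h = H * Xpow z j"
    using zcoef_exists[OF polys_wcomp[OF gh(2)] whom_wcomp] Diff_insert_absorb[OF assms(2)] by metis
  have "zcomp z i g * zcomp z j h = G * H * (Xpow z i * Xpow z j)"
    using G H by (simp add: algebra_simps)
  then have "p dvd G * H * Xpow z (i + j)" using * by (simp only: Xpow_mult)
  then have "p dvd G * H"
    by (rule dvd_mult_Xpow_cancel[OF pz polys_zhom[OF polys_mult[OF G(1) H(1)] assms(2)]])
  then have "p dvd G \<or> p dvd H" using assms(3) G H by (auto simp: prime_on_def)
  then show False using g(1) h(1) G H by auto
qed

section \<open>Irreducible elements are prime\<close>

definition irreducibles_prime_on :: "'n set \<Rightarrow> ('n, 'k::comm_ring_1) mpoly set \<Rightarrow> bool" where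
  "irreducibles_prime_on A D \<longleftrightarrow> (\<forall>p\<in>polys A. irreducible p \<longrightarrow> prime_on D p)"

text \<open>Each irreducible factor of \<open>l\<close> is prime, so it divides \<open>m\<close> or
  \<open>t\<close> and can be cancelled there; the induction collects the two kinds in
  \<open>l1\<close> and \<open>l2\<close>.\<close>

lemma split_divisor:
  fixes l e m t :: "('n::{finite,linorder}, 'k::field) mpoly"
  assumes "irreducibles_prime_on A (polys B :: ('n, 'k) mpoly set)" "l \<in> polys A" "l \<noteq> 0" "m \<in> polys B" "t \<in> polys B" "l * e = m * t"
  shows "\<exists>l1\<in>polys A. \<exists>l2\<in>polys A. \<exists>m' t'. l = l1 * l2 \<and> m = l1 * m' \<and> t = l2 * t' \<and> e = m' * t'"
  using assms(2-6)
proof (induction "nat (tdeg l)" arbitrary: l m t rule: less_induct)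
  case less
  show ?case
  proof (cases "l dvd 1")
    case True
    then obtain u where u: "1 = l * u" by blast
    have "m = l * (u * m)" using u by (simp add: mult.assoc[symmetric])
    moreover have "e = u * m * t" 
    proof -
      have "e = (l * u) * e" using u by simp
      also have "\<dots> = u * m * t" using less.prems(5) by (simp add: mult_ac)
      finally show ?thesis .
    qed
    ultimately show ?thesis using less.prems by (intro bexI[of _ l] bexI[of _ 1] exI[of _ "u * m"] exI[of _ t]) auto
  next
    case False
    then obtain \<pi> l0 where pi: "irreducible \<pi>" "l = \<pi> * l0"
      using irreducible_factor_exists less.prems by (metis dvdE)
    have piA: "\<pi> \<in> polys A" "l0 \<in> polys A" using polys_factor less.prems pi(2) by metis+
    have nz: "\<pi> \<noteq> 0" "l0 \<noteq> 0" using less.prems pi(2) by auto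
    have "tdeg \<pi> \<noteq> 0" using is_unit_iff_tdeg[of \<pi>] pi(1) nz irreducible_not_unit by blast
    then have deg: "nat (tdeg l0) < nat (tdeg l)"
      using tdeg_mult[OF nz] tdeg_nonneg[OF nz(1)] tdeg_nonneg[OF nz(2)] pi(2) by simp
    have "\<pi> dvd m * t" using less.prems(5) pi(2) by (metis dvd_triv_left mult.assoc)
    moreover have "prime_on (polys B) \<pi>"
      using assms(1) piA(1) pi(1) by (simp add: irreducibles_prime_on_def)
    ultimately have "\<pi> dvd m \<or> \<pi> dvd t"
      using less.prems(3,4) unfolding prime_on_def by blast
    then consider "\<pi> dvd m" | "\<pi> dvd t" by blast
    then show ?thesis
    proof cases
      case 1
      then obtain m0 where m0: "m = \<pi> * m0" by blast
      have "\<pi> * (l0 * e) = \<pi> * (m0 * t)" using less.prems(5) pi(2) m0 by (simp add: mult_ac)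
      then have eq: "l0 * e = m0 * t" using nz by simp
      have "m0 \<in> polys B"
        using m0 less.prems(3) polys_factor(2)[of \<pi> m0 B] by (cases "m0 = 0") (use nz in auto)
      from less.hyps[OF deg piA(2) nz(2) this less.prems(4) eq] obtain l1 l2 m' t' where
        "l1\<in>polys A" "l2\<in>polys A" "l0 = l1 * l2" "m0 = l1 * m'" "t = l2 * t'" "e = m' * t'" by blast
      then show ?thesis using pi(2) m0 piA polys_mult
        by (intro bexI[of _ "\<pi> * l1"] bexI[of _ l2] exI[of _ m'] exI[of _ t']) (auto simp: mult_ac)
    next
      case 2
      then obtain t0 where t0: "t = \<pi> * t0" by blast
      have "\<pi> * (l0 * e) = \<pi> * (m * t0)" using less.prems(5) pi(2) t0 by (simp add: mult_ac)
      then have eq: "l0 * e = m * t0" using nz by simp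
      have "t0 \<in> polys B"
        using t0 less.prems(4) polys_factor(2)[of \<pi> t0 B] by (cases "t0 = 0") (use nz in auto)
      from less.hyps[OF deg piA(2) nz(2) less.prems(3) this eq] obtain l1 l2 m' t' where
        "l1\<in>polys A" "l2\<in>polys A" "l0 = l1 * l2" "m = l1 * m'" "t0 = l2 * t'" "e = m' * t'" by blast
      then show ?thesis using pi(2) t0 piA polys_mult
        by (intro bexI[of _ l1] bexI[of _ "\<pi> * l2"] exI[of _ m'] exI[of _ t']) (auto simp: mult_ac)
    qed
  qed
qed

lemma unit_polys:
  fixes u :: "('n::linorder, 'k::idom) mpoly"
  assumes "u dvd 1" shows "u \<in> polys A"
proof -
  obtain v where v: "1 = u * v" using assms by blast
  then show ?thesis using polys_factor(1)[of u v A] by (metis polys_1 zero_neq_one)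
qed

text \<open>The part of \<open>l\<close> that divides \<open>p\<close> is a unit, because
  \<open>p\<close> is irreducible and does not lie in \<open>polys A\<close>. Hence \<open>l\<close>
  cancels entirely against the cofactor of \<open>p\<close>.\<close>

lemma dvd_cancel_polys:
  fixes p g l :: "('n::{finite,linorder}, 'k::field) mpoly"
  assumes "irreducibles_prime_on A (polys B :: ('n, 'k) mpoly set)" "irreducible p" "p \<in> polys B" "p \<notin> polys A"
    "l \<in> polys A" "l \<noteq> 0" "g \<in> polys B" "p dvd l * g" "A \<subseteq> B"
  shows "p dvd g"
proof (cases "g = 0")
  case False
  obtain t where t: "l * g = p * t" using assms by blast
  have "l * g \<noteq> 0" "l * g \<in> polys B" using False assms polys_mono[OF assms(9)] by (auto intro!: polys_mult)
  then have "t \<in> polys B" using t polys_factor(2) by metis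
  from split_divisor[OF assms(1,5,6,3) this t] obtain l1 l2 p' t' where
    l: "l1\<in>polys A" "p = l1 * p'" "g = p' * t'" by blast
  have "l1 dvd 1 \<or> p' dvd 1" using irreducibleD[OF assms(2) l(2)] .
  moreover have "\<not> p' dvd 1" using l(1,2) unit_polys[of p' A] assms(4) polys_mult[of l1 A p'] by auto
  ultimately obtain u where u: "1 = l1 * u" by blast
  have "p * u = (l1 * u) * p'" using l(2) by (simp add: mult_ac)
  then have "p' = p * u" by (simp flip: u)
  then have "g = p * (u * t')" using l(3) by (simp only: mult.assoc)
  then show ?thesis by (rule dvdI)
qed simp

text \<open>The case of an irreducible \<open>p\<close> that involves \<open>z\<close> follows
  Euclid's lemma over the fraction field of \<open>polys A\<close>, with denominators cleared by
  pseudo-division. Elements of \<open>polys A\<close> that enter this way are cancelled by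
  \<open>dvd_cancel_polys\<close>.\<close>

lemma irreducibles_prime_step:
  fixes dummy :: "('n::{finite,linorder}, 'k::field) mpoly"
  assumes "irreducibles_prime_on A (polys A :: ('n, 'k) mpoly set)" "z \<notin> A"
  shows "irreducibles_prime_on (insert z A) (polys (insert z A) :: ('n, 'k) mpoly set)"
proof -
  let ?B = "insert z A"
  have IH: "irreducibles_prime_on A (polys ?B :: ('n, 'k) mpoly set)"
    using assms prime_on_insert unfolding irreducibles_prime_on_def by blast
  have AB: "polys A \<subseteq> (polys ?B :: ('n, 'k) mpoly set)" by (rule polys_mono) auto
  show ?thesis unfolding irreducibles_prime_on_def
  proof (intro ballI impI)
    fix p :: "('n, 'k) mpoly" assume p: "p \<in> polys ?B" "irreducible p"
    show "prime_on (polys ?B) p"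
    proof (cases "p \<in> polys A")
      case True
      then show ?thesis using IH p by (auto simp: irreducibles_prime_on_def)
    next
      case nA: False
      show ?thesis unfolding prime_on_def
      proof (intro ballI impI, rule disjCI)
        fix g h assume gh: "g \<in> polys ?B" "h \<in> polys ?B" "p dvd g * h" "\<not> p dvd h"
        show "p dvd g"
        proof (rule ccontr)
          assume npg: "\<not> p dvd g"
          \<comment> \<open>A combination of least degree in \<open>z\<close> plays the role of the
            greatest common divisor of \<open>p\<close> and \<open>g\<close> over the fraction field
            of \<open>polys A\<close>.\<close>
          define S where "S = {m. m \<noteq> 0 \<and> (\<exists>u\<in>polys ?B. \<exists>v\<in>polys ?B. m = u * p + v * g)}"
          have "p \<noteq> 0" using p(2) by (auto simp: irreducible_def)
          moreover have "p = 1 * p + 0 * g" by simp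
          ultimately have "p \<in> S" unfolding S_def using polys_0 polys_1 by blast
          then obtain m where m: "m \<in> S" "\<And>m'. m' \<in> S \<Longrightarrow> zdeg z m \<le> zdeg z m'"
            using arg_min_nat_lemma[of "\<lambda>m. m \<in> S" p "zdeg z"] by (metis (no_types, lifting))
          then obtain u v where uv: "m \<noteq> 0" "u \<in> polys ?B" "v \<in> polys ?B" "m = u * p + v * g"
            by (auto simp: S_def)
          have mB: "m \<in> polys ?B" using uv p gh by (auto intro!: polys_add polys_mult)
          define d where "d = zdeg z m"
          obtain l where l: "l \<in> polys (?B - {z})" "zcomp z d m = l * Xpow z d"
            using zcoef_exists[OF polys_wcomp[OF mB] whom_wcomp] by blast
          have lA: "l \<in> polys A" using l assms(2) by simp
          have l0: "l \<noteq> 0" using l wcomp_wdeg_neq_0[OF uv(1), of "\<lambda>m. lookup m z"] by (auto simp: d_def)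
          \<comment> \<open>The remainder is again a combination of \<open>p\<close> and
            \<open>g\<close>; having smaller degree in \<open>z\<close> than \<open>m\<close>, it
            must vanish.\<close>
          have dv: "\<exists>k. \<exists>a\<in>polys ?B. l ^ k * e = m * a"
            if e: "e = a1 * p + a2 * g" "a1 \<in> polys ?B" "a2 \<in> polys ?B" for e a1 a2
          proof -
            have eB: "e \<in> polys ?B" using e p gh by (auto intro!: polys_add polys_mult)
            obtain k a r where k: "a \<in> polys ?B" "r \<in> polys ?B" "l ^ k * e = m * a + r" "r = 0 \<or> zdeg z r < zdeg z m"
              using pseudo_division[OF _ mB uv(1) _ polys_zhom[OF lA assms(2)] _ eB] lA AB l(2) d_def by auto
            have "r = (l ^ k * a1 - a * u) * p + (l ^ k * a2 - a * v) * g"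
              using k(3) e uv(4) by (simp add: algebra_simps)
            moreover have "l ^ k * a1 - a * u \<in> polys ?B" "l ^ k * a2 - a * v \<in> polys ?B"
              using lA AB e uv k by (auto intro!: polys_minus polys_mult polys_power)
            ultimately have "r = 0 \<or> r \<in> S" by (auto simp: S_def)
            then have "r = 0" using k(4) m(2)[of r] by auto
            then show ?thesis using k by auto
          qed
          obtain k a where ka: "a \<in> polys ?B" "l ^ k * p = m * a" using dv[of p 1 0] by auto
          obtain j b where jb: "b \<in> polys ?B" "l ^ j * g = m * b" using dv[of g 0 1] by auto
          have lk: "l ^ i \<in> polys A" "l ^ i \<noteq> 0" for i using lA l0 by (auto intro: polys_power)
          from split_divisor[OF IH lk mB ka(1) ka(2)] obtain l1 l2 m' t' where
            s: "l1\<in>polys A" "l ^ k = l1 * l2" "m = l1 * m'" "a = l2 * t'" "p = m' * t'" by blast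
          have "m' dvd 1 \<or> t' dvd 1" using irreducibleD[OF p(2) s(5)] .
          then show False
          proof
            \<comment> \<open>Then \<open>m\<close> is free of \<open>z\<close>, while
              \<open>m * h\<close> is a multiple of \<open>p\<close>: the case of coprime
              \<open>p\<close> and \<open>g\<close>.\<close>
            assume "m' dvd 1"
            then have "m \<in> polys A" using s unit_polys polys_mult by metis
            moreover have "p dvd m * h"
            proof -
              have "m * h = p * (u * h) + v * (g * h)" using uv(4) by (simp add: algebra_simps)
              then show ?thesis using gh(3) by auto
            qed
            ultimately show False
              using dvd_cancel_polys[OF IH p(2,1) nA _ uv(1) gh(2)] gh(4) by blast
          next
            \<comment> \<open>Then \<open>p\<close> and \<open>m'\<close> are associates, so
              \<open>p\<close> divides \<open>m\<close> and with it a multiple of \<open>g\<close>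
              by a power of \<open>l\<close>.\<close>
            assume "t' dvd 1"
            then obtain u' where u': "1 = t' * u'" by blast
            have "p * u' = m' * (t' * u')" using s(5) by (simp add: mult_ac)
            then have "m' = p * u'" by (simp flip: u')
            then have "l ^ j * g = p * (u' * l1 * b)" using jb s by (simp add: mult_ac)
            then have "p dvd l ^ j * g" by simp
            then show False using dvd_cancel_polys[OF IH p(2,1) nA lk gh(1)] npg by blast
          qed
        qed
      qed
    qed
  qed
qed

text \<open>Induction on the set of variables; with no variables there are only constants, and a
  nonzero constant is a unit.\<close>

theorem irreducible_imp_prime_mpoly:
  fixes p :: "('n::{finite,linorder}, 'k::field) mpoly"
  assumes "irreducible p" shows "prime_elem p"
proof -
  have "irreducibles_prime_on A (polys A :: ('n, 'k) mpoly set)" for A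
  proof (induction A rule: finite_induct[OF finite])
    case 1
    show ?case unfolding irreducibles_prime_on_def
    proof (intro ballI impI)
      fix p :: "('n, 'k) mpoly" assume "p \<in> polys {}" "irreducible p"
      then have "p \<noteq> 0" "form 0 p" by (auto simp: polys_def form_def)
      then have "p dvd 1" using form_tdeg is_unit_iff_tdeg by blast
      then show "prime_on (polys {}) p" using \<open>irreducible p\<close> irreducible_not_unit by blast
    qed
  qed (use irreducibles_prime_step in blast)
  from this[of UNIV] show ?thesis using assms
    by (auto simp: irreducibles_prime_on_def prime_on_def prime_elem_def irreducible_def)
qed

section \<open>Ideals, primes and heights\<close>

interpretation ideal: Modules.module "(*) :: 'a::comm_ring_1 \<Rightarrow> 'a \<Rightarrow> 'a"
  by standard (auto simp: algebra_simps)

declare ideal.scale_scale [simp del]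

lemma is_ideal_iff: "is_ideal I \<longleftrightarrow> 0 \<in> I \<and> (\<forall>x\<in>I. \<forall>y\<in>I. x + y \<in> I) \<and> (\<forall>c. \<forall>x\<in>I. c * x \<in> I)"
  unfolding ideal.subspace_def by auto

lemma is_ideal_minus: "is_ideal I \<Longrightarrow> x \<in> I \<Longrightarrow> y \<in> I \<Longrightarrow> x - y \<in> I"
  by (rule ideal.subspace_diff)

lemma one_notin_prime_ideal: "prime_ideal P \<Longrightarrow> 1 \<notin> P"
  unfolding prime_ideal_def is_ideal_iff by (metis UNIV_eq_I mult.right_neutral)

text \<open>Used in place of height at least two, because it is inherited by larger sets and passes
  from an ideal to its generators without mention of prime ideals.\<close>

definition primitive :: "('n, 'k::comm_ring_1) mpoly set \<Rightarrow> bool" where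
  "primitive S \<longleftrightarrow> \<not> (\<exists>p. irreducible p \<and> (\<forall>s\<in>S. p dvd s))"

lemma primitive_mono: "primitive S \<Longrightarrow> S \<subseteq> T \<Longrightarrow> primitive T"
  unfolding primitive_def by blast

lemma dvd_ideal_gen: "(\<forall>s\<in>S. p dvd s) \<Longrightarrow> x \<in> ideal_gen S \<Longrightarrow> p dvd x"
  by (rule ideal.span_induct[of x S]) (auto simp: is_ideal_iff)

lemma primitive_ideal_gen: "primitive (ideal_gen S) \<Longrightarrow> primitive S"
  unfolding primitive_def using dvd_ideal_gen by blast

lemma irreducible_prime_dvd:
  fixes p :: "('n::{finite,linorder}, 'k::field) mpoly"
  assumes "irreducible p" "p dvd a * b" shows "p dvd a \<or> p dvd b"
  using irreducible_imp_prime_mpoly[OF assms(1)] assms(2) by (auto simp: prime_elem_def)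

lemma tdeg_irreducible_pos:
  fixes p :: "('n::{finite,linorder}, 'k::field) mpoly"
  assumes "irreducible p" shows "p \<noteq> 0" "0 < tdeg p"
proof -
  show "p \<noteq> 0" using assms by auto
  then show "0 < tdeg p"
    using assms is_unit_iff_tdeg[of p] tdeg_nonneg[of p] by (auto simp: irreducible_def order_le_less)
qed

text \<open>An irreducible factor of \<open>c\<close> fails to divide some \<open>s\<close>, so it
  divides \<open>a\<close> and can be cancelled; induction on the degree of
  \<open>c\<close>.\<close>

lemma primitive_dvd:
  fixes c a :: "('n::{finite,linorder}, 'k::field) mpoly"
  assumes "primitive S" "c \<noteq> 0" "\<And>s. s \<in> S \<Longrightarrow> c dvd a * s"
  shows "c dvd a"
  using assms(2,3)
proof (induction "nat (tdeg c)" arbitrary: c a rule: less_induct)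
  case less
  show ?case
  proof (cases "c dvd 1")
    case False
    then obtain p c' where p: "irreducible p" "c = p * c'"
      using irreducible_factor_exists[OF less.prems(1)] by blast
    have nz: "p \<noteq> 0" "c' \<noteq> 0" using p(2) less.prems(1) by auto
    have deg: "nat (tdeg c') < nat (tdeg c)"
      using tdeg_mult[OF nz] tdeg_irreducible_pos[OF p(1)] tdeg_nonneg[OF nz(2)] p(2) by simp
    obtain s where s: "s \<in> S" "\<not> p dvd s" using assms(1) p(1) by (auto simp: primitive_def)
    have "p dvd a * s" using less.prems(2)[OF s(1)] p(2) by (metis dvd_mult_left)
    then have "p dvd a" using irreducible_prime_dvd[OF p(1)] s by blast
    then obtain a' where a': "a = p * a'" by blast
    have "c' dvd a' * s" if "s \<in> S" for s
    proof -
      have "p * c' dvd p * (a' * s)" using less.prems(2)[OF that] by (simp only: p(2) a' mult.assoc)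
      then show ?thesis using nz(1) by (simp only: dvd_mult_cancel_left) simp
    qed
    then have "c' dvd a'" using less.hyps[OF deg nz(2)] by blast
    then show ?thesis by (simp add: p(2) a')
  qed (meson dvd_trans one_dvd)
qed

section \<open>Chains of prime ideals and height at least two\<close>

lemma prime_ideal_multiples:
  fixes p :: "('n::{finite,linorder}, 'k::field) mpoly"
  assumes "irreducible p" shows "prime_ideal {r. p dvd r}"
  unfolding prime_ideal_def is_ideal_iff using assms irreducible_prime_dvd[OF assms]
  by (auto simp: irreducible_def set_eq_iff)

lemma prime_ideal_zero: "prime_ideal {0 :: ('n::linorder, 'k::idom) mpoly}"
  unfolding prime_ideal_def is_ideal_iff by (auto dest: arg_cong[of _ _ "\<lambda>S. 1 \<in> S"])

text \<open>A nonzero element of least degree in \<open>Q\<close> has the form \<open>p * r\<close>.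
  Since \<open>p\<close> is not in \<open>Q\<close>, the cofactor \<open>r\<close> is, and it has
  smaller degree.\<close>

lemma prime_below_multiples:
  fixes p :: "('n::{finite,linorder}, 'k::field) mpoly"
  assumes "irreducible p" "prime_ideal Q" "Q \<subset> {r. p dvd r}"
  shows "Q = {0}"
proof (rule ccontr)
  assume "Q \<noteq> {0}"
  have Q: "is_ideal Q" using assms(2) by (simp add: prime_ideal_def)
  then have "0 \<in> Q" by (simp add: is_ideal_iff)
  then obtain q0 where q0: "q0 \<in> Q - {0}" using \<open>Q \<noteq> {0}\<close> by blast
  obtain q where q: "q \<in> Q - {0}" "\<And>r. r \<in> Q - {0} \<Longrightarrow> nat (tdeg q) \<le> nat (tdeg r)"
    using arg_min_nat_lemma[of "\<lambda>q. q \<in> Q - {0}" q0 "\<lambda>q. nat (tdeg q)"] q0 by blast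
  obtain r where r: "q = p * r" using q(1) assms(3) by blast
  have nz: "p \<noteq> 0" "r \<noteq> 0" using q(1) r by auto
  have "p \<notin> Q"
  proof
    assume "p \<in> Q"
    have "x \<in> Q" if px: "p dvd x" for x
    proof -
      obtain y where "x = p * y" using px by blast
      then have "x = y * p" by (simp only: mult.commute)
      then show ?thesis using \<open>p \<in> Q\<close> Q by (simp add: is_ideal_iff)
    qed
    then show False using assms(3) by blast
  qed
  then have "r \<in> Q" using q(1) r assms(2) by (auto simp: prime_ideal_def)
  then have "nat (tdeg q) \<le> nat (tdeg r)" using q(2)[of r] nz by blast
  then show False
    using tdeg_mult[OF nz] tdeg_irreducible_pos[OF assms(1)] tdeg_nonneg[OF nz(2)] r by simp
qed

lemma prime_height_leI:
  assumes "\<And>l Q. (\<forall>i\<le>l. prime_ideal (Q i)) \<Longrightarrow> (\<forall>i<l. Q i \<subset> Q (Suc i)) \<Longrightarrow> Q l = P \<Longrightarrow> l \<le> n"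
  shows "prime_height P \<le> enat n"
  unfolding prime_height_def by (rule Sup_least) (use assms in auto)

lemma prime_height_geI:
  assumes "\<forall>i\<le>l. prime_ideal (Q i)" "\<forall>i<l. Q i \<subset> Q (Suc i)" "Q l = P"
  shows "enat l \<le> prime_height P"
  unfolding prime_height_def by (rule Sup_upper) (use assms in blast)

lemma prime_height_multiples:
  fixes p :: "('n::{finite,linorder}, 'k::field) mpoly"
  assumes "irreducible p" shows "prime_height {r. p dvd r} \<le> enat 1"
proof (rule prime_height_leI)
  fix l and Q :: "nat \<Rightarrow> ('n, 'k) mpoly set"
  assume Q: "\<forall>i\<le>l. prime_ideal (Q i)" "\<forall>i<l. Q i \<subset> Q (Suc i)" "Q l = {r. p dvd r}"
  show "l \<le> 1"
  proof (rule ccontr)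
    assume "\<not> l \<le> 1"
    then obtain k where k: "l = Suc (Suc k)" by (metis One_nat_def le_SucI nat_le_linear not0_implies_Suc old.nat.exhaust)
    have "Q (Suc k) \<subset> {r. p dvd r}" "prime_ideal (Q (Suc k))" using Q k by auto
    then have "Q (Suc k) = {0}" using prime_below_multiples[OF assms] by blast
    moreover have "Q k \<subset> Q (Suc k)" "prime_ideal (Q k)" using Q k by auto
    ultimately show False by (auto simp: prime_ideal_def is_ideal_iff)
  qed
qed

lemma height_le: "prime_ideal P \<Longrightarrow> I \<subseteq> P \<Longrightarrow> height I \<le> prime_height P"
  unfolding height_def by (rule Inf_lower) blast

lemma height_geI: "(\<And>P. prime_ideal P \<Longrightarrow> I \<subseteq> P \<Longrightarrow> n \<le> prime_height P) \<Longrightarrow> n \<le> height I"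
  unfolding height_def by (rule Inf_greatest) blast

text \<open>A common irreducible factor \<open>p\<close> would put \<open>I\<close> inside the prime
  ideal of multiples of \<open>p\<close>, whose height is at most one.\<close>

lemma primitive_if_height_2:
  fixes I :: "('n::{finite,linorder}, 'k::field) mpoly set"
  assumes "height I = 2" shows "primitive I"
proof (rule ccontr)
  assume "\<not> primitive I"
  then obtain p where p: "irreducible p" "I \<subseteq> {r. p dvd r}" by (auto simp: primitive_def)
  then have "height I \<le> enat 1"
    using height_le[OF prime_ideal_multiples] prime_height_multiples order_trans by blast
  then show False using assms by (simp add: numeral_eq_enat)
qed

lemma irreducible_exists:
  "\<exists>p :: ('n::{finite,linorder}, 'k::field) mpoly. irreducible p"
proof -
  fix z :: 'n
  have f: "form 1 (Xpow z 1 :: ('n, 'k) mpoly)"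
    by (auto simp: form_def mdeg_def)
  have "\<not> (Xpow z 1 :: ('n, 'k) mpoly) dvd 1"
    using form_tdeg[OF f] is_unit_iff_tdeg[of "Xpow z 1 :: ('n, 'k) mpoly"] by simp
  then show ?thesis using irreducible_factor_exists[OF Xpow_neq_0] by blast
qed

text \<open>Some irreducible factor \<open>p\<close> of a nonzero element lies in \<open>P\<close>.
  By primitivity \<open>P\<close> is larger than the multiples of \<open>p\<close>, which gives a
  chain of length two starting at 0.\<close>

lemma prime_height_ge_2:
  fixes P :: "('n::{finite,linorder}, 'k::field) mpoly set"
  assumes "primitive P" "prime_ideal P" shows "2 \<le> prime_height P"
proof -
  \<comment> \<open>Primitivity for an arbitrary irreducible \<open>p0\<close> yields an element not
    divisible by \<open>p0\<close>, in particular a nonzero one; cofactors in the induction keep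
    this property.\<close>
  obtain p0 :: "('n, 'k) mpoly" where "irreducible p0" using irreducible_exists by blast
  then obtain a where a: "a \<in> P" "\<not> p0 dvd a" using assms by (auto simp: primitive_def)
  have P: "is_ideal P" using assms by (simp add: prime_ideal_def)
  have "\<exists>p\<in>P. irreducible p"
    using a(1) a(2)
  proof (induction "nat (tdeg a)" arbitrary: a rule: less_induct)
    case less
    have a0: "a \<noteq> 0" using less.prems by auto
    have "\<not> a dvd 1"
    proof
      assume "a dvd 1"
      then obtain b where "1 = b * a" by (metis dvdE mult.commute)
      then have "1 \<in> P" using P less.prems by (metis is_ideal_iff)
      then show False using one_notin_prime_ideal assms by blast
    qed
    then obtain p b where p: "irreducible p" "a = p * b" using irreducible_factor_exists[OF a0] by blast
    have nz: "p \<noteq> 0" "b \<noteq> 0" using p a0 by auto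
    show ?case
    proof (cases "p \<in> P")
      case False
      then have "b \<in> P" using less.prems p assms(2) by (auto simp: prime_ideal_def)
      moreover have "nat (tdeg b) < nat (tdeg a)"
        using tdeg_mult[OF nz] tdeg_irreducible_pos[OF p(1)] tdeg_nonneg[OF nz(2)] p(2) by simp
      moreover have "\<not> p0 dvd b" using less.prems p by auto
      ultimately show ?thesis using less.hyps by blast
    qed (use p in blast)
  qed
  then obtain p where p: "p \<in> P" "irreducible p" by blast
  have "p * r \<in> P" for r using p(1) P by (metis is_ideal_iff mult.commute)
  then have "{r. p dvd r} \<subseteq> P" by auto
  moreover obtain b where "b \<in> P" "\<not> p dvd b" using assms(1) p by (auto simp: primitive_def)
  ultimately have 1: "{r. p dvd r} \<subset> P" by blast
  have "p \<in> {r. p dvd r}" "p \<notin> {0}" "0 \<in> {r. p dvd r}" using tdeg_irreducible_pos[OF p(2)] by simp_all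
  then have 2: "{0} \<subset> {r. p dvd r}" by blast
  define Q where "Q = (\<lambda>i::nat. if i = 0 then {0} else if i = 1 then {r. p dvd r} else P)"
  have "enat 2 \<le> prime_height P"
    by (rule prime_height_geI[of _ Q])
      (use 1 2 prime_ideal_zero prime_ideal_multiples[OF p(2)] assms(2) in \<open>auto simp: Q_def less_Suc_eq numeral_2_eq_2\<close>)
  then show ?thesis by (simp add: numeral_eq_enat)
qed

lemma height_ge_2:
  fixes I :: "('n::{finite,linorder}, 'k::field) mpoly set"
  assumes "primitive I" shows "2 \<le> height I"
  by (rule height_geI) (use prime_height_ge_2 primitive_mono assms in blast)

subsection \<open>Growth of residue rings\<close>

text \<open>The exponents are bounded one by one, instead of the total degree, so that the monomials
  in a set of variables are counted by a pure power.\<close>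

definition box :: "nat \<Rightarrow> ('n, 'k::zero) mpoly set" where
  "box i = {p. \<forall>m\<in>keys p. \<forall>x. lookup m x \<le> i}"

lemma box_mono: "i \<le> j \<Longrightarrow> box i \<subseteq> box j"
  unfolding box_def using order_trans by blast

lemma box_mult:
  fixes p q :: "('n, 'k::comm_ring_1) mpoly"
  assumes "p \<in> box i" "q \<in> box j" shows "p * q \<in> box (i + j)"
  unfolding box_def
proof safe
  fix m x assume "m \<in> keys (p * q)"
  then obtain a b where "m = a + b" "a \<in> keys p" "b \<in> keys q" using keys_mult[of p q] by blast
  then show "lookup m x \<le> i + j" using assms by (auto simp: box_def lookup_add intro: add_mono)
qed

lemma box_exists: "\<exists>c. (p :: ('n::finite, 'k::comm_ring_1) mpoly) \<in> box c"
proof -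
  have "finite ((\<lambda>(m, x). lookup m x) ` (keys p \<times> UNIV))" by simp
  then obtain c where "\<forall>v \<in> (\<lambda>(m, x). lookup m x) ` (keys p \<times> UNIV). v \<le> c"
    using finite_nat_set_iff_bounded_le by auto
  then show ?thesis by (intro exI[of _ c]) (auto simp: box_def)
qed

definition monoms :: "'n set \<Rightarrow> nat \<Rightarrow> ('n \<Rightarrow>\<^sub>0 nat) set" where
  "monoms Y i = {m. keys m \<subseteq> Y \<and> (\<forall>x. lookup m x \<le> i)}"

lemma card_monoms: 
  fixes Y :: "'n::finite set"
  shows "finite (monoms Y i)" "card (monoms Y i) = (i + 1) ^ card Y"
proof -
  have b: "bij_betw (\<lambda>m. restrict (lookup m) Y) (monoms Y i) (PiE Y (\<lambda>_. {..i}))"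
  proof (rule bij_betw_byWitness[where f' = "\<lambda>g. Abs_poly_mapping (\<lambda>x. if x \<in> Y then g x else 0)"])
    show "\<forall>m\<in>monoms Y i. Abs_poly_mapping (\<lambda>x. if x \<in> Y then restrict (lookup m) Y x else 0) = m"
    proof
      fix m assume m: "m \<in> monoms Y i"
      have "(if x \<in> Y then restrict (lookup m) Y x else 0) = lookup m x" for x
        using m in_keys_iff[of x m] by (auto simp: monoms_def)
      then show "Abs_poly_mapping (\<lambda>x. if x \<in> Y then restrict (lookup m) Y x else 0) = m" by simp
    qed
    show "\<forall>g\<in>Y \<rightarrow>\<^sub>E {..i}. restrict (lookup (Abs_poly_mapping (\<lambda>x. if x \<in> Y then g x else 0))) Y = g"
      by (auto simp: fun_eq_iff PiE_def extensional_def restrict_def)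
    show "(\<lambda>m. restrict (lookup m) Y) ` monoms Y i \<subseteq> Y \<rightarrow>\<^sub>E {..i}"
      by (auto simp: monoms_def)
    show "(\<lambda>g. Abs_poly_mapping (\<lambda>x. if x \<in> Y then g x else 0)) ` (Y \<rightarrow>\<^sub>E {..i}) \<subseteq> monoms Y i"
      by (auto simp: monoms_def in_keys_iff PiE_def Pi_def split: if_splits)
  qed
  show "finite (monoms Y i)" using bij_betw_finite[OF b] by (simp add: finite_PiE)
  show "card (monoms Y i) = (i + 1) ^ card Y" using bij_betw_same_card[OF b] by (simp add: card_PiE)
qed

interpretation kv: vector_space "\<lambda>(c::'k::field) (p::('n, 'k) mpoly). Const c * p"
  by standard (simp_all only: distrib_left distrib_right single_add mult.assoc[symmetric] mult_single
      add_0_left single_one mult_1_left)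

declare kv.scale_scale [simp del]

text \<open>\<open>box i\<close> contains \<open>m\<close> polynomials that are linearly independent modulo \<open>Q\<close>.\<close>

definition ind_mod :: "('n, 'k::comm_ring_1) mpoly set \<Rightarrow> nat \<Rightarrow> nat \<Rightarrow> bool" where
  "ind_mod Q m i \<longleftrightarrow> (\<exists>b. (\<forall>j<m. b j \<in> box i) \<and>
     (\<forall>c. (\<Sum>j<m. Const (c j) * b j) \<in> Q \<longrightarrow> (\<forall>j<m. c j = 0)))"

lemma ind_mod_mono: "ind_mod Q m i \<Longrightarrow> i \<le> j \<Longrightarrow> ind_mod Q m j"
  unfolding ind_mod_def using box_mono by (meson in_mono)

lemma ind_mod_0: "ind_mod Q 0 i"
  by (auto simp: ind_mod_def)

lemma sum_lessThan_add: "(\<Sum>j<m + n. f j) = (\<Sum>j<m. f j) + (\<Sum>j<n. f (m + j))"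
  for f :: "nat \<Rightarrow> 'a::comm_monoid_add"
  by (induction n) (auto simp: add.assoc)

text \<open>A family independent modulo \<open>P\<close> is joined to \<open>x\<close> times a
  family independent modulo \<open>Q\<close>. Modulo \<open>P\<close> the second part disappears, so
  the first coefficients vanish; then \<open>x\<close> can be cancelled because \<open>Q\<close> is
  prime.\<close>

lemma ind_mod_add:
  fixes P Q :: "('n::finite, 'k::field) mpoly set"
  assumes "prime_ideal Q" "is_ideal P" "Q \<subseteq> P" "x \<in> P" "x \<notin> Q" "x \<in> box c"
    "ind_mod P m (i + c)" "ind_mod Q m' i"
  shows "ind_mod Q (m + m') (i + c)"
proof -
  obtain b1 where b1: "\<forall>j<m. b1 j \<in> box (i + c)" "\<And>c. (\<Sum>j<m. Const (c j) * b1 j) \<in> P \<Longrightarrow> \<forall>j<m. c j = 0"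
    using assms(7) unfolding ind_mod_def by blast
  obtain b2 where b2: "\<forall>j<m'. b2 j \<in> box i" "\<And>c. (\<Sum>j<m'. Const (c j) * b2 j) \<in> Q \<Longrightarrow> \<forall>j<m'. c j = 0"
    using assms(8) unfolding ind_mod_def by blast
  define b where "b = (\<lambda>j. if j < m then b1 j else x * b2 (j - m))"
  have Q: "is_ideal Q" using assms(1) by (simp add: prime_ideal_def)
  show ?thesis unfolding ind_mod_def
  proof (intro exI[of _ b] conjI allI impI)
    fix j assume "j < m + m'"
    then show "b j \<in> box (i + c)"
      using b1 b2 box_mult[of x c "b2 (j - m)" i] assms(6) by (auto simp: b_def add.commute)
  next
    fix f j assume f: "(\<Sum>j<m + m'. Const (f j) * b j) \<in> Q" and j: "j < m + m'"
    define s2 where "s2 = (\<Sum>j<m'. Const (f (m + j)) * b2 j)"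
    have "(\<Sum>j<m + m'. Const (f j) * b j) = (\<Sum>j<m. Const (f j) * b1 j) + x * s2"
      unfolding sum_lessThan_add s2_def sum_distrib_left
      by (rule arg_cong2[of _ _ _ _ "(+)"]; rule sum.cong) (auto simp: b_def intro: mult.left_commute)
    then have s: "(\<Sum>j<m. Const (f j) * b1 j) + x * s2 \<in> Q" using f by simp
    have "s2 * x \<in> P" using assms(2,4) by (simp add: is_ideal_iff)
    then have "x * s2 \<in> P" by (simp only: mult.commute)
    then have "(\<Sum>j<m. Const (f j) * b1 j) + x * s2 - x * s2 \<in> P"
      using is_ideal_minus[OF assms(2)] assms(3) s by blast
    then have "(\<Sum>j<m. Const (f j) * b1 j) \<in> P" by simp
    then have f1: "\<forall>j<m. f j = 0" using b1(2) by blast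
    then have "x * s2 \<in> Q" using s by simp
    then have "s2 \<in> Q" using assms(1,5) by (auto simp: prime_ideal_def)
    then have "\<forall>j<m'. f (m + j) = 0" using b2(2)[of "\<lambda>j. f (m + j)"] unfolding s2_def by blast
    then show "f j = 0" using f1 j by (metis add_diff_inverse_nat add_less_cancel_left)
  qed
qed

text \<open>The growth of the residue ring is at least of degree \<open>d\<close>. The factor
  \<open>K\<close> permits a linear change of scale, which each step down a chain of primes
  needs.\<close>

definition grows :: "('n, 'k::comm_ring_1) mpoly set \<Rightarrow> nat \<Rightarrow> bool" where
  "grows Q d \<longleftrightarrow> (\<exists>K. \<forall>i. ind_mod Q ((i + 1) ^ d) (K * (i + 1)))"

text \<open>Applying \<open>ind_mod_add\<close> \<open>i + 1\<close> times gains a factor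
  \<open>i + 1\<close> in size, while the box grows only by \<open>i + 1\<close> times a
  constant.\<close>

lemma grows_Suc:
  fixes P Q :: "('n::finite, 'k::field) mpoly set"
  assumes "prime_ideal Q" "prime_ideal P" "Q \<subset> P" "grows P d"
  shows "grows Q (Suc d)"
proof -
  obtain K where K: "\<And>i. ind_mod P ((i + 1) ^ d) (K * (i + 1))" using assms(4) by (auto simp: grows_def)
  obtain x where x: "x \<in> P" "x \<notin> Q" using assms(3) by blast
  obtain c where c: "x \<in> box c" using box_exists by blast
  have P: "is_ideal P" using assms(2) by (simp add: prime_ideal_def)
  have "ind_mod Q (j * (i + 1) ^ d) (K * (i + 1) + j * c)" for i j
  proof (induction j)
    case (Suc j)
    have "ind_mod P ((i + 1) ^ d) (K * (i + 1) + j * c + c)" using K ind_mod_mono by (metis add.assoc le_add1)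
    from ind_mod_add[OF assms(1) P _ x c this Suc.IH] show ?case
      using assms(3) by (simp add: algebra_simps)
  qed (simp add: ind_mod_0)
  moreover have "K * (i + 1) + (i + 1) * c = (K + c) * (i + 1)" for i by (simp add: algebra_simps)
  ultimately have "ind_mod Q ((i + 1) ^ Suc d) ((K + c) * (i + 1))" for i
    using power_Suc by metis
  then show ?thesis unfolding grows_def by blast
qed

lemma box_subset_span: "box i \<subseteq> kv.span ((\<lambda>m. Poly_Mapping.single m 1) ` monoms (UNIV :: 'n::finite set) i :: ('n, 'k::field) mpoly set)"
proof
  fix p :: "('n, 'k) mpoly" assume p: "p \<in> box i"
  have "p = (\<Sum>m\<in>keys p. Const (lookup p m) * Poly_Mapping.single m 1)"
    using poly_mapping_sum_single[of p] by (simp add: mult_single)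
  also have "\<dots> \<in> kv.span ((\<lambda>m. Poly_Mapping.single m 1) ` monoms UNIV i)"
    using p by (intro kv.span_sum kv.span_scale kv.span_base) (auto simp: box_def monoms_def)
  finally show "p \<in> kv.span ((\<lambda>m. Poly_Mapping.single m 1) ` monoms UNIV i)" .
qed

lemma ind_mod_bound:
  fixes Q :: "('n::finite, 'k::field) mpoly set"
  assumes "ind_mod Q m i" "0 \<in> Q"
  shows "m \<le> (i + 1) ^ CARD('n)"
proof -
  obtain b where b: "\<forall>j<m. b j \<in> box i" "\<And>c. (\<Sum>j<m. Const (c j) * b j) \<in> Q \<Longrightarrow> \<forall>j<m. c j = 0"
    using assms(1) unfolding ind_mod_def by blast
  have inj: "inj_on b {..<m}"
  proof (rule inj_onI, rule ccontr)
    fix j k assume jk: "j \<in> {..<m}" "k \<in> {..<m}" "b j = b k" "j \<noteq> k"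
    define c where "c = (\<lambda>l. (1::'k) when l = j) - (\<lambda>l. 1 when l = k)"
    have "(\<Sum>l<m. Const (c l) * b l) = (\<Sum>l<m. (if l = j then b l else 0) - (if l = k then b l else 0))"
      by (intro sum.cong) (auto simp: c_def when_def single_uminus)
    also have "\<dots> = 0" using jk by (simp add: sum_subtractf)
    finally have "\<forall>l<m. c l = 0" using b(2) assms(2) by simp
    then show False using jk by (auto simp: c_def)
  qed
  have "kv.independent (b ` {..<m})"
  proof (rule kv.independent_if_scalars_zero)
    fix f x assume f: "(\<Sum>x\<in>b ` {..<m}. Const (f x) * x) = 0" and x: "x \<in> b ` {..<m}"
    have "(\<Sum>j<m. Const (f (b j)) * b j) = 0" using f unfolding sum.reindex[OF inj] o_def .
    then have "(\<Sum>j<m. Const (f (b j)) * b j) \<in> Q" using assms(2) by (simp only:)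
    then have "\<forall>j<m. f (b j) = 0" by (rule b(2))
    then show "f x = 0" using x by blast
  qed simp
  moreover have "b ` {..<m} \<subseteq> kv.span ((\<lambda>m. Poly_Mapping.single m 1) ` monoms UNIV i)"
    using b(1) box_subset_span by blast
  ultimately have "card (b ` {..<m}) \<le> card ((\<lambda>m. Poly_Mapping.single m (1::'k)) ` monoms (UNIV::'n set) i)"
    by (rule kv.independent_span_bound[OF finite_imageI[OF card_monoms(1)], THEN conjunct2])
  also have "\<dots> \<le> (i + 1) ^ CARD('n)" using card_image_le card_monoms by metis
  finally show ?thesis using inj by (simp add: card_image)
qed

lemma grows_polys:
  fixes P :: "('n::finite, 'k::field) mpoly set"
  assumes "P \<inter> polys Y \<subseteq> {0}" shows "grows P (card Y)"
  unfolding grows_def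
proof (intro exI[of _ 1] allI)
  fix i
  obtain h where h: "bij_betw h {0..<card (monoms Y i)} (monoms Y i)"
    using ex_bij_betw_nat_finite[OF card_monoms(1)] by blast
  define N where "N = card (monoms Y i)"
  have hm: "h j \<in> monoms Y i" if "j < N" for j
    using h that by (auto simp: N_def bij_betw_def)
  have hi: "inj_on h {..<N}" using h by (simp add: bij_betw_def N_def lessThan_atLeast0)
  have "ind_mod P N i" unfolding ind_mod_def
  proof (intro exI[of _ "\<lambda>j. Poly_Mapping.single (h j) 1"] conjI allI impI)
    fix j assume "j < N"
    then show "Poly_Mapping.single (h j) 1 \<in> box i" using hm by (auto simp: box_def monoms_def)
  next
    fix c j assume c: "(\<Sum>j<N. Const (c j) * Poly_Mapping.single (h j) 1) \<in> P" and j: "j < N"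
    have "(\<Sum>j<N. Const (c j) * Poly_Mapping.single (h j) 1) \<in> polys Y"
      using hm by (intro polys_sum polys_mult polys_Const) (auto simp: polys_def monoms_def)
    then have "(\<Sum>j<N. Const (c j) * Poly_Mapping.single (h j) 1) = 0" using c assms by blast
    then have "0 = lookup (\<Sum>j<N. Const (c j) * Poly_Mapping.single (h j) 1) (h j)" by simp
    also have "\<dots> = (\<Sum>l<N. if l = j then c l else 0)"
      unfolding lookup_sum using hi j
      by (intro sum.cong) (auto simp: mult_single lookup_single when_def inj_on_def)
    finally show "c j = 0" using j by simp
  qed
  then show "ind_mod P ((i + 1) ^ card Y) (1 * (i + 1))"
    using card_monoms(2)[of Y i] ind_mod_mono[of P _ i "i + 1"] by (simp add: N_def)
qed

lemma grows_bound:
  fixes Q :: "('n::finite, 'k::field) mpoly set"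
  assumes "grows Q d" "0 \<in> Q" shows "d \<le> CARD('n)"
proof (rule ccontr)
  assume d: "\<not> d \<le> CARD('n)"
  obtain K where K: "\<And>i. ind_mod Q ((i + 1) ^ d) (K * (i + 1))" using assms(1) by (auto simp: grows_def)
  \<comment> \<open>Chosen so that the upper bound \<open>((K + 1) * (i + 1)) ^ CARD('n)\<close>
    equals \<open>i * (i + 1) ^ CARD('n)\<close>, just short of the next power of
    \<open>i + 1\<close>.\<close>
  define i where "i = (K + 1) ^ CARD('n)"
  have "(i + 1) ^ d \<le> (K * (i + 1) + 1) ^ CARD('n)" using ind_mod_bound[OF K assms(2)] .
  also have "\<dots> \<le> ((K + 1) * (i + 1)) ^ CARD('n)" by (intro power_mono) auto
  also have "\<dots> = i * (i + 1) ^ CARD('n)" by (simp only: power_mult_distrib i_def)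
  also have "\<dots> < (i + 1) ^ Suc (CARD('n))" by simp
  also have "\<dots> \<le> (i + 1) ^ d" using d by (intro power_increasing) auto
  finally show False by simp
qed

lemma prime_height_le_if_polys:
  fixes P :: "('n::finite, 'k::field) mpoly set"
  assumes "P \<inter> polys Y \<subseteq> {0}" "CARD('n) \<le> card Y + h"
  shows "prime_height P \<le> enat h"
proof (rule prime_height_leI)
  fix l and Q :: "nat \<Rightarrow> ('n, 'k) mpoly set"
  assume Q: "\<forall>i\<le>l. prime_ideal (Q i)" "\<forall>i<l. Q i \<subset> Q (Suc i)" "Q l = P"
  have "i \<le> l \<Longrightarrow> grows (Q (l - i)) (card Y + i)" for i
  proof (induction i)
    case (Suc i)
    then have "Q (l - Suc i) \<subset> Q (l - i)" using Q(2) by (metis Suc_diff_Suc Suc_le_lessD diff_less_Suc lessI less_imp_diff_less zero_less_Suc diff_less less_le_trans)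
    then show ?case using grows_Suc[of "Q (l - Suc i)" "Q (l - i)"] Q(1) Suc by simp
  qed (use grows_polys assms(1) Q in simp)
  from this[of l] have "grows (Q 0) (card Y + l)" by simp
  moreover have "0 \<in> Q 0" using Q(1) by (auto simp: prime_ideal_def is_ideal_iff)
  ultimately show "l \<le> h" using grows_bound assms(2) by fastforce
qed

section \<open>Independent variables and primes avoiding a multiplicative set\<close>

lemma maximal_independent_variables:
  fixes I :: "('n::finite, 'k::field) mpoly set"
  assumes "is_ideal I" "1 \<notin> I"
  obtains Y where "I \<inter> polys Y \<subseteq> {0}"
    "\<And>z. z \<notin> Y \<Longrightarrow> \<exists>q\<in>I. q \<in> polys (insert z Y) \<and> q \<noteq> 0 \<and> 0 < zdeg z q"
proof -
  have "I \<inter> polys {} \<subseteq> {0}"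
  proof
    fix p assume p: "p \<in> I \<inter> polys {}"
    then have c: "p = Const (lookup p 0)" by (intro form_0_Const) (auto simp: polys_def form_def)
    have "p = 0"
    proof (rule ccontr)
      assume "p \<noteq> 0"
      then have "lookup p 0 \<noteq> 0" using c by force
      then have "Const (inverse (lookup p 0)) * Const (lookup p 0) = 1" by (simp add: mult_single)
      moreover have "Const (inverse (lookup p 0)) * p = Const (inverse (lookup p 0)) * Const (lookup p 0)"
        by (rule arg_cong[OF c])
      ultimately have "Const (inverse (lookup p 0)) * p = 1" by (simp only:)
      then show False using assms p by (metis IntD1 is_ideal_iff)
    qed
    then show "p \<in> {0}" by simp
  qed
  then have "\<exists>Y. I \<inter> polys Y \<subseteq> {0} \<and> (\<forall>Z. I \<inter> polys Z \<subseteq> {0} \<longrightarrow> card Z \<le> card Y)"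
    using ex_has_greatest_nat[of "\<lambda>Y. I \<inter> polys Y \<subseteq> {0}" "{}" card "Suc CARD('n)"] card_mono[of UNIV] 
    by (metis (no_types, lifting) finite le_imp_less_Suc subset_UNIV)
  then obtain Y where Y: "I \<inter> polys Y \<subseteq> {0}" "\<And>Z. I \<inter> polys Z \<subseteq> {0} \<Longrightarrow> card Z \<le> card Y" by blast
  have "\<exists>q\<in>I. q \<in> polys (insert z Y) \<and> q \<noteq> 0 \<and> 0 < zdeg z q" if "z \<notin> Y" for z
  proof -
    have "\<not> I \<inter> polys (insert z Y) \<subseteq> {0}" using Y(2)[of "insert z Y"] that by fastforce
    then obtain q where q: "q \<in> I" "q \<in> polys (insert z Y)" "q \<noteq> 0" by blast
    have "q \<notin> polys Y" using q Y(1) by blast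
    then have "0 < zdeg z q" using q polys_iff_zdeg[OF q(3)] by (metis gr0I insertE)
    then show ?thesis using q by blast
  qed
  then show thesis using that Y(1) by blast
qed

text \<open>By Zorn's lemma there is a maximal ideal \<open>P\<close> among those that contain
  \<open>I\<close> and miss \<open>S\<close>. If \<open>a\<close> and \<open>b\<close> are outside,
  then \<open>P\<close> together with either one meets \<open>S\<close>; multiplying the two
  elements of \<open>S\<close> shows that \<open>a * b\<close> is outside as well.\<close>

lemma prime_ideal_avoiding:
  fixes I S :: "'a::comm_ring_1 set"
  assumes "is_ideal I" "I \<inter> S = {}" "1 \<in> S" "\<And>a b. a \<in> S \<Longrightarrow> b \<in> S \<Longrightarrow> a * b \<in> S"
  obtains P where "prime_ideal P" "I \<subseteq> P" "P \<inter> S = {}"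
proof -
  define F where "F = {P. is_ideal P \<and> I \<subseteq> P \<and> P \<inter> S = {}}"
  have "\<exists>P\<in>F. \<forall>X\<in>F. P \<subseteq> X \<longrightarrow> X = P"
  proof (rule subset_Zorn_nonempty)
    show "F \<noteq> {}" using assms by (auto simp: F_def)
    fix C assume C: "C \<noteq> {}" "subset.chain F C"
    have ch: "\<And>x y. x \<in> C \<Longrightarrow> y \<in> C \<Longrightarrow> x \<subseteq> y \<or> y \<subseteq> x" and CF: "C \<subseteq> F"
      using C(2) by (auto simp: subset.chain_def)
    have "is_ideal (\<Union>C)" unfolding is_ideal_iff
    proof (intro conjI ballI allI)
      show "0 \<in> \<Union>C" using C(1) CF by (auto simp: F_def is_ideal_iff)
      fix x y assume "x \<in> \<Union>C" "y \<in> \<Union>C"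
      then obtain A B where AB: "A \<in> C" "B \<in> C" "x \<in> A" "y \<in> B" by blast
      then obtain D where D: "D \<in> C" "x \<in> D" "y \<in> D" using ch[OF AB(1,2)] by blast
      then have "is_ideal D" using CF by (auto simp: F_def)
      then have "x + y \<in> D" using D by (simp add: is_ideal_iff)
      then show "x + y \<in> \<Union>C" using D(1) by blast
    next
      fix c x assume "x \<in> \<Union>C"
      then obtain D where D: "D \<in> C" "x \<in> D" by blast
      then have "is_ideal D" using CF by (auto simp: F_def)
      then have "c * x \<in> D" using D by (simp add: is_ideal_iff)
      then show "c * x \<in> \<Union>C" using D(1) by blast
    qed
    then show "\<Union>C \<in> F" using C(1) CF by (auto simp: F_def)
  qed
  then obtain P where P: "P \<in> F" "\<And>X. X \<in> F \<Longrightarrow> P \<subseteq> X \<Longrightarrow> X = P" by blast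
  have Pi: "is_ideal P" "I \<subseteq> P" "P \<inter> S = {}" using P(1) by (auto simp: F_def)
  have meet: "\<exists>s\<in>S. \<exists>p\<in>P. \<exists>r. s = p + r * a" if "a \<notin> P" for a
  proof (rule ccontr)
    assume c: "\<not> ?thesis"
    define X where "X = {p + r * a | p r. p \<in> P}"
    have PX: "P \<subseteq> X"
    proof
      fix x assume "x \<in> P"
      moreover have "x = x + 0 * a" by simp
      ultimately show "x \<in> X" unfolding X_def by blast
    qed
    have "0 \<in> P" "a = 0 + 1 * a" using Pi(1) by (auto simp: is_ideal_iff)
    then have "a \<in> X" unfolding X_def by blast
    have "is_ideal X" unfolding is_ideal_iff
    proof (intro conjI ballI allI)
      show "0 \<in> X" using PX Pi by (auto simp: is_ideal_iff)
      fix x y assume "x \<in> X" "y \<in> X"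
      then obtain p r q s where xy: "x = p + r * a" "p \<in> P" "y = q + s * a" "q \<in> P" by (auto simp: X_def)
      then have "p + q \<in> P" using Pi(1) by (simp add: is_ideal_iff)
      moreover have "x + y = (p + q) + (r + s) * a" unfolding xy by (simp add: algebra_simps)
      ultimately show "x + y \<in> X" unfolding X_def by blast
    next
      fix t x assume "x \<in> X"
      then obtain p r where xp: "x = p + r * a" "p \<in> P" by (auto simp: X_def)
      then have "t * p \<in> P" using Pi(1) by (simp add: is_ideal_iff)
      moreover have "t * x = t * p + (t * r) * a" unfolding xp by (simp add: algebra_simps)
      ultimately show "t * x \<in> X" unfolding X_def by blast
    qed
    moreover have "X \<inter> S = {}" using c by (auto simp: X_def)
    ultimately have "X \<in> F" using PX Pi by (auto simp: F_def)
    then show False using P(2) PX \<open>a \<in> X\<close> that by blast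
  qed
  have "prime_ideal P" unfolding prime_ideal_def
  proof (intro conjI allI impI)
    show "P \<noteq> UNIV" using Pi(3) assms(3) by blast
    fix a b assume ab: "a * b \<in> P"
    show "a \<in> P \<or> b \<in> P"
    proof (rule ccontr)
      assume "\<not> ?thesis"
      then have "a \<notin> P" "b \<notin> P" by auto
      obtain s p r where s1: "s \<in> S" "p \<in> P" "s = p + r * a" using meet[OF \<open>a \<notin> P\<close>] by blast
      obtain t q u where s2: "t \<in> S" "q \<in> P" "t = q + u * b" using meet[OF \<open>b \<notin> P\<close>] by blast
      note s = s1 s2
      have "s * t = t * p + (r * a) * q + (r * u) * (a * b)"
        unfolding s(3,6) by (simp add: algebra_simps)
      moreover have "t * p \<in> P" "(r * a) * q \<in> P" "(r * u) * (a * b) \<in> P"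
        using Pi(1) s(2,5) ab unfolding is_ideal_iff by blast+
      then have "t * p + (r * a) * q + (r * u) * (a * b) \<in> P" using Pi(1) unfolding is_ideal_iff by blast
      ultimately show False using assms(4)[OF s(1,4)] Pi(3) by (metis disjoint_iff)
    qed
  qed (use Pi in simp)
  then show thesis using that Pi by blast
qed

section \<open>The canonical map and the Bourbaki ideal\<close>

definition zlt :: "'n \<Rightarrow> nat \<Rightarrow> ('n, 'k::zero) mpoly \<Rightarrow> bool" where
  "zlt z n p \<longleftrightarrow> (\<forall>m\<in>keys p. lookup m z < n)"

lemma zlt_minus: "zlt z n p \<Longrightarrow> zlt z n q \<Longrightarrow> zlt z n (p - q)" for p :: "('n, 'k::comm_ring_1) mpoly"
  unfolding zlt_def using keys_minus_le by blast

lemma zlt_mult: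
  fixes p q :: "('n, 'k::comm_ring_1) mpoly"
  assumes "zhom z 0 q" "zlt z n p" shows "zlt z n (q * p)"
  unfolding zlt_def
proof
  fix m assume "m \<in> keys (q * p)"
  then obtain a b where "m = a + b" "a \<in> keys q" "b \<in> keys p" using keys_mult[of q p] by blast
  then show "lookup m z < n" using assms by (simp add: zlt_def whom_def lookup_add)
qed

lemma zltI: "r = 0 \<or> zdeg z r < n \<Longrightarrow> zlt z n r"
proof (unfold zlt_def, intro ballI)
  fix m assume "r = 0 \<or> zdeg z r < n" "m \<in> keys r"
  then show "lookup m z < n" using wdeg_ge[of m r "\<lambda>m. lookup m z"] by auto
qed

text \<open>A nonzero multiple of \<open>q\<close> has at least the degree of \<open>q\<close> in
  \<open>z\<close>.\<close>

lemma zlt_multiple_eq_0: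
  fixes q t :: "('n::linorder, 'k::idom) mpoly"
  assumes "zlt z (zdeg z q) (q * t)" shows "q * t = 0"
proof (rule ccontr)
  assume nz: "q * t \<noteq> 0"
  then have "zdeg z (q * t) = zdeg z q + zdeg z t" by (intro zdeg_mult) auto
  moreover obtain m where "m \<in> keys (q * t)" "lookup m z = zdeg z (q * t)"
    using wdeg_in[OF nz, of "\<lambda>m. lookup m z"] by blast
  ultimately show False using assms by (auto simp: zlt_def)
qed

lemma pseudo_division_over:
  fixes q c :: "('n::linorder, 'k::idom) mpoly"
  assumes "z \<notin> Y" "q \<in> polys (insert z Y)" "q \<noteq> 0"
  obtains s a r where "s \<in> polys Y" "s \<noteq> 0" "s * c = q * a + r" "zlt z (zdeg z q) r"
proof -
  obtain l where l: "l \<in> polys (insert z Y - {z})" "zcomp z (zdeg z q) q = l * Xpow z (zdeg z q)"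
    using zcoef_exists[OF polys_wcomp[OF assms(2)] whom_wcomp] by blast
  then have lY: "l \<in> polys Y" using assms(1) by simp
  have l0: "l \<noteq> 0" using l wcomp_wdeg_neq_0[OF assms(3), of "\<lambda>m. lookup m z"] by auto
  obtain k a r where "l ^ k * c = q * a + r" "r = 0 \<or> zdeg z r < zdeg z q"
    using pseudo_division[of z UNIV q l c] assms(3) polys_zhom[OF lY assms(1)] l(2) by auto
  then show thesis using that[of "l ^ k" a r] polys_power[OF lY] l0 zltI[of r z] by simp
qed

text \<open>Let \<open>r\<close> be the remainder of \<open>u\<close> modulo \<open>q1\<close>.
  Multiplication by \<open>q2\<close>, which is free of \<open>z\<close>, turns it into a multiple
  of \<open>q1\<close> of too small a degree in \<open>z\<close>, hence into 0.\<close>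

lemma divides_up_to_polys:
  fixes q1 q2 u v :: "('n::linorder, 'k::idom) mpoly"
  assumes "z \<notin> Y" "q1 \<in> polys (insert z Y)" "q1 \<noteq> 0" "zhom z 0 q2" "q2 \<noteq> 0" "q2 * u = q1 * v"
  obtains s where "s \<in> polys Y" "s \<noteq> 0" "q1 dvd s * u"
proof -
  obtain s a r where s: "s \<in> polys Y" "s \<noteq> 0" "s * u = q1 * a + r" "zlt z (zdeg z q1) r"
    using pseudo_division_over[OF assms(1-3)] by blast
  have "q2 * r = q2 * (s * u) - q1 * (q2 * a)" unfolding s(3) by (simp add: algebra_simps)
  also have "q2 * (s * u) = q1 * (s * v)" using assms(6) by (metis mult.left_commute)
  finally have eq: "q2 * r = q1 * (s * v - q2 * a)" by (simp add: algebra_simps)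
  have "zlt z (zdeg z q1) (q2 * r)" using zlt_mult[OF assms(4) s(4)] .
  then have "q2 * r = 0" using zlt_multiple_eq_0 eq by metis
  then have "r = 0" using assms(5) by simp
  then show thesis using that s by simp
qed

text \<open>Replace \<open>c\<close> and \<beta> by their remainders modulo \<open>q1\<close> in
  \<open>z1\<close>. The resulting equation has too small a degree in \<open>z1\<close> for a
  nonzero multiple of \<open>q1\<close>, so it becomes a relation between \<open>q2\<close> and
  \<open>q3\<close> alone, and \<open>divides_up_to_polys\<close> in \<open>z2\<close>
  applies.\<close>

lemma regular_up_to_polys:
  fixes q1 q2 q3 c :: "('n::linorder, 'k::idom) mpoly"
  assumes "z1 \<notin> Y" "z2 \<notin> Y" "z3 \<notin> Y" "z1 \<noteq> z2" "z1 \<noteq> z3" "z2 \<noteq> z3"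
    "q1 \<in> polys (insert z1 Y)" "q1 \<noteq> 0" "q2 \<in> polys (insert z2 Y)" "q2 \<noteq> 0"
    "q3 \<in> polys (insert z3 Y)" "q3 \<noteq> 0" and c: "q3 * c = \<alpha> * q1 + \<beta> * q2"
  obtains s a b where "s \<in> polys Y" "s \<noteq> 0" "s * c = a * q1 + b * q2"
proof -
  obtain s1 a1 c' where 1: "s1 \<in> polys Y" "s1 \<noteq> 0" "s1 * c = q1 * a1 + c'" "zlt z1 (zdeg z1 q1) c'"
    using pseudo_division_over[OF assms(1,7,8)] by blast
  obtain s2 a2 \<beta>' where 2: "s2 \<in> polys Y" "s2 \<noteq> 0" "s2 * \<beta> = q1 * a2 + \<beta>'" "zlt z1 (zdeg z1 q1) \<beta>'"
    using pseudo_division_over[OF assms(1,7,8)] by blast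
  have h: "zhom z1 0 s1" "zhom z1 0 s2" "zhom z1 0 q2" "zhom z1 0 q3" "zhom z2 0 q3"
    using polys_zhom 1 2 assms by (metis insert_iff)+
  have "q3 * (s2 * c') - q2 * (s1 * \<beta>') = s2 * s1 * (q3 * c) - q3 * s2 * (q1 * a1) - q2 * s1 * (s2 * \<beta> - q1 * a2)"
    using 1(3) 2(3) by Groebner_Basis.algebra
  also have "\<dots> = q1 * (s2 * s1 * \<alpha> - q3 * s2 * a1 + q2 * s1 * a2)"
    unfolding c by (simp add: algebra_simps)
  finally have eq: "q3 * (s2 * c') - q2 * (s1 * \<beta>') = q1 * (s2 * s1 * \<alpha> - q3 * s2 * a1 + q2 * s1 * a2)" .
  have "zlt z1 (zdeg z1 q1) (q3 * (s2 * c') - q2 * (s1 * \<beta>'))"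
    using h 1 2 by (intro zlt_minus zlt_mult)
  then have "q3 * (s2 * c') - q2 * (s1 * \<beta>') = 0" using eq zlt_multiple_eq_0 by metis
  then have "q3 * (s2 * c') = q2 * (s1 * \<beta>')" by simp
  from divides_up_to_polys[OF assms(2,9,10) h(5) assms(12) this]
  obtain s where s: "s \<in> polys Y" "s \<noteq> 0" "q2 dvd s * (s2 * c')" by blast
  then obtain b where b: "s * (s2 * c') = q2 * b" by blast
  have "s * s2 * s1 * c = s * s2 * (q1 * a1) + s * (s2 * c')"
    using 1(3) by Groebner_Basis.algebra
  also have "\<dots> = (s * s2 * a1) * q1 + b * q2" unfolding b by (simp add: algebra_simps)
  finally show thesis using that[of "s * s2 * s1"] s 1 2 polys_mult by (metis mult_eq_0_iff)
qed

section \<open>Vectors with three entries\<close>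

lemma all_less_3: "(\<forall>i<3. P i) \<longleftrightarrow> P 0 \<and> P 1 \<and> P (2::nat)"
  by (auto simp: numeral_3_eq_3 less_Suc_eq numeral_2_eq_2)

lemma ex_less_3: "(\<exists>i<3. P i) \<longleftrightarrow> P 0 \<or> P 1 \<or> P (2::nat)"
  by (auto simp: numeral_3_eq_3 less_Suc_eq numeral_2_eq_2)

lemma scalar_prod_3: "w \<in> carrier_vec 3 \<Longrightarrow> v \<bullet> w = v $ 0 * w $ 0 + v $ 1 * w $ 1 + v $ 2 * w $ 2"
  by (simp add: scalar_prod_def numeral_3_eq_3 numeral_2_eq_2)

lemma vec_3_eqI:
  "v \<in> carrier_vec 3 \<Longrightarrow> w \<in> carrier_vec 3 \<Longrightarrow> v $ 0 = w $ 0 \<Longrightarrow> v $ 1 = w $ 1 \<Longrightarrow> v $ 2 = w $ 2 \<Longrightarrow> v = w"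
  using all_less_3[of "\<lambda>i. v $ i = w $ i"] by (intro eq_vecI) auto

definition vec3 :: "'a \<Rightarrow> 'a \<Rightarrow> 'a \<Rightarrow> 'a vec" where
  "vec3 a b c = vec 3 (\<lambda>i. if i = 0 then a else if i = 1 then b else c)"

lemma vec3_simps [simp]: "vec3 a b c $ 0 = a" "vec3 a b c $ Suc 0 = b" "vec3 a b c $ 1 = b" "vec3 a b c $ 2 = c"
  "vec3 a b c \<in> carrier_vec 3" "dim_vec (vec3 a b c) = 3"
  by (auto simp: vec3_def)

text \<open>For a nonzero \<open>f k\<close>, the products \<open>A k * f j = A j * f k\<close> are
  all divisible by \<open>f k\<close>, so primitivity forces \<open>f k\<close> to divide
  \<open>A k\<close>.\<close>

lemma primitive_proportional:
  fixes A f :: "nat \<Rightarrow> ('n::{finite,linorder}, 'k::field) mpoly"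
  assumes "primitive (f ` {..<3})" "\<And>i j. i < 3 \<Longrightarrow> j < 3 \<Longrightarrow> A i * f j = A j * f i"
  shows "\<exists>g. \<forall>i<3. A i = g * f i"
proof -
  obtain p0 :: "('n, 'k) mpoly" where "irreducible p0" using irreducible_exists by blast
  then obtain k where k: "k < 3" "\<not> p0 dvd f k" using assms(1) by (auto simp: primitive_def)
  then have fk: "f k \<noteq> 0" by auto
  have "f k dvd A k"
    by (rule primitive_dvd[OF assms(1) fk]) (use assms(2)[OF k(1)] in auto)
  then obtain g where g: "A k = f k * g" by blast
  have "A j = g * f j" if "j < 3" for j
  proof -
    have "f k * A j = f k * (g * f j)" using assms(2)[OF k(1) that] g by Groebner_Basis.algebra
    then show ?thesis using mult_left_cancel[OF fk] by blast
  qed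
  then show ?thesis by blast
qed

definition entries3 :: "'a vec \<Rightarrow> 'a set" where
  "entries3 v = (\<lambda>i. v $ i) ` {..<3}"

text \<open>Minimality of the degree of \<nu> enters in the form of primitive entries, see
  \<open>minimal_syzygy_primitive\<close>.\<close>

locale bourbaki_setup =
  fixes f \<nu> :: "('n::{finite,linorder}, 'k::field) mpoly vec" and d e :: int
  assumes f: "f \<in> carrier_vec 3" "\<forall>i<3. form d (f $ i)" "primitive (entries3 f)"
    and nu: "\<nu> \<in> syzygies f" "\<forall>i<3. form e (\<nu> $ i)" "primitive (entries3 \<nu>)"
begin

lemma nu_carrier: "\<nu> \<in> carrier_vec 3"
  using nu(1) f(1) by (simp add: syzygies_def)

lemma syz_iff: "w \<in> syzygies f \<longleftrightarrow> w \<in> carrier_vec 3 \<and> f $ 0 * w $ 0 + f $ 1 * w $ 1 + f $ 2 * w $ 2 = 0"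
  using f(1) scalar_prod_3[of w f] by (auto simp: syzygies_def)

lemma syz_carrier: "w \<in> syzygies f \<Longrightarrow> w \<in> carrier_vec 3"
  by (simp add: syz_iff)

lemma syz_dim: "w \<in> syzygies f \<Longrightarrow> dim_vec w = 3"
  using syz_carrier by auto

lemma syz_index:
  assumes "w \<in> syzygies f" "i < 3"
  shows "(v + w) $ i = v $ i + w $ i" "(r \<cdot>\<^sub>v w) $ i = r * w $ i"
  using assms syz_dim[OF assms(1)] by auto

lemmas syz_index' = syz_index[where i = 0] syz_index[where i = 1] syz_index[where i = 2]

lemma syz_add: "v \<in> syzygies f \<Longrightarrow> w \<in> syzygies f \<Longrightarrow> v + w \<in> syzygies f"
proof -
  assume v: "v \<in> syzygies f" and w: "w \<in> syzygies f"
  have "(f $ 0 * v $ 0 + f $ 1 * v $ 1 + f $ 2 * v $ 2) + (f $ 0 * w $ 0 + f $ 1 * w $ 1 + f $ 2 * w $ 2) = 0"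
    using v w by (simp add: syz_iff)
  then have "f $ 0 * (v + w) $ 0 + f $ 1 * (v + w) $ 1 + f $ 2 * (v + w) $ 2 = 0"
    using syz_index'[OF w] by (simp add: algebra_simps)
  then show ?thesis using syz_carrier[OF v] syz_carrier[OF w] by (simp add: syz_iff)
qed

lemma syz_smult: "w \<in> syzygies f \<Longrightarrow> r \<cdot>\<^sub>v w \<in> syzygies f"
proof -
  assume w: "w \<in> syzygies f"
  then have "r * (f $ 0 * w $ 0 + f $ 1 * w $ 1 + f $ 2 * w $ 2) = 0" by (simp add: syz_iff)
  then have "f $ 0 * (r \<cdot>\<^sub>v w) $ 0 + f $ 1 * (r \<cdot>\<^sub>v w) $ 1 + f $ 2 * (r \<cdot>\<^sub>v w) $ 2 = 0"
    using syz_index'[OF w] by (simp add: algebra_simps)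
  then show ?thesis using syz_carrier[OF w] by (simp add: syz_iff)
qed

text \<open>The left-hand sides are the entries of the cross product of \<nu> and
  \<open>w\<close>.\<close>

definition is_phi :: "('n, 'k) mpoly vec \<Rightarrow> ('n, 'k) mpoly \<Rightarrow> bool" where
  "is_phi w g \<longleftrightarrow> \<nu> $ 1 * w $ 2 - \<nu> $ 2 * w $ 1 = g * f $ 0 \<and>
     \<nu> $ 2 * w $ 0 - \<nu> $ 0 * w $ 2 = g * f $ 1 \<and> \<nu> $ 0 * w $ 1 - \<nu> $ 1 * w $ 0 = g * f $ 2"

definition phi :: "('n, 'k) mpoly vec \<Rightarrow> ('n, 'k) mpoly" where
  "phi w = (THE g. is_phi w g)"

lemma primitive_neq_0: "primitive (entries3 (v :: ('n, 'k) mpoly vec)) \<Longrightarrow> \<exists>i<3. v $ i \<noteq> 0"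
proof -
  assume v: "primitive (entries3 v)"
  obtain p0 :: "('n, 'k) mpoly" where "irreducible p0" using irreducible_exists by blast
  then obtain k where k: "k < 3" "\<not> p0 dvd v $ k" using v by (auto simp: primitive_def entries3_def)
  then have "v $ k \<noteq> 0" by (metis dvd_0_right)
  then show ?thesis using k by blast
qed

lemma f_neq_0: "f $ 0 \<noteq> 0 \<or> f $ 1 \<noteq> 0 \<or> f $ 2 \<noteq> 0"
  using primitive_neq_0[OF f(3)] unfolding ex_less_3 .

lemma is_phi_unique: "is_phi w g \<Longrightarrow> is_phi w h \<Longrightarrow> g = h"
  using f_neq_0 unfolding is_phi_def by (metis mult_right_cancel)

text \<open>Both \<nu> and \<open>w\<close> are orthogonal to \<open>f\<close>, so their cross
  product is parallel to \<open>f\<close>, and \<open>f\<close> has primitive entries.\<close>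

lemma is_phi_exists:
  assumes w: "w \<in> syzygies f" shows "\<exists>g. is_phi w g"
proof -
  define A where "A = (\<lambda>i::nat. if i = 0 then \<nu> $ 1 * w $ 2 - \<nu> $ 2 * w $ 1
    else if i = 1 then \<nu> $ 2 * w $ 0 - \<nu> $ 0 * w $ 2 else \<nu> $ 0 * w $ 1 - \<nu> $ 1 * w $ 0)"
  have w0: "f $ 0 * w $ 0 + f $ 1 * w $ 1 + f $ 2 * w $ 2 = 0"
    and n0: "f $ 0 * \<nu> $ 0 + f $ 1 * \<nu> $ 1 + f $ 2 * \<nu> $ 2 = 0"
    using w nu(1) by (auto simp: syz_iff)
  have 1: "A 0 * f $ 1 = A 1 * f $ 0" "A 0 * f $ 2 = A 2 * f $ 0" "A 1 * f $ 2 = A 2 * f $ 1"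
    unfolding A_def using w0 n0 by (simp_all, Groebner_Basis.algebra+)
  have "\<forall>i<3. \<forall>j<3. A i * f $ j = A j * f $ i"
    unfolding all_less_3 using 1 by simp
  then obtain g where "\<forall>i<3. A i = g * f $ i"
    using primitive_proportional[of "\<lambda>i. f $ i" A] f(3) by (auto simp: entries3_def)
  then show ?thesis unfolding all_less_3 is_phi_def A_def by auto
qed

lemma is_phi_phi: "w \<in> syzygies f \<Longrightarrow> is_phi w (phi w)"
  unfolding phi_def by (rule theI') (metis is_phi_exists is_phi_unique)

lemma phi_eqI: "is_phi w g \<Longrightarrow> phi w = g"
  unfolding phi_def using is_phi_unique by blast

lemma phi_add: "v \<in> syzygies f \<Longrightarrow> w \<in> syzygies f \<Longrightarrow> phi (v + w) = phi v + phi w"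
  using is_phi_phi[of v] is_phi_phi[of w] syz_index'(1,3,5)[of w v]
  by (intro phi_eqI) (simp add: is_phi_def, Groebner_Basis.algebra)

lemma phi_smult: "w \<in> syzygies f \<Longrightarrow> phi (r \<cdot>\<^sub>v w) = r * phi w"
  using is_phi_phi[of w] syz_index'(2,4,6)[of w r]
  by (intro phi_eqI) (simp add: is_phi_def, Groebner_Basis.algebra)

text \<open>A vanishing cross product makes \<open>w\<close> parallel to \<nu>, and the entries of
  \<nu> are primitive.\<close>

lemma phi_kernel: 
  assumes "w \<in> syzygies f" shows "phi w = 0 \<longleftrightarrow> (\<exists>r. w = r \<cdot>\<^sub>v \<nu>)"
proof
  assume "phi w = 0"
  then have "is_phi w 0" using is_phi_phi[OF assms] by simp
  then have "\<forall>i<3. \<forall>j<3. w $ i * \<nu> $ j = w $ j * \<nu> $ i"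
    unfolding all_less_3 is_phi_def by (auto simp: mult.commute)
  then obtain r where "\<forall>i<3. w $ i = r * \<nu> $ i"
    using primitive_proportional[of "\<lambda>i. \<nu> $ i" "\<lambda>i. w $ i"] nu(3) by (auto simp: entries3_def)
  then have "w = r \<cdot>\<^sub>v \<nu>"
    unfolding all_less_3 using syz_carrier[OF assms] nu_carrier by (intro vec_3_eqI) auto
  then show "\<exists>r. w = r \<cdot>\<^sub>v \<nu>" by blast
next
  assume "\<exists>r. w = r \<cdot>\<^sub>v \<nu>"
  then obtain r where "w = r \<cdot>\<^sub>v \<nu>" by blast
  then show "phi w = 0" using nu_carrier by (intro phi_eqI) (auto simp: is_phi_def mult_ac)
qed

text \<open>The vectors are the cross products of \<open>f\<close> with the unit vectors e. The
  triple product expansion gives \<nu> \<times> (f \<times> e) = (\<nu> \<bullet> e) f - (\<nu>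
  \<bullet> f) e, where the last term vanishes.\<close>

lemma phi_koszul:
  "vec3 0 (f $ 2) (- f $ 1) \<in> syzygies f" "phi (vec3 0 (f $ 2) (- f $ 1)) = \<nu> $ 0"
  "vec3 (- f $ 2) 0 (f $ 0) \<in> syzygies f" "phi (vec3 (- f $ 2) 0 (f $ 0)) = \<nu> $ 1"
  "vec3 (f $ 1) (- f $ 0) 0 \<in> syzygies f" "phi (vec3 (f $ 1) (- f $ 0) 0) = \<nu> $ 2"
proof -
  have n0: "f $ 0 * \<nu> $ 0 + f $ 1 * \<nu> $ 1 + f $ 2 * \<nu> $ 2 = 0"
    using nu(1) by (auto simp: syz_iff)
  show "vec3 0 (f $ 2) (- f $ 1) \<in> syzygies f" "vec3 (- f $ 2) 0 (f $ 0) \<in> syzygies f"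
    "vec3 (f $ 1) (- f $ 0) 0 \<in> syzygies f" by (auto simp: syz_iff)
  have "is_phi (vec3 0 (f $ 2) (- f $ 1)) (\<nu> $ 0)"
    unfolding is_phi_def vec3_simps
  proof (intro conjI)
    show "\<nu> $ 1 * - f $ 1 - \<nu> $ 2 * f $ 2 = \<nu> $ 0 * f $ 0" using n0 by Groebner_Basis.algebra
  qed simp_all
  then show "phi (vec3 0 (f $ 2) (- f $ 1)) = \<nu> $ 0" by (rule phi_eqI)
  have "is_phi (vec3 (- f $ 2) 0 (f $ 0)) (\<nu> $ 1)"
    unfolding is_phi_def vec3_simps
  proof (intro conjI)
    show "\<nu> $ 2 * - f $ 2 - \<nu> $ 0 * f $ 0 = \<nu> $ 1 * f $ 1" using n0 by Groebner_Basis.algebra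
  qed simp_all
  then show "phi (vec3 (- f $ 2) 0 (f $ 0)) = \<nu> $ 1" by (rule phi_eqI)
  have "is_phi (vec3 (f $ 1) (- f $ 0) 0) (\<nu> $ 2)"
    unfolding is_phi_def vec3_simps
  proof (intro conjI)
    show "\<nu> $ 0 * - f $ 0 - \<nu> $ 1 * f $ 1 = \<nu> $ 2 * f $ 2" using n0 by Groebner_Basis.algebra
  qed simp_all
  then show "phi (vec3 (f $ 1) (- f $ 0) 0) = \<nu> $ 2" by (rule phi_eqI)
qed

section \<open>The image of the canonical map and its grading\<close>

definition bideal :: "('n, 'k) mpoly set" where
  "bideal = phi ` syzygies f"

lemma is_ideal_bideal: "is_ideal bideal"
  unfolding is_ideal_iff
proof (intro conjI ballI allI)
  have "0 \<cdot>\<^sub>v \<nu> \<in> syzygies f" using syz_smult nu(1) by blast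
  moreover have "phi (0 \<cdot>\<^sub>v \<nu>) = 0" using phi_smult[OF nu(1), of 0] by simp
  ultimately show "0 \<in> bideal" unfolding bideal_def by (metis image_eqI)
next
  fix x y assume "x \<in> bideal" "y \<in> bideal"
  then show "x + y \<in> bideal" unfolding bideal_def using phi_add syz_add by (auto simp: image_iff) metis
next
  fix c x assume "x \<in> bideal"
  then show "c * x \<in> bideal" unfolding bideal_def using phi_smult syz_smult by (auto simp: image_iff) metis
qed

lemma nu_in_bideal: "i < 3 \<Longrightarrow> \<nu> $ i \<in> bideal"
proof -
  have "\<forall>i<3. \<nu> $ i \<in> bideal"
    unfolding all_less_3 bideal_def using phi_koszul by (metis image_eqI)
  then show "i < 3 \<Longrightarrow> \<nu> $ i \<in> bideal" by blast
qed

lemma primitive_bideal: "primitive bideal"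
  by (rule primitive_mono[OF nu(3)]) (auto simp: entries3_def nu_in_bideal)

definition vcomp :: "int \<Rightarrow> ('n, 'k) mpoly vec \<Rightarrow> ('n, 'k) mpoly vec" where
  "vcomp c w = vec 3 (\<lambda>i. hcomp c (w $ i))"

lemma vcomp_simps [simp]: "i < 3 \<Longrightarrow> vcomp c w $ i = hcomp c (w $ i)" "vcomp c w \<in> carrier_vec 3"
  by (auto simp: vcomp_def)

lemma vec_form_vcomp: "vec_form c (vcomp c w)"
  by (auto simp: vec_form_def vcomp_def)

lemma hcomp_mult_f: "i < 3 \<Longrightarrow> hcomp (c + d) (f $ i * p) = f $ i * hcomp c p"
  using hcomp_mult[of d "f $ i" "c + d" p] f(2) by simp

lemma hcomp_mult_nu: "i < 3 \<Longrightarrow> hcomp (c + e) (\<nu> $ i * p) = \<nu> $ i * hcomp c p"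
  using hcomp_mult[of e "\<nu> $ i" "c + e" p] nu(2) by simp

lemma vcomp_syz:
  assumes "w \<in> syzygies f" shows "vcomp c w \<in> syzygies f"
proof -
  have "hcomp (c + d) (f $ 0 * w $ 0 + f $ 1 * w $ 1 + f $ 2 * w $ 2) = 0"
    using assms by (simp add: syz_iff)
  then show ?thesis by (simp add: syz_iff wcomp_add hcomp_mult_f)
qed

lemma phi_vcomp:
  assumes "w \<in> syzygies f" shows "phi (vcomp c w) = hcomp (c + e - d) (phi w)"
proof (rule phi_eqI)
  have g: "hcomp (c + e) (phi w * f $ i) = hcomp (c + e - d) (phi w) * f $ i" if "i < 3" for i
    using hcomp_mult_f[OF that, of "c + e - d" "phi w"] by (simp add: mult.commute)
  have eqs: "hcomp (c + e) (\<nu> $ 1 * w $ 2 - \<nu> $ 2 * w $ 1) = hcomp (c + e) (phi w * f $ 0)"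
    "hcomp (c + e) (\<nu> $ 2 * w $ 0 - \<nu> $ 0 * w $ 2) = hcomp (c + e) (phi w * f $ 1)"
    "hcomp (c + e) (\<nu> $ 0 * w $ 1 - \<nu> $ 1 * w $ 0) = hcomp (c + e) (phi w * f $ 2)"
    using is_phi_phi[OF assms] unfolding is_phi_def by simp_all
  show "is_phi (vcomp c w) (hcomp (c + e - d) (phi w))"
    unfolding is_phi_def using eqs by (simp add: wcomp_minus hcomp_mult_nu g)
qed

lemma vcomp_vec_form: "w \<in> carrier_vec 3 \<Longrightarrow> vec_form c w \<Longrightarrow> vcomp c w = w"
  by (intro eq_vecI) (auto simp: vcomp_def vec_form_def hcomp_form)

lemma form_phi: "w \<in> syzygies f \<Longrightarrow> vec_form c w \<Longrightarrow> form (c + e - d) (phi w)"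
  using phi_vcomp[of w c] vcomp_vec_form[OF syz_carrier, of w c] by (metis form_hcomp)

lemma hcomp_bideal: "g \<in> bideal \<Longrightarrow> hcomp c g \<in> bideal"
proof -
  assume "g \<in> bideal"
  then obtain w where w: "w \<in> syzygies f" "g = phi w" by (auto simp: bideal_def)
  have "hcomp c g = phi (vcomp (c + d - e) w)" using phi_vcomp[OF w(1), of "c + d - e"] w(2) by simp
  then show ?thesis unfolding bideal_def using vcomp_syz[OF w(1)] by blast
qed

lemma homogeneous_bideal: "homogeneous_ideal bideal"
  unfolding homogeneous_ideal_def
proof (intro conjI equalityI)
  show "is_ideal bideal" by (rule is_ideal_bideal)
  show "ideal_gen {p \<in> bideal. \<exists>d. form d p} \<subseteq> bideal"
    by (rule ideal.span_minimal) (auto simp: is_ideal_bideal)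
  show "bideal \<subseteq> ideal_gen {p \<in> bideal. \<exists>d. form d p}"
  proof
    fix g assume g: "g \<in> bideal"
    have "g = (\<Sum>c\<in>(\<lambda>m. int (mdeg m)) ` keys g. hcomp c g)" by (rule wcomp_decomp) auto
    also have "\<dots> \<in> ideal_gen {p \<in> bideal. \<exists>d. form d p}"
      using hcomp_bideal[OF g] form_hcomp by (intro ideal.span_sum ideal.span_base) blast
    finally show "g \<in> ideal_gen {p \<in> bideal. \<exists>d. form d p}" .
  qed
qed

lemma quot_iso_bideal: "quot_iso_ideal (syzygies f) \<nu> bideal"
  unfolding quot_iso_ideal_def
proof (intro exI[of _ phi] exI[of _ "e - d"] conjI ballI allI impI)
  show "{v \<in> syzygies f. phi v = 0} = {r \<cdot>\<^sub>v \<nu> | r. True}"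
    using phi_kernel syz_smult[OF nu(1)] by blast
qed (auto simp: phi_add phi_smult bideal_def algebra_simps dest: form_phi)

text \<open>Modulo \<open>\<nu>\<close>, the syzygies \<open>w\<^sub>i\<close> with \<open>\<phi>(w\<^sub>i) = q\<^sub>i a\<close> satisfy \<open>q\<^sub>i w\<^sub>j = q\<^sub>j w\<^sub>i\<close>; the differences form a
  cocycle with coefficients in \<open>R\<close>, which becomes a coboundary after multiplication by some \<open>s\<close> because
  \<open>q\<^sub>1, q\<^sub>2, q\<^sub>3\<close> is a regular sequence up to polynomials in the variables \<open>Y\<close>.\<close>

lemma bideal_torsion:
  assumes Y: "z1 \<notin> Y" "z2 \<notin> Y" "z3 \<notin> Y" "z1 \<noteq> z2" "z1 \<noteq> z3" "z2 \<noteq> z3"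
    and q: "q1 \<in> polys (insert z1 Y)" "q1 \<noteq> 0" "q2 \<in> polys (insert z2 Y)" "q2 \<noteq> 0"
      "q3 \<in> polys (insert z3 Y)" "q3 \<noteq> 0"
    and a: "q1 * a \<in> bideal" "q2 * a \<in> bideal" "q3 * a \<in> bideal"
  obtains s where "s \<in> polys Y" "s \<noteq> 0" "s * a \<in> bideal"
proof -
  obtain w1 w2 w3 where w: "w1 \<in> syzygies f" "w2 \<in> syzygies f" "w3 \<in> syzygies f"
    "q1 * a = phi w1" "q2 * a = phi w2" "q3 * a = phi w3"
    using a unfolding bideal_def by blast
  have cocycle: "\<exists>c. \<forall>i<3. p * v $ i - q * w $ i = c * \<nu> $ i"
    if vw: "v \<in> syzygies f" "w \<in> syzygies f" "q * a = phi v" "p * a = phi w" for p q v w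
  proof -
    have s: "p \<cdot>\<^sub>v v + (- q) \<cdot>\<^sub>v w \<in> syzygies f" using vw by (intro syz_add syz_smult)
    have "phi (p \<cdot>\<^sub>v v + (- q) \<cdot>\<^sub>v w) = 0"
      unfolding phi_add[OF syz_smult[OF vw(1)] syz_smult[OF vw(2)]] phi_smult[OF vw(1)] phi_smult[OF vw(2)]
        vw(3,4)[symmetric] by (simp add: mult.left_commute)
    then obtain c where "p \<cdot>\<^sub>v v + (- q) \<cdot>\<^sub>v w = c \<cdot>\<^sub>v \<nu>" using phi_kernel[OF s] by blast
    then have eq: "(p \<cdot>\<^sub>v v + (- q) \<cdot>\<^sub>v w) $ i = (c \<cdot>\<^sub>v \<nu>) $ i" for i by simp
    have "p * v $ i - q * w $ i = c * \<nu> $ i" if "i < 3" for i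
      using eq[of i] unfolding syz_index(1)[OF syz_smult[OF vw(2)] that] syz_index(2)[OF vw(1) that] syz_index(2)[OF vw(2) that]
        syz_index(2)[OF nu(1) that] by simp
    then show ?thesis by blast
  qed
  obtain c12 where c12: "\<And>i. i < 3 \<Longrightarrow> q2 * w1 $ i - q1 * w2 $ i = c12 * \<nu> $ i"
    using cocycle[OF w(1,2,4,5)] by blast
  obtain c13 where c13: "\<And>i. i < 3 \<Longrightarrow> q3 * w1 $ i - q1 * w3 $ i = c13 * \<nu> $ i"
    using cocycle[OF w(1,3,4,6)] by blast
  obtain c23 where c23: "\<And>i. i < 3 \<Longrightarrow> q3 * w2 $ i - q2 * w3 $ i = c23 * \<nu> $ i"
    using cocycle[OF w(2,3,5,6)] by blast
  obtain i where i: "i < 3" "\<nu> $ i \<noteq> 0" using primitive_neq_0[OF nu(3)] by blast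
  have "(q3 * c12) * \<nu> $ i = (q2 * c13 - q1 * c23) * \<nu> $ i"
    using c12[OF i(1)] c13[OF i(1)] c23[OF i(1)] by Groebner_Basis.algebra
  then have "q3 * c12 = (- c23) * q1 + c13 * q2" using i by (simp add: mult_ac)
  from regular_up_to_polys[OF Y q this] obtain s \<alpha> \<beta> where
    s: "s \<in> polys Y" "s \<noteq> 0" "s * c12 = \<alpha> * q1 + \<beta> * q2" by blast
  \<comment> \<open>The coboundary corrects \<open>s\<close> times the syzygies by multiples of
    \<nu>, so that proportionality modulo \<nu> becomes an equation.\<close>
  have eq: "q2 * (s * w1 $ i - \<beta> * \<nu> $ i) = q1 * (s * w2 $ i + \<alpha> * \<nu> $ i)" if "i < 3" for i
    using c12[OF that] s(3) by Groebner_Basis.algebra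
  have hz: "zhom z1 0 q2" using polys_zhom[OF q(3)] Y by simp
  have "\<exists>t. t \<in> polys Y \<and> t \<noteq> 0 \<and> q1 dvd t * (s * w1 $ i - \<beta> * \<nu> $ i)" if "i < 3" for i
    using divides_up_to_polys[OF Y(1) q(1,2) hz q(4) eq[OF that]] by metis
  then obtain t where t: "\<And>i. i < 3 \<Longrightarrow> t i \<in> polys Y \<and> t i \<noteq> 0 \<and> q1 dvd t i * (s * w1 $ i - \<beta> * \<nu> $ i)"
    by metis
  define T where "T = t 0 * t 1 * t 2"
  have T: "T \<in> polys Y" "T \<noteq> 0" using t[of 0] t[of 1] t[of 2] by (auto simp: T_def intro!: polys_mult)
  have "\<forall>i<3. q1 dvd T * (s * w1 $ i - \<beta> * \<nu> $ i)"
  proof (intro allI impI)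
    fix i :: nat assume i: "i < 3"
    have "t i dvd T" using i unfolding T_def numeral_3_eq_3 less_Suc_eq numeral_2_eq_2 by auto
    then show "q1 dvd T * (s * w1 $ i - \<beta> * \<nu> $ i)" using t[OF i] by (meson dvd_trans mult_dvd_mono dvd_refl)
  qed
  then have "\<forall>i<3. \<exists>x. T * (s * w1 $ i - \<beta> * \<nu> $ i) = q1 * x" by (auto simp: dvd_def)
  then obtain x where x: "\<And>i. i < 3 \<Longrightarrow> T * (s * w1 $ i - \<beta> * \<nu> $ i) = q1 * x i" by metis
  \<comment> \<open>The corrected syzygy \<open>u\<close> is divisible by \<open>q1\<close>. As
    \<open>phi\<close> kills \<nu>, the quotient \<open>w'\<close> is mapped to
    \<open>T * s * a\<close>.\<close>
  define w' where "w' = vec 3 x"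
  define u where "u = T \<cdot>\<^sub>v (s \<cdot>\<^sub>v w1 + (- \<beta>) \<cdot>\<^sub>v \<nu>)"
  have u: "u \<in> syzygies f" unfolding u_def using w nu by (intro syz_smult syz_add)
  have uw: "u = q1 \<cdot>\<^sub>v w'" unfolding u_def w'_def
    using x syz_dim[OF w(1)] syz_dim[OF nu(1)] by (intro eq_vecI) auto
  have "q1 * (f $ 0 * w' $ 0 + f $ 1 * w' $ 1 + f $ 2 * w' $ 2) = 0"
    using u unfolding uw syz_iff by (simp add: w'_def algebra_simps)
  then have w': "w' \<in> syzygies f" using q(2) by (simp add: syz_iff w'_def)
  have "phi \<nu> = 0" using phi_kernel[OF nu(1)] by (metis one_smult_vec)
  then have "phi u = T * (s * (q1 * a))"
    unfolding u_def using w nu by (simp add: phi_smult phi_add syz_add syz_smult)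
  moreover have "phi u = q1 * phi w'" unfolding uw using phi_smult[OF w'] .
  ultimately have "q1 * phi w' = q1 * (T * s * a)" by (simp add: mult_ac)
  then have "phi w' = T * s * a" using q(2) by simp
  then have "T * s * a \<in> bideal" unfolding bideal_def using w' by (metis image_eqI)
  then show thesis using that[of "T * s"] T s polys_mult by auto
qed

section \<open>Height, unmixedness and uniqueness of the image\<close>

lemma three_outside:
  assumes "card Y + 3 \<le> CARD('n)"
  obtains z1 z2 z3 :: 'n where "z1 \<notin> Y" "z2 \<notin> Y" "z3 \<notin> Y" "z1 \<noteq> z2" "z1 \<noteq> z3" "z2 \<noteq> z3"
proof -
  have "3 \<le> card (- Y)" using assms by (simp add: Compl_eq_Diff_UNIV card_Diff_subset)
  then obtain Z where "Z \<subseteq> - Y" "card Z = 3" by (meson obtain_subset_with_card_n)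
  then show thesis using that unfolding card_3_iff by auto
qed

lemma associated_prime_height:
  assumes "associated_prime bideal P" shows "prime_height P = 2"
proof -
  obtain a where P: "prime_ideal P" "P = {r. r * a \<in> bideal}"
    using assms by (auto simp: associated_prime_def)
  have "bideal \<subseteq> P"
  proof
    fix x assume "x \<in> bideal"
    then have "a * x \<in> bideal" using is_ideal_bideal by (simp add: is_ideal_iff)
    then show "x \<in> P" using P(2) by (simp add: mult.commute)
  qed
  then have ge: "2 \<le> prime_height P" using prime_height_ge_2 primitive_mono[OF primitive_bideal] P(1) by blast
  have "is_ideal P" "1 \<notin> P" using P(1) one_notin_prime_ideal by (auto simp: prime_ideal_def)
  then obtain Y where Y: "P \<inter> polys Y \<subseteq> {0}"
    "\<And>z. z \<notin> Y \<Longrightarrow> \<exists>q\<in>P. q \<in> polys (insert z Y) \<and> q \<noteq> 0 \<and> 0 < zdeg z q"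
    using maximal_independent_variables by blast
  have "\<not> card Y + 3 \<le> CARD('n)"
  proof
    assume "card Y + 3 \<le> CARD('n)"
    then obtain z1 z2 z3 :: 'n where z: "z1 \<notin> Y" "z2 \<notin> Y" "z3 \<notin> Y" "z1 \<noteq> z2" "z1 \<noteq> z3" "z2 \<noteq> z3"
      using three_outside by blast
    obtain q1 where q1: "q1 \<in> P" "q1 \<in> polys (insert z1 Y)" "q1 \<noteq> 0" using Y(2) z by blast
    obtain q2 where q2: "q2 \<in> P" "q2 \<in> polys (insert z2 Y)" "q2 \<noteq> 0" using Y(2) z by blast
    obtain q3 where q3: "q3 \<in> P" "q3 \<in> polys (insert z3 Y)" "q3 \<noteq> 0" using Y(2) z by blast
    obtain s where "s \<in> polys Y" "s \<noteq> 0" "s * a \<in> bideal"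
      using bideal_torsion[OF z q1(2,3) q2(2,3) q3(2,3), of a] q1(1) q2(1) q3(1) P(2) by blast
    then show False using Y(1) P(2) by blast
  qed
  then have "prime_height P \<le> enat 2" using prime_height_le_if_polys[OF Y(1), of 2] by simp
  then show ?thesis using ge by (simp add: numeral_eq_enat)
qed

text \<open>\<open>bideal_torsion\<close> with \<open>a = 1\<close> leaves at most two variables
  outside \<open>Y\<close>. To bound the height, a prime ideal above \<open>bideal\<close> is chosen
  that still contains no nonzero polynomial in \<open>Y\<close>.\<close>

lemma height_bideal:
  assumes "1 \<notin> bideal" shows "height bideal = 2"
proof -
  obtain Y where Y: "bideal \<inter> polys Y \<subseteq> {0}"
    "\<And>z. z \<notin> Y \<Longrightarrow> \<exists>q\<in>bideal. q \<in> polys (insert z Y) \<and> q \<noteq> 0 \<and> 0 < zdeg z q"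
    using maximal_independent_variables[OF is_ideal_bideal assms] by blast
  have c: "\<not> card Y + 3 \<le> CARD('n)"
  proof
    assume "card Y + 3 \<le> CARD('n)"
    then obtain z1 z2 z3 :: 'n where z: "z1 \<notin> Y" "z2 \<notin> Y" "z3 \<notin> Y" "z1 \<noteq> z2" "z1 \<noteq> z3" "z2 \<noteq> z3"
      using three_outside by blast
    obtain q1 where q1: "q1 \<in> bideal" "q1 \<in> polys (insert z1 Y)" "q1 \<noteq> 0" using Y(2) z by blast
    obtain q2 where q2: "q2 \<in> bideal" "q2 \<in> polys (insert z2 Y)" "q2 \<noteq> 0" using Y(2) z by blast
    obtain q3 where q3: "q3 \<in> bideal" "q3 \<in> polys (insert z3 Y)" "q3 \<noteq> 0" using Y(2) z by blast
    obtain s where "s \<in> polys Y" "s \<noteq> 0" "s * 1 \<in> bideal"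
      using bideal_torsion[OF z q1(2,3) q2(2,3) q3(2,3), of 1] q1(1) q2(1) q3(1) by auto
    then show False using Y(1) by auto
  qed
  obtain P where P: "prime_ideal P" "bideal \<subseteq> P" "P \<inter> (polys Y - {0}) = {}"
  proof (rule prime_ideal_avoiding[OF is_ideal_bideal, of "polys Y - {0}"])
    show "bideal \<inter> (polys Y - {0}) = {}" using Y(1) by blast
  qed (auto intro: polys_mult)
  have "P \<inter> polys Y \<subseteq> {0}" using P(3) by blast
  then have "prime_height P \<le> enat 2" using prime_height_le_if_polys[of P Y 2] c by simp
  then have "height bideal \<le> 2" using height_le[OF P(1,2)] by (simp add: numeral_eq_enat)
  then show ?thesis using height_ge_2[OF primitive_bideal] by simp
qed

lemma unmixed_bideal: "1 \<notin> bideal \<Longrightarrow> unmixed bideal"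
  unfolding unmixed_def using associated_prime_height height_bideal by simp

text \<open>The map \<open>phi\<close> shifts degrees by \<open>e - d\<close>, so a preimage of 1
  could be replaced by its part of degree \<open>d - e\<close>.\<close>

lemma one_notin_bideal:
  assumes "\<And>w. w \<in> syzygies f \<Longrightarrow> vec_form (d - e) w \<Longrightarrow> w = 0\<^sub>v 3"
  shows "1 \<notin> bideal"
proof
  assume "1 \<in> bideal"
  then obtain w where w: "w \<in> syzygies f" "1 = phi w" by (auto simp: bideal_def)
  have "vcomp (d - e) w = 0\<^sub>v 3" using assms vcomp_syz[OF w(1)] vec_form_vcomp by blast
  then have "phi (0\<^sub>v 3) = hcomp 0 1" using phi_vcomp[OF w(1), of "d - e"] w(2) by simp
  moreover have "phi (0\<^sub>v 3) = 0" by (rule phi_eqI) (simp add: is_phi_def)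
  moreover have "hcomp 0 (1 :: ('n, 'k) mpoly) = 1" using hcomp_form[of 0 "1 :: ('n, 'k) mpoly" 0] by (simp add: form_def)
  ultimately show False by simp
qed

text \<open>Maps on the syzygies with the same kernel are proportional. As neither image has a
  common factor, numerator and denominator of the ratio divide each other, so the ratio is a
  unit.\<close>

lemma quot_iso_unique:
  assumes iso: "quot_iso_ideal (syzygies f) \<nu> I" and h: "height I = 2"
  shows "I = bideal"
proof -
  from iso obtain \<psi> s where raw:
    "(\<forall>v\<in>syzygies f. \<forall>w\<in>syzygies f. \<psi> (v + w) = \<psi> v + \<psi> w) \<and>
     (\<forall>r. \<forall>v\<in>syzygies f. \<psi> (r \<cdot>\<^sub>v v) = r * \<psi> v) \<and>
     (\<forall>d. \<forall>v\<in>syzygies f. vec_form d v \<longrightarrow> form (d + s) (\<psi> v)) \<and>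
     {v \<in> syzygies f. \<psi> v = 0} = {r \<cdot>\<^sub>v \<nu> | r. True} \<and> \<psi> ` syzygies f = I"
    unfolding quot_iso_ideal_def by (elim exE)
  then have \<psi>: "\<And>v w. v \<in> syzygies f \<Longrightarrow> w \<in> syzygies f \<Longrightarrow> \<psi> (v + w) = \<psi> v + \<psi> w"
    "\<And>r v. v \<in> syzygies f \<Longrightarrow> \<psi> (r \<cdot>\<^sub>v v) = r * \<psi> v"
    "{v \<in> syzygies f. \<psi> v = 0} = {r \<cdot>\<^sub>v \<nu> | r. True}" "\<psi> ` syzygies f = I"
    by blast+
  have ratio: "phi v * \<psi> w = \<psi> v * phi w" if "v \<in> syzygies f" "w \<in> syzygies f" for v w
  proof -
    \<comment> \<open>\<open>phi\<close> sends this combination to 0, so it is a multiple of \<nu>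
      and lies in the kernel of \<psi> too.\<close>
    define u where "u = phi v \<cdot>\<^sub>v w + (- phi w) \<cdot>\<^sub>v v"
    have u: "u \<in> syzygies f" unfolding u_def using that by (intro syz_add syz_smult)
    have "phi u = 0" unfolding u_def using that by (simp add: phi_add phi_smult syz_smult mult.commute)
    then have "\<psi> u = 0" using phi_kernel[OF u] \<psi>(3) u by blast
    then show ?thesis unfolding u_def using that by (simp add: \<psi>(1,2) syz_smult mult.commute)
  qed
  have Iprim: "primitive I" using primitive_if_height_2[OF h] .
  obtain p0 :: "('n, 'k) mpoly" where "irreducible p0" using irreducible_exists by blast
  then obtain v where v: "v \<in> syzygies f" "\<not> p0 dvd phi v"
    using primitive_bideal unfolding primitive_def bideal_def by blast
  then have pv: "phi v \<noteq> 0" by auto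
  have "\<psi> v \<noteq> 0"
  proof
    assume "\<psi> v = 0"
    then have "v \<in> {r \<cdot>\<^sub>v \<nu> | r. True}" using \<psi>(3) v(1) by blast
    then show False using phi_kernel[OF v(1)] pv by blast
  qed
  have "phi v dvd \<psi> v"
    by (rule primitive_dvd[OF primitive_bideal pv]) (use ratio[OF v(1)] in \<open>auto simp: bideal_def intro: dvdI[OF sym]\<close>)
  moreover have "\<psi> v dvd phi v"
    by (rule primitive_dvd[OF Iprim \<open>\<psi> v \<noteq> 0\<close>]) (use ratio[OF v(1)] in \<open>auto simp flip: \<psi>(4)\<close>)
  ultimately obtain a b where ab: "\<psi> v = phi v * a" "phi v = \<psi> v * b" by blast
  then have "phi v * 1 = phi v * (a * b)" by Groebner_Basis.algebra
  then have ab1: "a * b = 1" using mult_left_cancel[OF pv] by metis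
  have eq: "\<psi> w = a * phi w" if "w \<in> syzygies f" for w
  proof -
    have "phi v * \<psi> w = phi v * (a * phi w)" using ratio[OF v(1) that] ab(1) by (simp add: mult_ac)
    then show ?thesis using pv by simp
  qed
  show ?thesis
  proof
    show "I \<subseteq> bideal" using is_ideal_bideal eq unfolding is_ideal_iff \<psi>(4)[symmetric] by (auto simp: bideal_def)
    show "bideal \<subseteq> I"
    proof
      fix x assume "x \<in> bideal"
      then obtain w where w: "w \<in> syzygies f" "x = phi w" by (auto simp: bideal_def)
      have "\<psi> (b \<cdot>\<^sub>v w) = (a * b) * phi w" using eq w by (simp add: \<psi>(2) mult_ac)
      then have "x = \<psi> (b \<cdot>\<^sub>v w)" using w ab1 by simp
      then show "x \<in> I" using \<psi>(4) syz_smult[OF w(1)] by blast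
    qed
  qed
qed

end

section \<open>Dimensions of graded pieces\<close>

text \<open>Linearity is required on \<open>V\<close> only, because the canonical map
  \<open>phi\<close> is meaningful only on syzygies. The finite spanning sets are explicit since the
  ambient spaces are infinite-dimensional.\<close>

lemma (in vector_space_pair) rank_nullity_on:
  assumes V: "vs1.subspace V"
    and add: "\<And>x y. x \<in> V \<Longrightarrow> y \<in> V \<Longrightarrow> T (x + y) = T x + T y"
    and scale: "\<And>c x. x \<in> V \<Longrightarrow> T (s1 c x) = s2 c (T x)"
    and K: "finite K" "{x \<in> V. T x = 0} \<subseteq> vs1.span K"
    and D: "finite D" "T ` V \<subseteq> vs2.span D"
  shows "\<exists>B. finite B \<and> V \<subseteq> vs1.span B" "vs1.dim V = vs1.dim {x \<in> V. T x = 0} + vs2.dim (T ` V)"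
proof -
  have T0: "T 0 = 0" using scale[of 0 0] vs1.subspace_0[OF V] by simp
  have Tsum: "(\<Sum>x\<in>S. s1 (u x) x) \<in> V \<and> T (\<Sum>x\<in>S. s1 (u x) x) = (\<Sum>x\<in>S. s2 (u x) (T x))"
    if "finite S" "S \<subseteq> V" for S u
    using that
  proof (induction S)
    case (insert x S)
    then have "s1 (u x) x \<in> V" using vs1.subspace_scale[OF V] by auto
    then show ?case using insert add scale vs1.subspace_add[OF V] by auto
  qed (use T0 vs1.subspace_0[OF V] in auto)
  obtain B0 where B0: "B0 \<subseteq> {x \<in> V. T x = 0}" "vs1.independent B0" "{x \<in> V. T x = 0} \<subseteq> vs1.span B0"
    using vs1.maximal_independent_subset by blast
  have fB0: "finite B0" using vs1.independent_span_bound[OF K(1) B0(2)] B0(1) K(2) by blast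
  obtain C0 where C0: "C0 \<subseteq> T ` V" "vs2.independent C0" "T ` V \<subseteq> vs2.span C0"
    using vs2.maximal_independent_subset by blast
  have fC0: "finite C0" using vs2.independent_span_bound[OF D(1) C0(2)] C0(1) D(2) by blast
  obtain g where g: "\<And>c. c \<in> C0 \<Longrightarrow> g c \<in> V \<and> T (g c) = c"
    using C0(1) by (metis (no_types, lifting) image_iff subsetD)
  define C where "C = g ` C0"
  have gi: "inj_on g C0" by (metis g inj_onI)
  have C: "finite C" "C \<subseteq> V" "card C = card C0" using fC0 g gi by (auto simp: C_def card_image)
  have "0 \<notin> C0" using C0(2) vs2.dependent_zero by blast
  then have disj: "B0 \<inter> C = {}" using B0(1) g by (fastforce simp: C_def)
  have BV: "B0 \<union> C \<subseteq> V" using B0(1) C by blast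
  have TC: "(\<Sum>x\<in>C. s2 (u x) (T x)) = (\<Sum>c\<in>C0. s2 (u (g c)) c)" for u
    unfolding C_def sum.reindex[OF gi] using g by (auto intro!: sum.cong)
  have ind: "vs1.independent (B0 \<union> C)"
  proof (rule vs1.independent_if_scalars_zero)
    fix u x assume u: "(\<Sum>x\<in>B0 \<union> C. s1 (u x) x) = 0" and x: "x \<in> B0 \<union> C"
    have "(\<Sum>x\<in>B0 \<union> C. s2 (u x) (T x)) = 0"
      using Tsum[of "B0 \<union> C" u] BV fB0 C(1) u T0 by simp
    moreover have "(\<Sum>x\<in>B0. s2 (u x) (T x)) = 0" using B0(1) by (intro sum.neutral) auto
    ultimately have "(\<Sum>c\<in>C0. s2 (u (g c)) c) = 0"
      using sum.union_disjoint[OF fB0 C(1) disj, of "\<lambda>x. s2 (u x) (T x)"] TC[of u] by simp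
    then have uC: "u c = 0" if "c \<in> C" for c
      using vs2.independentD[OF C0(2) fC0 order_refl, of "\<lambda>c. u (g c)"] that by (auto simp: C_def)
    then have "(\<Sum>x\<in>B0. s1 (u x) x) = 0"
      using sum.union_disjoint[OF fB0 C(1) disj, of "\<lambda>x. s1 (u x) x"] u by simp
    then have "u b = 0" if "b \<in> B0" for b
      using vs1.independentD[OF B0(2) fB0 order_refl, of u] that by blast
    then show "u x = 0" using uC x by blast
  qed (use fB0 C in simp)
  have span: "V \<subseteq> vs1.span (B0 \<union> C)"
  proof
    fix v assume v: "v \<in> V"
    then have "T v \<in> vs2.span C0" using C0(3) by blast
    then obtain u where u: "T v = (\<Sum>c\<in>C0. s2 (u c) c)" unfolding vs2.span_finite[OF fC0] by blast
    define y where "y = (\<Sum>x\<in>C. s1 (u (T x)) x)"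
    have y: "y \<in> V" "T y = (\<Sum>x\<in>C. s2 (u (T x)) (T x))"
      using Tsum[OF C(1,2), of "\<lambda>x. u (T x)"] by (auto simp: y_def)
    have "T y = T v" unfolding y(2) TC u using g by (auto intro!: sum.cong)
    moreover have "T (v - y) + T y = T v" using add[OF vs1.subspace_diff[OF V v y(1)] y(1)] by simp
    ultimately have "v - y \<in> {x \<in> V. T x = 0}" using vs1.subspace_diff[OF V v y(1)] by simp
    then have "v - y \<in> vs1.span (B0 \<union> C)" using B0(3) vs1.span_mono[of B0 "B0 \<union> C"] by blast
    moreover have "y \<in> vs1.span (B0 \<union> C)"
      unfolding y_def by (intro vs1.span_sum vs1.span_scale vs1.span_base) auto
    ultimately have "v - y + y \<in> vs1.span (B0 \<union> C)" by (rule vs1.span_add)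
    then show "v \<in> vs1.span (B0 \<union> C)" by simp
  qed
  show "\<exists>B. finite B \<and> V \<subseteq> vs1.span B" using span fB0 C(1) by blast
  have "vs1.dim V = card (B0 \<union> C)" using vs1.basis_card_eq_dim[OF BV span ind] by simp
  also have "\<dots> = card B0 + card C0" using card_Un_disjoint[OF fB0 C(1) disj] C(3) by simp
  also have "card B0 = vs1.dim {x \<in> V. T x = 0}" using vs1.basis_card_eq_dim[OF B0(1,3,2)] .
  also have "card C0 = vs2.dim (T ` V)" using vs2.basis_card_eq_dim[OF C0(1,3,2)] .
  finally show "vs1.dim V = vs1.dim {x \<in> V. T x = 0} + vs2.dim (T ` V)" .
qed

lemma (in vector_space) dim_subset_finite:
  assumes "U \<subseteq> V" "finite B" "V \<subseteq> span B" shows "dim U \<le> dim V"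
proof -
  obtain C where C: "C \<subseteq> U" "independent C" "U \<subseteq> span C" "card C = dim U" using basis_exists by blast
  obtain E where E: "E \<subseteq> V" "independent E" "V \<subseteq> span E" "card E = dim V" using basis_exists by blast
  have "finite E" using independent_span_bound[OF assms(2) E(2)] E(1) assms(3) by blast
  then have "card C \<le> card E" using independent_span_bound[OF _ C(2), of E] C(1) E(3) assms(1) by blast
  then show ?thesis using C E by simp
qed

text \<open>Tuples of polynomials are functions on \<open>nat\<close> padded by zeros: these form a
  vector space as a whole type, whereas addition on \<open>vec\<close> makes sense only for equal
  dimensions.\<close>

interpretation fv: vector_space "\<lambda>(c::'k::field) (v::nat \<Rightarrow> ('n, 'k) mpoly) i. Const c * v i"
  by standard (simp_all only: fun_eq_iff plus_fun_apply distrib_left distrib_right single_add mult.assoc[symmetric] mult_single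
      add_0_left single_one mult_1_left simp_thms)

declare fv.scale_scale [simp del]

interpretation fm: vector_space_pair "\<lambda>(c::'k::field) (v::nat \<Rightarrow> ('n, 'k) mpoly) i. Const c * v i"
  "\<lambda>(c::'k::field) (p::('n, 'k) mpoly). Const c * p" ..

interpretation mf: vector_space_pair "\<lambda>(c::'k::field) (p::('n, 'k) mpoly). Const c * p"
  "\<lambda>(c::'k::field) (v::nat \<Rightarrow> ('n, 'k) mpoly) i. Const c * v i" ..

interpretation ff: vector_space_pair "\<lambda>(c::'k::field) (v::nat \<Rightarrow> ('n, 'k) mpoly) i. Const c * v i"
  "\<lambda>(c::'k::field) (v::nat \<Rightarrow> ('n, 'k) mpoly) i. Const c * v i" ..

section \<open>Graded pieces of the ring and of free modules\<close>

definition forms :: "int \<Rightarrow> ('n, 'k::zero) mpoly set" where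
  "forms d = {p. form d p}"

definition rdim :: "('n, 'k::field) mpoly itself \<Rightarrow> int \<Rightarrow> nat" where
  "rdim _ d = kv.dim (forms d :: ('n, 'k) mpoly set)"

lemma form_Const_mult: "form d p \<Longrightarrow> form d (Const c * p)" for p :: "('n::finite, 'k::comm_ring_1) mpoly"
  using form_mult[OF form_Const[of c], of d p] by simp

lemma subspace_forms: "kv.subspace (forms d :: ('n::finite, 'k::field) mpoly set)"
  unfolding kv.subspace_def by (auto simp: forms_def form_add form_Const_mult)

definition monomials_of_degree :: "int \<Rightarrow> ('n \<Rightarrow>\<^sub>0 nat) set" where
  "monomials_of_degree d = {m. int (mdeg m) = d}"

lemma finite_monomials_of_degree: "finite (monomials_of_degree d :: ('n::finite \<Rightarrow>\<^sub>0 nat) set)"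
proof (rule finite_subset[OF _ card_monoms(1)])
  have "lookup m x \<le> mdeg m" for m :: "'n \<Rightarrow>\<^sub>0 nat" and x
    unfolding mdeg_eq by (rule member_le_sum) auto
  then show "monomials_of_degree d \<subseteq> monoms (UNIV :: 'n set) (nat d)"
    by (auto simp: monomials_of_degree_def monoms_def)
qed

lemma forms_span: "forms d \<subseteq> kv.span ((\<lambda>m. Poly_Mapping.single m 1) ` monomials_of_degree d :: ('n::finite, 'k::field) mpoly set)"
proof
  fix p :: "('n, 'k) mpoly" assume p: "p \<in> forms d"
  have "p = (\<Sum>m\<in>keys p. Const (lookup p m) * Poly_Mapping.single m 1)"
    using poly_mapping_sum_single[of p] by (simp add: mult_single)
  also have "\<dots> \<in> kv.span ((\<lambda>m. Poly_Mapping.single m 1) ` monomials_of_degree d)"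
    using p by (intro kv.span_sum kv.span_scale kv.span_base) (auto simp: forms_def form_def monomials_of_degree_def)
  finally show "p \<in> kv.span ((\<lambda>m. Poly_Mapping.single m 1) ` monomials_of_degree d)" .
qed

lemma forms_finite_span: "\<exists>B. finite B \<and> (forms d :: ('n::finite, 'k::field) mpoly set) \<subseteq> kv.span B"
  using forms_span finite_monomials_of_degree by blast

lemma rdim_card: "rdim TYPE(('n::finite, 'k::field) mpoly) d = card (monomials_of_degree d :: ('n \<Rightarrow>\<^sub>0 nat) set)"
proof -
  let ?M = "monomials_of_degree d :: ('n \<Rightarrow>\<^sub>0 nat) set"
  let ?s = "\<lambda>m. Poly_Mapping.single m (1::'k)"
  have fin: "finite ?M" by (rule finite_monomials_of_degree)
  have inj: "inj_on ?s ?M" by (auto simp: inj_on_def dest!: arg_cong[of _ _ keys])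
  have "kv.independent (?s ` ?M)"
  proof (rule kv.independent_if_scalars_zero)
    fix u x assume u: "(\<Sum>x\<in>?s ` ?M. Const (u x) * x) = 0" and x: "x \<in> ?s ` ?M"
    obtain m where m: "m \<in> ?M" "x = ?s m" using x by blast
    have "(\<Sum>m\<in>?M. Poly_Mapping.single m (u (?s m))) = 0"
      using u unfolding sum.reindex[OF inj] o_def by (simp add: mult_single)
    then have "0 = lookup (\<Sum>m\<in>?M. Poly_Mapping.single m (u (?s m))) m" by simp
    also have "\<dots> = u x" using m fin
      by (simp add: lookup_sum lookup_single when_def)
    finally show "u x = 0" by simp
  qed (simp add: finite_monomials_of_degree)
  moreover have "?s ` ?M \<subseteq> forms d" by (auto simp: forms_def form_def monomials_of_degree_def)
  ultimately have "card (?s ` ?M) = kv.dim (forms d :: ('n, 'k) mpoly set)"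
    using kv.basis_card_eq_dim forms_span by blast
  then show ?thesis using inj by (simp add: rdim_def card_image)
qed

lemma rdim_neg: "d < 0 \<Longrightarrow> rdim TYPE(('n::finite, 'k::field) mpoly) d = 0"
proof -
  assume "d < 0"
  then have "(monomials_of_degree d :: ('n \<Rightarrow>\<^sub>0 nat) set) = {}" by (auto simp: monomials_of_degree_def)
  then show ?thesis unfolding rdim_card by simp
qed

text \<open>Listed along an enumeration of the variables, the exponents of a monomial of degree
  \<open>i\<close> form a list of length \<open>CARD('n)\<close> with sum \<open>i\<close>.\<close>

lemma rdim_binomial:
  "rdim TYPE(('n::{finite,linorder}, 'k::field) mpoly) (int i) = (i + (CARD('n) - 1)) choose (CARD('n) - 1)"
proof -
  define xs where "xs = sorted_list_of_set (UNIV :: 'n set)"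
  have xs: "set xs = UNIV" "distinct xs" "length xs = CARD('n)" by (auto simp: xs_def)
  have bij: "bij_betw (\<lambda>m. map (lookup m) xs) (monomials_of_degree (int i)) {l. length l = CARD('n) \<and> sum_list l = i}"
    unfolding bij_betw_def
  proof
    show "inj_on (\<lambda>m. map (lookup m) xs) (monomials_of_degree (int i))"
      using xs(1) by (auto simp: inj_on_def intro: poly_mapping_eqI)
    show "(\<lambda>m. map (lookup m) xs) ` monomials_of_degree (int i) = {l. length l = CARD('n) \<and> sum_list l = i}"
    proof safe
      fix m :: "'n \<Rightarrow>\<^sub>0 nat" assume "m \<in> monomials_of_degree (int i)"
      then have "mdeg m = i" by (simp add: monomials_of_degree_def)
      then show "sum_list (map (lookup m) xs) = i"
        using xs by (simp add: mdeg_eq sum_list_distinct_conv_sum_set)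
    next
      fix l :: "nat list" assume l: "length l = CARD('n)" "i = sum_list l"
      define m where "m = Abs_poly_mapping (\<lambda>x. the (map_of (zip xs l) x))"
      have "map (lookup m) xs = l"
        using xs l(1) by (intro nth_equalityI) (auto simp: m_def map_of_zip_nth)
      moreover have "mdeg m = sum_list (map (lookup m) xs)"
        using xs by (simp add: mdeg_eq sum_list_distinct_conv_sum_set)
      ultimately show "l \<in> (\<lambda>m. map (lookup m) xs) ` monomials_of_degree (int (sum_list l))"
        by (intro image_eqI[of _ _ m]) (simp_all add: monomials_of_degree_def)
    qed (simp add: xs)
  qed
  have "card (monomials_of_degree (int i) :: ('n \<Rightarrow>\<^sub>0 nat) set) = (i + CARD('n) - 1) choose i"
    unfolding bij_betw_same_card[OF bij] card_length_sum_list ..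
  also have "\<dots> = (i + (CARD('n) - 1)) choose (CARD('n) - 1)"
  proof -
    obtain N where "CARD('n) = Suc N" using gr0_implies_Suc[OF zero_less_card_finite] by blast
    then show ?thesis using binomial_symmetric[of i "i + N"] by simp
  qed
  finally show ?thesis unfolding rdim_card .
qed

text \<open>The part of degree \<open>d\<close> of the graded free module whose twists are given by
  \<open>a\<close>.\<close>

definition tuples :: "int list \<Rightarrow> int \<Rightarrow> (nat \<Rightarrow> ('n, 'k::zero) mpoly) set" where
  "tuples a d = {v. (\<forall>j<length a. form (d - a ! j) (v j)) \<and> (\<forall>j\<ge>length a. v j = 0)}"

lemma subspace_tuples: "fv.subspace (tuples a d :: (nat \<Rightarrow> ('n::finite, 'k::field) mpoly) set)"
  unfolding fv.subspace_def by (auto simp: tuples_def form_add form_Const_mult)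

lemma dim_tuples:
  "(\<exists>B. finite B \<and> (tuples a d :: (nat \<Rightarrow> ('n::finite, 'k::field) mpoly) set) \<subseteq> fv.span B) \<and>
   fv.dim (tuples a d :: (nat \<Rightarrow> ('n, 'k) mpoly) set) = (\<Sum>x\<leftarrow>a. rdim TYPE(('n, 'k) mpoly) (d - x))"
proof (induction a rule: rev_induct)
  case Nil
  have "(tuples [] d :: (nat \<Rightarrow> ('n, 'k) mpoly) set) = {0}"
    by (auto simp: tuples_def fun_eq_iff)
  moreover have "fv.dim ({0} :: (nat \<Rightarrow> ('n, 'k) mpoly) set) = 0"
    using fv.dim_le_card[of "{0}" "{}"] by simp
  ultimately show ?case by (auto intro!: exI[of _ "{}"])
next
  case (snoc x a)
  let ?V = "tuples (a @ [x]) d :: (nat \<Rightarrow> ('n, 'k) mpoly) set"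
  let ?T = "\<lambda>v :: nat \<Rightarrow> ('n, 'k) mpoly. v (length a)"
  have ker: "{v \<in> ?V. ?T v = 0} = tuples a d"
  proof safe
    fix v :: "nat \<Rightarrow> ('n, 'k) mpoly" assume v: "v \<in> ?V" "v (length a) = 0"
    have "v j = 0" if "length a \<le> j" for j
      using v that by (cases "j = length a") (auto simp: tuples_def)
    moreover have "form (d - a ! j) (v j)" if "j < length a" for j
    proof -
      have "form (d - (a @ [x]) ! j) (v j)" using v(1) that by (simp add: tuples_def)
      then show ?thesis using that by (simp add: nth_append)
    qed
    ultimately show "v \<in> tuples a d" by (simp add: tuples_def)
  qed (auto simp: tuples_def nth_append less_Suc_eq)
  have im: "?T ` ?V = forms (d - x)"
  proof safe
    fix v :: "nat \<Rightarrow> ('n, 'k) mpoly" assume "v \<in> ?V"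
    then have "\<forall>j<length (a @ [x]). form (d - (a @ [x]) ! j) (v j)" unfolding tuples_def by blast
    from this[rule_format, of "length a"] show "?T v \<in> forms (d - x)" by (simp add: forms_def)
  next
    fix p :: "('n, 'k) mpoly" assume "p \<in> forms (d - x)"
    then have "(\<lambda>j. if j = length a then p else 0) \<in> ?V" by (auto simp: tuples_def forms_def nth_append)
    then have "?T (\<lambda>j. if j = length a then p else 0) \<in> ?T ` ?V" by (rule imageI)
    then show "p \<in> ?T ` ?V" by simp
  qed
  obtain K where K: "finite K" "{v \<in> ?V. ?T v = 0} \<subseteq> fv.span K" using snoc ker by auto
  obtain D where D: "finite D" "?T ` ?V \<subseteq> kv.span D" using forms_finite_span im by metis
  show ?case
    using fm.rank_nullity_on[OF subspace_tuples _ _ K D] ker im snoc by (simp add: rdim_def)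
qed

lemmas tuples_finite_span = dim_tuples[THEN conjunct1]

definition act :: "'a::comm_ring_1 mat \<Rightarrow> (nat \<Rightarrow> 'a) \<Rightarrow> nat \<Rightarrow> 'a" where
  "act M v i = (if i < dim_row M then (\<Sum>j<dim_col M. M $$ (i, j) * v j) else 0)"

lemma mult_vec_act: "M *\<^sub>v vec (dim_col M) v = vec (dim_row M) (act M v)"
  by (rule eq_vecI) (auto simp: act_def scalar_prod_def lessThan_atLeast0 intro!: sum.cong)

lemma act_tuples:
  fixes M :: "('n::finite, 'k::comm_ring_1) mpoly mat"
  assumes "graded_map b a M" "v \<in> tuples a d" shows "act M v \<in> tuples b d"
proof -
  have M: "dim_row M = length b" "dim_col M = length a" using assms(1) by (auto simp: graded_map_def)
  have "form (d - b ! i) (act M v i)" if "i < length b" for i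
  proof -
    have "form (d - b ! i) (M $$ (i, j) * v j)" if "j < length a" for j
      using form_mult[of "a ! j - b ! i" "M $$ (i, j)" "d - a ! j" "v j"] assms that \<open>i < length b\<close>
      by (auto simp: graded_map_def tuples_def)
    then show ?thesis using that M by (auto simp: act_def intro!: form_sum)
  qed
  then show ?thesis using M by (auto simp: tuples_def act_def)
qed

text \<open>Each entry of \<open>u\<close> is replaced by its part of the fitting degree; as
  \<open>M\<close> is graded and the image is already homogeneous, the image does not
  change.\<close>

lemma act_homogeneous_part:
  fixes M :: "('n::finite, 'k::comm_ring_1) mpoly mat"
  assumes "graded_map b a M" "u \<in> carrier_vec (length a)" "\<And>i. i < length b \<Longrightarrow> form (d - b ! i) ((M *\<^sub>v u) $ i)"
  shows "\<exists>v\<in>tuples a d. \<forall>i<length b. act M v i = (M *\<^sub>v u) $ i"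
proof -
  have M: "dim_row M = length b" "dim_col M = length a" using assms(1) by (auto simp: graded_map_def)
  define v where "v = (\<lambda>j. if j < length a then hcomp (d - a ! j) (u $ j) else 0)"
  have "act M v i = (M *\<^sub>v u) $ i" if i: "i < length b" for i
  proof -
    have "act M v i = (\<Sum>j<length a. hcomp (d - b ! i) (M $$ (i, j) * u $ j))"
      using assms(1) i hcomp_mult[of "a ! j - b ! i" "M $$ (i, j)" "d - b ! i" "u $ j" for j] M
      by (auto simp: act_def v_def graded_map_def intro!: sum.cong)
    also have "\<dots> = hcomp (d - b ! i) ((M *\<^sub>v u) $ i)"
      using i M assms(2) by (auto simp: scalar_prod_def lessThan_atLeast0 simp flip: wcomp_sum intro!: arg_cong[of _ _ "hcomp _"] sum.cong)
    finally show ?thesis using hcomp_form[OF assms(3)[OF i]] by simp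
  qed
  moreover have "v \<in> tuples a d" by (auto simp: tuples_def v_def)
  ultimately show ?thesis by blast
qed

lemma exact_tuples:
  fixes M M' :: "('n::finite, 'k::comm_ring_1) mpoly mat"
  assumes "graded_map b a M" "graded_map a a' M'" "mat_kernel M = mat_image M'"
  shows "{v \<in> tuples a d. act M v = 0} = act M' ` tuples a' d"
proof -
  have M: "dim_row M = length b" "dim_col M = length a" "dim_row M' = length a" "dim_col M' = length a'"
    using assms(1,2) by (auto simp: graded_map_def)
  have zero_iff: "act M v = 0 \<longleftrightarrow> vec (length a) v \<in> mat_kernel M" for v
    using mult_vec_act[of M v] M by (auto simp: mat_kernel_def act_def vec_eq_iff fun_eq_iff)
  show ?thesis
  proof safe
    fix v assume v: "v \<in> tuples a d" "act M v = 0"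
    then have "vec (length a) v \<in> mat_image M'" using zero_iff assms(3) by blast
    then obtain u where u: "u \<in> carrier_vec (length a')" "vec (length a) v = M' *\<^sub>v u"
      using M by (auto simp: mat_image_def)
    have vi: "(M' *\<^sub>v u) $ i = v i" if "i < length a" for i
      using u(2) that by (metis index_vec)
    obtain w where w: "w \<in> tuples a' d" "\<forall>i<length a. act M' w i = (M' *\<^sub>v u) $ i"
      using act_homogeneous_part[OF assms(2) u(1), of d] vi v(1) by (auto simp: tuples_def)
    have "act M' w = v"
    proof
      fix i show "act M' w i = v i"
        using w(2) vi v(1) M by (cases "i < length a") (auto simp: act_def tuples_def)
    qed
    then show "v \<in> act M' ` tuples a' d" using w(1) by blast
  next
    fix w :: "nat \<Rightarrow> ('n, 'k) mpoly" assume w: "w \<in> tuples a' d"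
    show "act M' w \<in> tuples a d" using act_tuples[OF assms(2) w] .
    have "M' *\<^sub>v vec (length a') w \<in> mat_image M'" using M by (auto simp: mat_image_def)
    then show "act M (act M' w) = 0"
      unfolding zero_iff assms(3) using mult_vec_act[of M' w] M by simp
  qed
qed

lemma act_add: "act M (v + w) = act M v + act M w"
  by (auto simp: act_def fun_eq_iff distrib_left sum.distrib)

lemma act_scale: "act M (\<lambda>i. c * v i) = (\<lambda>i. c * act M v i)"
  by (auto simp: act_def fun_eq_iff sum_distrib_left mult.left_commute)

lemma dim_act_tuples:
  fixes M :: "('n::finite, 'k::field) mpoly mat"
  assumes "graded_map b a M"
  shows "fv.dim {v \<in> tuples a d. act M v = 0} + fv.dim (act M ` tuples a d) =
    (\<Sum>x\<leftarrow>a. rdim TYPE(('n, 'k) mpoly) (d - x))"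
proof -
  obtain K where K: "finite K" "{v \<in> tuples a d. act M v = 0} \<subseteq> fv.span K"
    using tuples_finite_span[of a d] by blast
  obtain D where D: "finite D" "act M ` tuples a d \<subseteq> fv.span D"
    using tuples_finite_span[of b d] act_tuples[OF assms, of _ d] by blast
  show ?thesis
    using ff.rank_nullity_on(2)[OF subspace_tuples[of a d], of "act M", OF act_add _ K D] dim_tuples[of a d, where 'n='n and 'k='k]
    by (simp add: act_scale)
qed

section \<open>Dimension counts along a resolution\<close>

definition row_ideal :: "'a::comm_ring_1 mat \<Rightarrow> 'a set" where
  "row_ideal M = (\<lambda>v. v $ 0) ` mat_image M"

lemma dim_row_ideal:
  fixes M :: "('n::finite, 'k::field) mpoly mat"
  assumes "graded_map [0] a M"
  shows "fv.dim {v \<in> tuples a d. act M v = 0} + kv.dim {p \<in> row_ideal M. form d p} =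
    (\<Sum>x\<leftarrow>a. rdim TYPE(('n, 'k) mpoly) (d - x))"
proof -
  have M: "dim_row M = 1" "dim_col M = length a" using assms(1) by (auto simp: graded_map_def)
  have z: "act M v 0 = 0 \<longleftrightarrow> act M v = 0" for v
    using M by (auto simp: act_def fun_eq_iff)
  have im: "(\<lambda>v. act M v 0) ` tuples a d = {p \<in> row_ideal M. form d p}"
  proof safe
    fix v :: "nat \<Rightarrow> ('n, 'k) mpoly" assume v: "v \<in> tuples a d"
    have "(M *\<^sub>v vec (dim_col M) v) $ 0 = act M v 0" unfolding mult_vec_act using M by simp
    then show "act M v 0 \<in> row_ideal M" unfolding row_ideal_def mat_image_def by (metis (mono_tags, lifting) imageI mem_Collect_eq vec_carrier)
    show "form d (act M v 0)" using act_tuples[OF assms v] by (auto simp: tuples_def)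
  next
    fix p assume p: "p \<in> row_ideal M" "form d p"
    then obtain u where u: "u \<in> carrier_vec (length a)" "p = (M *\<^sub>v u) $ 0"
      using M by (auto simp: row_ideal_def mat_image_def)
    then obtain v where "v \<in> tuples a d" "act M v 0 = p"
      using act_homogeneous_part[OF assms u(1), of d] p(2) by auto
    then show "p \<in> (\<lambda>v. act M v 0) ` tuples a d" by blast
  qed
  obtain K where K: "finite K" "{v \<in> tuples a d. act M v 0 = 0} \<subseteq> fv.span K"
    using tuples_finite_span[of a d] by blast
  obtain D where D: "finite D" "(\<lambda>v. act M v 0) ` tuples a d \<subseteq> kv.span D"
    using forms_finite_span[of d] unfolding im forms_def by blast
  show ?thesis
    using fm.rank_nullity_on(2)[OF subspace_tuples[of a d], of "\<lambda>v. act M v 0", OF _ _ K D] dim_tuples[of a d, where 'n='n and 'k='k]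
    unfolding im z by (simp add: act_scale act_add)
qed

lemma dim_zero: "fv.dim ({0} :: (nat \<Rightarrow> ('n, 'k::field) mpoly) set) = 0"
  using fv.dim_le_card[of "{0}" "{}"] by simp

lemma dim_syzygies_resolution:
  fixes J :: "('n::finite, 'k::field) mpoly set"
  assumes "graded_free_resolution J [a0, a1, a2] [M0, M1, M2]"
  shows "fv.dim {v \<in> tuples a0 d. act M0 v = 0} + (\<Sum>x\<leftarrow>a2. rdim TYPE(('n, 'k) mpoly) (d - x)) =
    (\<Sum>x\<leftarrow>a1. rdim TYPE(('n, 'k) mpoly) (d - x))"
proof -
  have g: "graded_map [0] a0 M0" "graded_map a0 a1 M1" "graded_map a1 a2 M2"
    using assms by (auto simp: graded_free_resolution_def all_less_3 numeral_2_eq_2)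
  have k: "mat_kernel M0 = mat_image M1" "mat_kernel M1 = mat_image M2" "mat_kernel M2 = {0\<^sub>v (dim_col M2)}"
    using assms by (auto simp: graded_free_resolution_def all_less_3 numeral_2_eq_2)
  have "{v \<in> tuples a2 d. act M2 v = 0} = {0}"
  proof safe
    fix v assume v: "v \<in> tuples a2 d" "act M2 v = 0"
    have d: "dim_col M2 = length a2" using g(3) by (auto simp: graded_map_def)
    have "M2 *\<^sub>v vec (dim_col M2) v = 0\<^sub>v (dim_row M2)" unfolding mult_vec_act v(2) by auto
    then have "vec (dim_col M2) v \<in> mat_kernel M2" by (simp add: mat_kernel_def)
    then have "vec (dim_col M2) v = 0\<^sub>v (dim_col M2)" using k(3) by blast
    then have *: "vec (length a2) v = 0\<^sub>v (length a2)" using d by simp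
    show "v = 0"
    proof
      fix i show "v i = 0 i"
      proof (cases "i < length a2")
        case True
        then have "v i = vec (length a2) v $ i" by simp
        then show ?thesis using * True by simp
      qed (use v(1) in \<open>simp add: tuples_def\<close>)
    qed
  qed (auto simp: tuples_def act_def fun_eq_iff)
  moreover have "fv.dim ({0} :: (nat \<Rightarrow> ('n, 'k) mpoly) set) = 0" by (rule dim_zero)
  ultimately show ?thesis
    using dim_act_tuples[OF g(3), of d] dim_act_tuples[OF g(2), of d] exact_tuples[OF g(2,3) k(2), of d]
      exact_tuples[OF g(1,2) k(1), of d] by simp
qed

section \<open>Hilbert polynomials\<close>

text \<open>The binomial coefficient \<open>x + N\<close> over \<open>N\<close> as a polynomial in
  \<open>x\<close>: the Hilbert polynomial of the polynomial ring in \<open>N + 1\<close>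
  variables.\<close>

definition rho :: "nat \<Rightarrow> 'a::field_char_0 poly" where
  "rho N = Polynomial.smult (inverse (fact N)) (\<Prod>j<N. [:of_nat j + 1, 1:])"

lemma poly_rho: "poly (rho N) (of_nat i) = (of_nat ((i + N) choose N) :: 'a::field_char_0)"
proof -
  have "(of_nat ((i + N) choose N) :: 'a) = pochhammer (of_nat i + 1) N / fact N"
    by (simp add: binomial_gbinomial gbinomial_pochhammer')
  also have "pochhammer (of_nat i + 1 :: 'a) N = (\<Prod>j<N. poly [:of_nat j + 1, 1:] (of_nat i))"
    by (simp add: pochhammer_prod lessThan_atLeast0 add_ac)
  finally show ?thesis by (simp add: rho_def poly_prod field_simps)
qed

lemma rho_degree: "Polynomial.degree (rho N :: 'a::field_char_0 poly) = N" "coeff (rho N :: 'a poly) N = inverse (fact N)"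
proof -
  have d: "Polynomial.degree (\<Prod>j<N. [:of_nat j + 1 :: 'a, 1:]) = N"
    by (subst degree_prod_eq_sum_degree) auto
  then show "Polynomial.degree (rho N :: 'a poly) = N" by (simp add: rho_def)
  have "lead_coeff (\<Prod>j<N. [:of_nat j + 1 :: 'a, 1:]) = 1" by (simp add: lead_coeff_prod)
  then show "coeff (rho N :: 'a poly) N = inverse (fact N)" using d by (simp add: rho_def)
qed

lemma pcompose_monom: "pcompose (Polynomial.monom c j) q = Polynomial.smult c (q ^ j)" for q :: "'a::comm_ring_1 poly"
  by (induction j) (auto simp: monom_0 monom_Suc pcompose_pCons)

lemma coeff_shift:
  fixes p :: "'a::comm_ring_1 poly"
  assumes "Polynomial.degree p \<le> n"
  shows "coeff (pcompose p [:b, 1:]) k = (\<Sum>j\<le>n. coeff p j * of_nat (j choose k) * b ^ (j - k))"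
proof -
  have "pcompose p [:b, 1:] = (\<Sum>j\<le>n. Polynomial.smult (coeff p j) ([:b, 1:] ^ j))"
    using arg_cong[OF poly_as_sum_of_monoms'[OF assms], of "\<lambda>p. pcompose p [:b, 1:]"]
    by (simp add: pcompose_sum pcompose_monom)
  moreover have "coeff ([:b, 1:] ^ j) k = of_nat (j choose k) * b ^ (j - k)" for j
    using degree_power_le[of "[:b, 1:]" j]
    by (cases "k \<le> j") (auto simp: coeff_linear_poly_power binomial_eq_0 intro!: coeff_eq_0)
  ultimately show ?thesis by (simp add: coeff_sum mult.assoc)
qed

text \<open>Three coefficients suffice: the ring has a Hilbert polynomial of degree
  \<open>m + 2\<close>, and a quotient of codimension two has one of degree
  \<open>m\<close>.\<close>

lemma coeff_shift_top:
  fixes p :: "'a::comm_ring_1 poly"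
  assumes "Polynomial.degree p \<le> Suc (Suc m)"
  shows "coeff (pcompose p [:b, 1:]) (Suc (Suc m)) = coeff p (Suc (Suc m))"
    "coeff (pcompose p [:b, 1:]) (Suc m) = coeff p (Suc m) + of_nat (Suc (Suc m)) * b * coeff p (Suc (Suc m))"
    "coeff (pcompose p [:b, 1:]) m = coeff p m + of_nat (Suc m) * b * coeff p (Suc m)
       + of_nat (Suc (Suc m) choose 2) * b\<^sup>2 * coeff p (Suc (Suc m))"
    "k > Suc (Suc m) \<Longrightarrow> coeff (pcompose p [:b, 1:]) k = 0"
proof -
  have lower: "(\<Sum>j\<le>n. coeff p j * of_nat (j choose k) * b ^ (j - k)) = (if n = k then coeff p k else 0)" if "n \<le> k" for n k
  proof (cases "n = k")
    case True
    have "(\<Sum>j\<le>k. coeff p j * of_nat (j choose k) * b ^ (j - k)) = (\<Sum>j\<in>{k}. coeff p j * of_nat (j choose k) * b ^ (j - k))"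
      by (rule sum.mono_neutral_right) (auto simp: binomial_eq_0)
    then show ?thesis using True by simp
  next
    case False
    then show ?thesis using that by (auto intro!: sum.neutral simp: binomial_eq_0)
  qed
  have ch: "Suc (Suc m) choose m = Suc (Suc m) choose 2" using binomial_symmetric[of m "Suc (Suc m)"] by (simp add: numeral_2_eq_2)
  note c = coeff_shift[OF assms, of b]
  show "coeff (pcompose p [:b, 1:]) (Suc (Suc m)) = coeff p (Suc (Suc m))"
    unfolding c using lower[of "Suc (Suc m)" "Suc (Suc m)"] by simp
  show "coeff (pcompose p [:b, 1:]) (Suc m) = coeff p (Suc m) + of_nat (Suc (Suc m)) * b * coeff p (Suc (Suc m))"
    unfolding c sum.atMost_Suc[of _ "Suc m"] using lower[of "Suc m" "Suc m"] by (simp add: mult_ac)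
  show "coeff (pcompose p [:b, 1:]) m = coeff p m + of_nat (Suc m) * b * coeff p (Suc m)
       + of_nat (Suc (Suc m) choose 2) * b\<^sup>2 * coeff p (Suc (Suc m))"
    unfolding c sum.atMost_Suc[of _ "Suc m"] sum.atMost_Suc[of _ m] using lower[of m m] ch
    by (simp add: mult_ac power2_eq_square)
  show "coeff (pcompose p [:b, 1:]) k = 0" if "k > Suc (Suc m)"
    unfolding c using lower[of "Suc (Suc m)" k] that by simp
qed

text \<open>A list of pairs \<open>(c, a)\<close> stands for the numerator \<open>\<Sum> c t\<^sup>a\<close> of a Hilbert series; its moments are
  the derivatives at \<open>t = 1\<close> up to triangular transformations.\<close>

definition hpoly :: "nat \<Rightarrow> (int \<times> int) list \<Rightarrow> 'a::field_char_0 poly" where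
  "hpoly N cs = (\<Sum>(c, a)\<leftarrow>cs. Polynomial.smult (of_int c) (pcompose (rho N) [:- of_int a, 1:]))"

definition moment :: "nat \<Rightarrow> (int \<times> int) list \<Rightarrow> int" where
  "moment k cs = (\<Sum>(c, a)\<leftarrow>cs. c * a ^ k)"

text \<open>A shift by \<open>a\<close> contributes powers of \<open>a\<close>, so the top
  coefficients are triangular in the moments.\<close>

lemma hpoly_coeffs:
  fixes cs :: "(int \<times> int) list" and m :: nat
  defines "N \<equiv> Suc (Suc m)"
  defines "h \<equiv> (hpoly N cs :: 'a::field_char_0 poly)"
  shows "coeff h N = of_int (moment 0 cs) * inverse (fact N)"
    "coeff h (Suc m) = of_int (moment 0 cs) * coeff (rho N) (Suc m) - of_int (moment 1 cs) * (of_nat N * inverse (fact N))"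
    "coeff h m = of_int (moment 0 cs) * coeff (rho N) m - of_int (moment 1 cs) * (of_nat (Suc m) * coeff (rho N) (Suc m))
       + of_int (moment 2 cs) * (of_nat (N choose 2) * inverse (fact N))"
    "k > N \<Longrightarrow> coeff h k = 0"
proof -
  have d: "Polynomial.degree (rho N :: 'a poly) \<le> Suc (Suc m)" by (simp add: rho_degree N_def)
  note t = coeff_shift_top[OF d]
  note rN = rho_degree(2)[of N, where 'a='a]
  show "coeff h N = of_int (moment 0 cs) * inverse (fact N)"
    unfolding h_def hpoly_def moment_def N_def[symmetric]
    by (induction cs) (auto simp: t[folded N_def] rN algebra_simps)
  show "coeff h (Suc m) = of_int (moment 0 cs) * coeff (rho N) (Suc m) - of_int (moment 1 cs) * (of_nat N * inverse (fact N))"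
    unfolding h_def hpoly_def moment_def
    by (induction cs) (auto simp: t(2) rN algebra_simps simp flip: N_def)
  show "coeff h m = of_int (moment 0 cs) * coeff (rho N) m - of_int (moment 1 cs) * (of_nat (Suc m) * coeff (rho N) (Suc m))
       + of_int (moment 2 cs) * (of_nat (N choose 2) * inverse (fact N))"
    unfolding h_def hpoly_def moment_def
    by (induction cs) (auto simp: t(3) rN algebra_simps simp flip: N_def)
  show "coeff h k = 0" if "k > N"
    using that unfolding h_def hpoly_def
    by (induction cs) (auto simp: t(4)[unfolded N_def] N_def)
qed

lemma poly_hpoly: "poly (hpoly N cs) x = (\<Sum>(c, a)\<leftarrow>cs. of_int c * poly (rho N) (x - of_int a))"
  unfolding hpoly_def by (induction cs) (auto simp: poly_pcompose)

lemma eventually_rdim: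
  assumes "CARD('n::{finite,linorder}) = Suc N"
  shows "\<forall>\<^sub>F i in sequentially. (of_nat (rdim TYPE(('n, 'k::field) mpoly) (int i - a)) :: 'a::field_char_0) = poly (rho N) (of_nat i - of_int a)"
proof (rule eventually_sequentiallyI[of "nat a"])
  fix i assume "nat a \<le> i"
  then have 1: "int i - a = int (nat (int i - a))" by simp
  then have 2: "(of_nat i - of_int a :: 'a) = of_nat (nat (int i - a))"
    by (metis of_int_diff of_int_of_nat_eq)
  show "(of_nat (rdim TYPE(('n, 'k) mpoly) (int i - a)) :: 'a) = poly (rho N) (of_nat i - of_int a)"
    unfolding 2 poly_rho using rdim_binomial[of "nat (int i - a)", where 'n='n and 'k='k] 1 assms by simp
qed

lemma eventually_hpoly:
  assumes "CARD('n::{finite,linorder}) = Suc N"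
  shows "\<forall>\<^sub>F i in sequentially. (\<Sum>(c, a)\<leftarrow>cs. of_int c * of_nat (rdim TYPE(('n, 'k::field) mpoly) (int i - a))) =
     (poly (hpoly N cs) (of_nat i) :: 'a::field_char_0)"
  unfolding poly_hpoly
proof (induction cs)
  case (Cons x cs)
  show ?case using eventually_conj[OF Cons.IH eventually_rdim[OF assms, of "snd x", where 'k='k and 'a='a]]
    by (rule eventually_mono) (auto simp: case_prod_beta)
qed simp

lemma finite_polys_eq:
  fixes p q :: "rat poly"
  assumes "\<forall>\<^sub>F i in sequentially. poly p (of_nat i) = poly q (of_nat i)"
  shows "p = q"
proof (rule ccontr)
  assume "p \<noteq> q"
  then have fin: "finite {x. poly (p - q) x = 0}" by (intro poly_roots_finite) simp
  obtain n where n: "\<And>i. n \<le> i \<Longrightarrow> poly p (of_nat i) = poly q (of_nat i)"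
    using assms unfolding eventually_sequentially by blast
  have "of_nat ` {n..} \<subseteq> {x. poly (p - q) x = 0}" using n by auto
  then have "finite ((of_nat :: nat \<Rightarrow> rat) ` {n..})" using fin finite_subset by blast
  then have "finite {n..}" by (rule finite_imageD) (auto simp: inj_on_def)
  then show False using infinite_Ici by blast
qed

text \<open>When the first two moments vanish, the leading coefficient is the second moment times
  \<open>(N choose 2) / N!\<close> with \<open>N = m + 2\<close>. This factor is
  \<open>1 / (2 * m!)\<close>, hence the 2 in front of \<mu>.\<close>

lemma quot_multiplicity_eqI:
  fixes I :: "('n::{finite,linorder}, 'k::field) mpoly set"
  assumes N: "CARD('n) = Suc (Suc (Suc m))"
    and ev: "\<And>i. of_nat (hilbert_fun I i) = (\<Sum>(c, a)\<leftarrow>cs. of_int c * of_nat (rdim TYPE(('n, 'k) mpoly) (int i - a)) :: rat)"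
    and mom: "moment 0 cs = 0" "moment 1 cs = 0" "moment 2 cs = 2 * \<mu>" "\<mu> \<noteq> 0"
  shows "quot_multiplicity I = of_int \<mu>"
proof -
  define h where "h = (hpoly (Suc (Suc m)) cs :: rat poly)"
  have h: "\<forall>\<^sub>F i in sequentially. of_nat (hilbert_fun I i) = poly h (of_nat i)"
    unfolding h_def ev by (rule eventually_hpoly[OF N])
  have hp: "hilbert_poly I = h"
    unfolding hilbert_poly_def
  proof (rule the_equality)
    show "\<forall>\<^sub>F i in sequentially. of_nat (hilbert_fun I i) = poly h (of_nat i)" by (rule h)
  next
    fix h' :: "rat poly" assume "\<forall>\<^sub>F i in sequentially. of_nat (hilbert_fun I i) = poly h' (of_nat i)"
    then have "\<forall>\<^sub>F i in sequentially. poly h' (of_nat i) = poly h (of_nat i)"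
      using h by eventually_elim simp
    then show "h' = h" by (rule finite_polys_eq)
  qed
  have c2: "coeff h m = of_int \<mu> * inverse (fact m)"
  proof -
    have "of_nat (Suc (Suc m) choose 2) = (of_nat (Suc (Suc m)) * of_nat (Suc m) / 2 :: rat)"
    proof -
      have "2 * (Suc (Suc m) choose 2) = Suc (Suc m) * Suc m" by (simp add: choose_two)
      then have "(2 :: rat) * of_nat (Suc (Suc m) choose 2) = of_nat (Suc (Suc m)) * of_nat (Suc m)"
        by (metis of_nat_mult of_nat_numeral)
      then show ?thesis by simp
    qed
    moreover have "(fact (Suc (Suc m)) :: rat) = of_nat (Suc (Suc m)) * of_nat (Suc m) * fact m" by simp
    ultimately have "of_int (2 * \<mu>) * (of_nat (Suc (Suc m) choose 2) * inverse (fact (Suc (Suc m)))) = (of_int \<mu> * inverse (fact m) :: rat)"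
      by (simp only: of_int_mult of_int_numeral) (simp add: field_simps del: of_nat_Suc fact_Suc)
    then show ?thesis unfolding h_def hpoly_coeffs(3) mom by simp
  qed
  have up: "coeff h k = 0" if k: "k > m" for k
  proof -
    consider "k = Suc m" | "k = Suc (Suc m)" | "k > Suc (Suc m)" using k by linarith
    then show ?thesis
      using hpoly_coeffs[where m=m and cs=cs and 'a=rat] mom unfolding h_def by cases auto
  qed
  have deg: "Polynomial.degree h = m"
    using c2 mom(4) up by (intro antisym degree_le le_degree) auto
  have "h \<noteq> 0" using c2 mom(4) by auto
  then show ?thesis unfolding quot_multiplicity_def hp Let_def using deg c2 by simp
qed

text \<open>The coefficient of degree \<open>m + 1\<close> is a nonzero multiple of
  \<open>moment 1 cs\<close>. If it were not 0, the polynomial would eventually become negative or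
  exceed the polynomial of \<open>ds\<close>, whose degree is at most \<open>m\<close>.\<close>

lemma moment_1_zero:
  assumes N: "CARD('n::{finite,linorder}) = Suc (Suc (Suc m))"
    and mom: "moment 0 cs = 0" "moment 0 ds = 0" "moment 1 ds = 0"
    and le: "\<And>i. 0 \<le> (\<Sum>(c, a)\<leftarrow>cs. of_int c * of_nat (rdim TYPE(('n, 'k::field) mpoly) (int i - a)) :: real)"
      "\<And>i. (\<Sum>(c, a)\<leftarrow>cs. of_int c * of_nat (rdim TYPE(('n, 'k) mpoly) (int i - a)) :: real)
         \<le> (\<Sum>(c, a)\<leftarrow>ds. of_int c * of_nat (rdim TYPE(('n, 'k) mpoly) (int i - a)))"
  shows "moment 1 cs = 0"
proof (rule ccontr)
  assume m1: "moment 1 cs \<noteq> 0"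
  define h where "h = (hpoly (Suc (Suc m)) cs :: real poly)"
  define g where "g = (hpoly (Suc (Suc m)) ds :: real poly)"
  have "\<forall>\<^sub>F i in sequentially. 0 \<le> poly h (of_nat i) \<and> poly h (of_nat i) \<le> poly g (of_nat i)"
    using eventually_conj[OF eventually_hpoly[OF N, of cs, where 'k='k and 'a=real] eventually_hpoly[OF N, of ds, where 'k='k and 'a=real]]
    unfolding h_def g_def by (rule eventually_mono) (use le in metis)
  then obtain n where n: "\<And>i. n \<le> i \<Longrightarrow> 0 \<le> poly h (real i) \<and> poly h (real i) \<le> poly g (real i)"
    unfolding eventually_sequentially by blast
  define \<kappa> where "\<kappa> = coeff h (Suc m)"
  have k0: "\<kappa> = - of_int (moment 1 cs) * (of_nat (Suc (Suc m)) * inverse (fact (Suc (Suc m))))"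
    unfolding \<kappa>_def h_def hpoly_coeffs(2) mom by simp
  have zero: "coeff h k = 0" "coeff g k = 0" if k: "k > Suc m" for k
  proof -
    consider "k = Suc (Suc m)" | "k > Suc (Suc m)" using k by linarith
    then show "coeff h k = 0" "coeff g k = 0"
      using hpoly_coeffs[where m=m and cs=cs and 'a=real] hpoly_coeffs[where m=m and cs=ds and 'a=real] mom unfolding h_def g_def by (cases; auto)+
  qed
  have g1: "coeff g (Suc m) = 0" unfolding g_def hpoly_coeffs(2) mom by simp
  have contra: False if p: "lead_coeff p > 0" "\<And>i. n \<le> i \<Longrightarrow> poly p (real i) \<le> 0" for p :: "real poly"
  proof -
    obtain x0 where x0: "\<And>x. x0 \<le> x \<Longrightarrow> lead_coeff p \<le> poly p x" using poly_pinfty_gt_lc[OF p(1)] by blast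
    define i where "i = max n (nat \<lceil>x0\<rceil>)"
    have "x0 \<le> real i" unfolding i_def by linarith
    then show False using x0[of "real i"] p(1) p(2)[of i] by (simp add: i_def)
  qed
  have "\<kappa> \<noteq> 0" unfolding k0 using m1 by simp
  then consider "\<kappa> > 0" | "\<kappa> < 0" by linarith
  then show False
  proof cases
    case 1
    have "Polynomial.degree (h - g) = Suc m"
      using 1 zero g1 by (intro antisym degree_le le_degree) (auto simp: \<kappa>_def)
    then show False using contra[of "h - g"] 1 g1 n by (simp add: \<kappa>_def)
  next
    case 2
    have "Polynomial.degree (- h) = Suc m"
      using 2 zero by (intro antisym degree_le le_degree) (auto simp: \<kappa>_def)
    then show False using contra[of "- h"] 2 n by (simp add: \<kappa>_def)
  qed
qed

subsection \<open>A regular sequence of two generators\<close>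

text \<open>An irreducible factor of \<open>a\<close> divides \<open>g + Const c * h\<close> for at
  most one \<open>c\<close>: from two values it would divide \<open>h\<close> and \<open>g\<close>
  as well. So each factor excludes at most one constant.\<close>

lemma coprime_combination:
  fixes a g h :: "('n::{finite,linorder}, 'k::field) mpoly"
  assumes "a \<noteq> 0" "primitive {a, g, h}"
  shows "\<exists>B. finite B \<and> (\<forall>c. c \<notin> B \<longrightarrow> primitive {a, g + Const c * h})"
  using assms
proof (induction "nat (tdeg a)" arbitrary: a rule: less_induct)
  case less
  show ?case
  proof (cases "a dvd 1")
    case True
    then have "primitive {a, g + Const c * h}" for c
      unfolding primitive_def using dvd_trans irreducible_not_unit by blast
    then show ?thesis by (intro exI[of _ "{}"]) auto
  next
    case False
    then obtain p a' where p: "irreducible p" "a = p * a'"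
      using irreducible_factor_exists[OF less.prems(1)] by blast
    have nz: "p \<noteq> 0" "a' \<noteq> 0" using p(2) less.prems(1) by auto
    have deg: "nat (tdeg a') < nat (tdeg a)"
      using tdeg_mult[OF nz] tdeg_irreducible_pos[OF p(1)] tdeg_nonneg[OF nz(2)] p(2) by simp
    have "primitive {a', g, h}" using less.prems(2) p(2) unfolding primitive_def by auto
    then obtain B where B: "finite B" "\<And>c. c \<notin> B \<Longrightarrow> primitive {a', g + Const c * h}"
      using less.hyps[OF deg nz(2)] by blast
    define E where "E = {c. p dvd g + Const c * h}"
    have E: "c = c'" if "c \<in> E" "c' \<in> E" for c c'
    proof (rule ccontr)
      assume "c \<noteq> c'"
      have "p dvd (g + Const c * h) - (g + Const c' * h)" using that by (intro dvd_diff) (auto simp: E_def)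
      also have "(g + Const c * h) - (g + Const c' * h) = Const (c - c') * h"
        by (simp add: single_diff algebra_simps)
      finally have "p dvd Const (c - c') * h" .
      moreover have "\<not> p dvd Const (c - c')"
        using Const_unit[of "c - c'"] \<open>c \<noteq> c'\<close> p(1) dvd_trans irreducible_not_unit by (metis right_minus_eq)
      ultimately have "p dvd h" using irreducible_prime_dvd[OF p(1)] by blast
      moreover have "p dvd (g + Const c * h) - Const c * h"
        using that calculation by (intro dvd_diff) (auto simp: E_def)
      ultimately show False using less.prems(2) p unfolding primitive_def by auto
    qed
    have "finite E"
    proof (cases "E = {}")
      case False
      then obtain c where "c \<in> E" by blast
      then have "E \<subseteq> {c}" using E by blast
      then show ?thesis by (rule finite_subset) simp
    qed simp
    moreover have "primitive {a, g + Const c * h}" if c: "c \<notin> B \<union> E" for c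
      unfolding primitive_def
    proof (intro notI, elim exE conjE)
      fix q assume q: "irreducible q" "\<forall>s\<in>{a, g + Const c * h}. q dvd s"
      then have "q dvd p \<or> q dvd a'" using irreducible_prime_dvd p(2) by auto
      then show False
      proof
        assume "q dvd p"
        then obtain u where u: "p = q * u" by blast
        then have "u dvd 1" using irreducibleD[OF p(1) u] q(1) irreducible_not_unit by blast
        then obtain v where "1 = u * v" by blast
        then have "p * v = q" using u by (metis mult.assoc mult.right_neutral)
        then have "p dvd q" by (metis dvd_triv_left)
        then show False using q(2) c dvd_trans by (auto simp: E_def)
      next
        assume "q dvd a'"
        then show False using B(2)[of c] c q unfolding primitive_def by auto
      qed
    qed
    ultimately show ?thesis using B(1) by (intro exI[of _ "B \<union> E"]) auto
  qed
qed

text \<open>For coprime \<open>u\<close> and \<open>v\<close> the Koszul relation generates all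
  relations. This bounds from below the dimension of the ideal they generate, which lies in
  \<open>J\<close>.\<close>

lemma dim_ideal_coprime_pair:
  fixes J :: "('n::{finite,linorder}, 'k::field) mpoly set"
  assumes "is_ideal J" "u \<in> J" "v \<in> J" "form s u" "form s v" "primitive {u, v}" "u \<noteq> 0"
  shows "2 * rdim TYPE(('n, 'k) mpoly) (d - s) \<le> rdim TYPE(('n, 'k) mpoly) (d - 2 * s) + kv.dim {p \<in> J. form d p}"
proof -
  define M where "M = mat 1 2 (\<lambda>(i, j). if j = 0 then u else v)"
  define M' where "M' = mat 2 1 (\<lambda>(i, j). if i = 0 then v else - u)"
  have g: "graded_map [0] [s, s] M" "graded_map [s, s] [2 * s] M'"
    using assms(4,5) whom_uminus[of _ s u] by (auto simp: graded_map_def M_def M'_def less_Suc_eq form_eq_whom)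
  have Mv: "(M *\<^sub>v w) $ 0 = u * w $ 0 + v * w $ 1" if "w \<in> carrier_vec 2" for w
    using that by (simp add: M_def scalar_prod_def numeral_2_eq_2)
  have M'v: "M' *\<^sub>v w = vec 2 (\<lambda>i. if i = 0 then v * w $ 0 else - u * w $ 0)" if "w \<in> carrier_vec 1" for w
    using that by (intro eq_vecI) (auto simp: M'_def scalar_prod_def)
  have ker: "mat_kernel M = mat_image M'"
  proof safe
    fix w assume "w \<in> mat_kernel M"
    then have w: "w \<in> carrier_vec 2" "M *\<^sub>v w = 0\<^sub>v 1" by (auto simp: mat_kernel_def M_def)
    then have eq: "u * w $ 0 + v * w $ 1 = 0" using Mv[OF w(1)] by simp
    have "u dvd w $ 1 * x" if "x \<in> {u, v}" for x
    proof -
      have "w $ 1 * v = u * (- w $ 0)" using eq by Groebner_Basis.algebra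
      then show ?thesis using that by auto
    qed
    then have "u dvd w $ 1" using primitive_dvd[OF assms(6,7)] by blast
    then obtain t where t: "w $ 1 = u * t" by blast
    have "u * (w $ 0) = u * (- v * t)" using eq t by Groebner_Basis.algebra
    then have t0: "w $ 0 = - v * t" using mult_left_cancel[OF assms(7)] by blast
    have "w = M' *\<^sub>v vec 1 (\<lambda>_. - t)"
      using M'v[of "vec 1 (\<lambda>_. - t)"] w(1) t t0 by (intro eq_vecI) (auto simp: less_Suc_eq numeral_2_eq_2)
    then show "w \<in> mat_image M'" by (auto simp: mat_image_def M'_def)
  next
    fix w assume "w \<in> mat_image M'"
    then obtain y where y: "y \<in> carrier_vec 1" "w = M' *\<^sub>v y" by (auto simp: mat_image_def M'_def)
    then have w: "w = vec 2 (\<lambda>i. if i = 0 then v * y $ 0 else - u * y $ 0)" using M'v by blast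
    then have "(M *\<^sub>v w) $ 0 = 0" using Mv[of w] by (simp add: mult_ac)
    then have "M *\<^sub>v w = 0\<^sub>v 1" by (intro eq_vecI) (auto simp: M_def)
    then show "w \<in> mat_kernel M" using w by (auto simp: mat_kernel_def M_def)
  qed
  have sub: "{p \<in> row_ideal M. form d p} \<subseteq> {p \<in> J. form d p}"
  proof safe
    fix p assume "p \<in> row_ideal M"
    then obtain w where w: "w \<in> carrier_vec 2" "p = (M *\<^sub>v w) $ 0" by (auto simp: row_ideal_def mat_image_def M_def)
    have "w $ 0 * u + w $ 1 * v \<in> J" using assms(1-3) unfolding is_ideal_iff by blast
    then show "p \<in> J" using Mv[OF w(1)] w(2) by (simp add: mult.commute)
  qed
  obtain B where B: "finite B" "{p \<in> J. form d p} \<subseteq> kv.span B"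
    using forms_finite_span[of d] unfolding forms_def by blast
  have "kv.dim {p \<in> row_ideal M. form d p} \<le> kv.dim {p \<in> J. form d p}"
    by (rule kv.dim_subset_finite[OF sub B])
  moreover have "fv.dim (act M' ` tuples [2 * s] d) \<le> rdim TYPE(('n, 'k) mpoly) (d - 2 * s)"
    using dim_act_tuples[OF g(2), of d] by simp
  ultimately show ?thesis
    using dim_row_ideal[OF g(1), of d] exact_tuples[OF g ker, of d] by simp
qed

text \<open>In characteristic zero the field is infinite, so some constant outside the exceptional
  set of \<open>coprime_combination\<close> provides two coprime forms of degree \<open>s\<close> in
  \<open>J\<close>.\<close>

lemma ideal_forms_dim_ge:
  fixes J :: "('n::{finite,linorder}, 'k::field_char_0) mpoly set"
  assumes "f \<in> carrier_vec 3" "min_gens s J f" "primitive J"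
  shows "2 * rdim TYPE(('n, 'k) mpoly) (d - s) \<le> rdim TYPE(('n, 'k) mpoly) (d - 2 * s) + kv.dim {p \<in> J. form d p}"
proof -
  have J: "J = ideal_gen (set\<^sub>v f)" "is_ideal J" using assms(2) by (auto simp: min_gens_def)
  have set: "set\<^sub>v f = {f $ 0, f $ 1, f $ 2}"
    using assms(1) by (auto simp: vec_set_def numeral_3_eq_3 less_Suc_eq numeral_2_eq_2)
  have fJ: "f $ i \<in> J" if "i < 3" for i
    unfolding J(1) set using that by (intro ideal.span_base) (auto simp: numeral_3_eq_3 less_Suc_eq numeral_2_eq_2)
  have ff: "form s (f $ i)" if "i < 3" for i using assms(1,2) that by (auto simp: min_gens_def)
  have "0 < dim_vec f" using assms(1) by auto
  then have "f $ 0 \<notin> ideal_gen {f $ j | j. j < dim_vec f \<and> j \<noteq> 0}"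
    by (rule assms(2)[unfolded min_gens_def, THEN conjunct2, THEN conjunct2, rule_format])
  then have f0: "f $ 0 \<noteq> 0" by (rule contrapos_nn) (simp only: ideal.span_zero)
  have "primitive {f $ 0, f $ 1, f $ 2}" using primitive_ideal_gen[of "set\<^sub>v f", folded J(1), OF assms(3)] unfolding set .
  then obtain B where B: "finite B" "\<And>c. c \<notin> B \<Longrightarrow> primitive {f $ 0, f $ 1 + Const c * f $ 2}"
    using coprime_combination[OF f0] by blast
  obtain c where "c \<notin> B" using ex_new_if_finite[OF infinite_UNIV_char_0 B(1)] by blast
  have "f $ 1 + Const c * f $ 2 \<in> J" using fJ[of 1] fJ[of 2] J(2) unfolding is_ideal_iff by auto
  moreover have "form s (f $ 1 + Const c * f $ 2)" using ff by (intro form_add form_Const_mult) auto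
  ultimately show ?thesis
    using dim_ideal_coprime_pair[OF J(2) fJ[of 0] _ ff[of 0] _ B(2)[OF \<open>c \<notin> B\<close>] f0] by simp
qed

section \<open>Vectors of three forms and their syzygies\<close>

lemma set_vec_3: "f \<in> carrier_vec 3 \<Longrightarrow> set\<^sub>v f = {f $ 0, f $ 1, f $ 2}"
  by (auto simp: vec_set_def numeral_3_eq_3 less_Suc_eq numeral_2_eq_2)

lemma entries3_eq: "entries3 f = {f $ 0, f $ 1, f $ 2}"
  by (auto simp: entries3_def numeral_3_eq_3 less_Suc_eq numeral_2_eq_2)

lemma ideal_gen_3: "ideal_gen {a, b, c} = {a * x + b * y + c * z | x y z. True}" (is "_ = ?R")
proof
  have "is_ideal ?R" unfolding is_ideal_iff
  proof (intro conjI ballI allI)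
    have "0 = a * 0 + b * 0 + c * 0" by simp
    then show "0 \<in> ?R" by blast
    fix p q assume "p \<in> ?R" "q \<in> ?R"
    then obtain x y z x' y' z' where "p = a * x + b * y + c * z" "q = a * x' + b * y' + c * z'" by blast
    then have "p + q = a * (x + x') + b * (y + y') + c * (z + z')" by (simp add: algebra_simps)
    then show "p + q \<in> ?R" by blast
  next
    fix r p assume "p \<in> ?R"
    then obtain x y z where "p = a * x + b * y + c * z" by blast
    then have "r * p = a * (r * x) + b * (r * y) + c * (r * z)" by (simp add: algebra_simps)
    then show "r * p \<in> ?R" by blast
  qed
  moreover have "{a, b, c} \<subseteq> ?R"
  proof -
    have "a = a * 1 + b * 0 + c * 0" "b = a * 0 + b * 1 + c * 0" "c = a * 0 + b * 0 + c * 1" by auto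
    then show ?thesis by blast
  qed
  ultimately show "ideal_gen {a, b, c} \<subseteq> ?R" by (rule ideal.span_minimal[rotated])
  have "a * x + b * y + c * z \<in> ideal_gen {a, b, c}" for x y z
    unfolding mult.commute[of a] mult.commute[of b] mult.commute[of c]
    by (intro ideal.span_add ideal.span_scale ideal.span_base) auto
  then show "?R \<subseteq> ideal_gen {a, b, c}" by blast
qed

definition row_mat :: "'a vec \<Rightarrow> 'a mat" where
  "row_mat f = mat 1 3 (\<lambda>(i, j). f $ j)"

lemma act_row_mat: "act (row_mat f) v 0 = f $ 0 * v 0 + f $ 1 * v 1 + f $ 2 * v 2"
  by (simp add: act_def row_mat_def numeral_3_eq_3 numeral_2_eq_2)

lemma act_row_mat_0: "act (row_mat f) v = 0 \<longleftrightarrow> f $ 0 * v 0 + f $ 1 * v 1 + f $ 2 * v 2 = 0"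
  unfolding act_row_mat[symmetric] by (auto simp: act_def row_mat_def fun_eq_iff)

lemma row_mat_mult: "w \<in> carrier_vec 3 \<Longrightarrow> row_mat f *\<^sub>v w = vec 1 (\<lambda>_. f $ 0 * w $ 0 + f $ 1 * w $ 1 + f $ 2 * w $ 2)"
  by (intro eq_vecI) (auto simp: row_mat_def scalar_prod_def numeral_3_eq_3 numeral_2_eq_2)

lemma kernel_row_mat: "f \<in> carrier_vec 3 \<Longrightarrow> mat_kernel (row_mat f) = syzygies f"
  using row_mat_mult[of _ f] scalar_prod_3[of _ f]
  by (auto simp: mat_kernel_def syzygies_def row_mat_def vec_eq_iff)

lemma row_ideal_row_mat: "f \<in> carrier_vec 3 \<Longrightarrow> row_ideal (row_mat f) = ideal_gen (set\<^sub>v f)"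
proof -
  assume f: "f \<in> carrier_vec 3"
  have d: "dim_col (row_mat f) = 3" by (simp add: row_mat_def)
  show ?thesis unfolding set_vec_3[OF f] ideal_gen_3 row_ideal_def mat_image_def d
  proof safe
    fix w :: "'a vec" assume "w \<in> carrier_vec 3"
    then show "\<exists>x y z. (row_mat f *\<^sub>v w) $ 0 = f $ 0 * x + f $ 1 * y + f $ 2 * z \<and> True"
      using row_mat_mult by fastforce
  next
    fix x y z
    have "(row_mat f *\<^sub>v vec3 x y z) $ 0 = f $ 0 * x + f $ 1 * y + f $ 2 * z"
      using row_mat_mult[of "vec3 x y z" f] by simp
    then show "f $ 0 * x + f $ 1 * y + f $ 2 * z \<in> (\<lambda>v. v $ 0) ` {row_mat f *\<^sub>v v | v. v \<in> carrier_vec 3}"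
      by (metis (mono_tags, lifting) imageI mem_Collect_eq vec3_simps(5))
  qed
qed

lemma graded_row_mat: "\<forall>i<3. form s (f $ i) \<Longrightarrow> graded_map [0] [s, s, s] (row_mat f)"
  unfolding all_less_3 by (auto simp: graded_map_def row_mat_def numeral_3_eq_3 less_Suc_eq numeral_2_eq_2)

text \<open>Syzygies with entries of degree \<open>c\<close> sit in degree \<open>c + 3\<close> of
  the free module with the twists 3, 3, 3.\<close>

definition syz_forms :: "('n, 'k::comm_ring_1) mpoly vec \<Rightarrow> int \<Rightarrow> (nat \<Rightarrow> ('n, 'k) mpoly) set" where
  "syz_forms f c = {v \<in> tuples [3, 3, 3] (c + 3). act (row_mat f) v = 0}"

lemma syz_forms_iff:
  "v \<in> syz_forms f c \<longleftrightarrow> form c (v 0) \<and> form c (v 1) \<and> form c (v 2) \<and> (\<forall>j\<ge>3. v j = 0) \<and>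
     f $ 0 * v 0 + f $ 1 * v 1 + f $ 2 * v 2 = 0"
  unfolding syz_forms_def act_row_mat_0 by (auto simp: tuples_def numeral_3_eq_3 less_Suc_eq numeral_2_eq_2)

lemma vec_in_syzygies:
  assumes "f \<in> carrier_vec 3" "v \<in> syz_forms f c"
  shows "vec 3 v \<in> syzygies f" "vec_form c (vec 3 v)"
  using assms scalar_prod_3[of "vec 3 v" f] all_less_3[of "\<lambda>i. form c (v i)"]
  by (auto simp: syz_forms_iff syzygies_def vec_form_def)

lemma syzygy_function:
  assumes "f \<in> carrier_vec 3" "w \<in> syzygies f" "vec_form c w"
  shows "(\<lambda>j. if j < 3 then w $ j else 0) \<in> syz_forms f c" "vec 3 (\<lambda>j. if j < 3 then w $ j else 0) = w"
  using assms scalar_prod_3[of w f]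
  by (auto simp: syz_forms_iff syzygies_def vec_form_def)

lemma vec_eq_0_iff: "v \<in> syz_forms f c \<Longrightarrow> vec 3 v = 0\<^sub>v 3 \<longleftrightarrow> v = 0"
proof
  assume v: "v \<in> syz_forms f c" "vec 3 v = 0\<^sub>v 3"
  show "v = 0"
  proof
    fix j show "v j = 0 j"
    proof (cases "j < 3")
      case True
      then have "v j = vec 3 v $ j" by simp
      then show ?thesis using True v(2) by simp
    qed (use v(1) in \<open>simp add: syz_forms_iff\<close>)
  qed
qed auto

lemma (in vector_space) dim_0_imp:
  assumes "dim V = 0" "finite B" "V \<subseteq> span B" shows "V \<subseteq> {0}"
proof -
  obtain C where C: "C \<subseteq> V" "independent C" "V \<subseteq> span C" "card C = dim V" using basis_exists by blast
  then have "finite C" using independent_span_bound[OF assms(2) C(2)] assms(3) by blast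
  then have "C = {}" using C(4) assms(1) by simp
  then show ?thesis using C(3) by simp
qed

lemma syz_forms_finite_span:
  "\<exists>B. finite B \<and> (syz_forms f c :: (nat \<Rightarrow> ('n::finite, 'k::field) mpoly) set) \<subseteq> fv.span B"
  unfolding syz_forms_def using tuples_finite_span[of "[3, 3, 3]" "c + 3"] by blast

text \<open>A common irreducible factor would be homogeneous of positive degree, and dividing by it
  would leave a syzygy of smaller degree.\<close>

lemma minimal_syzygy_primitive:
  fixes f \<nu> :: "('n::{finite,linorder}, 'k::field) mpoly vec"
  assumes f: "f \<in> carrier_vec 3" and nu: "\<nu> \<in> syzygies f" "\<nu> \<noteq> 0\<^sub>v 3" "vec_form e \<nu>"
    and min: "\<And>w c. w \<in> syzygies f \<Longrightarrow> vec_form c w \<Longrightarrow> w \<noteq> 0\<^sub>v 3 \<Longrightarrow> e \<le> c"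
  shows "primitive (entries3 \<nu>)"
  unfolding primitive_def
proof (intro notI, elim exE conjE)
  fix p assume p: "irreducible p" "\<forall>s\<in>entries3 \<nu>. p dvd s"
  then have "\<forall>i<3. \<exists>y. \<nu> $ i = y * p" by (auto simp: entries3_def dvd_def mult.commute)
  then obtain y where y: "\<And>i. i < 3 \<Longrightarrow> \<nu> $ i = y i * p" by metis
  have nc: "\<nu> \<in> carrier_vec 3" using nu(1) f by (simp add: syzygies_def)
  have nf: "form e (\<nu> $ i)" if "i < 3" for i using nu(3) nc that by (auto simp: vec_form_def)
  obtain k where k: "k < 3" "\<nu> $ k \<noteq> 0"
    using nu(2) nc by (metis carrier_vecD eq_vecI index_zero_vec)
  have p0: "p \<noteq> 0" using p(1) by auto
  have "whom (\<lambda>m. int (mdeg m)) e (p * y k)"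
    using nf[OF k(1)] y[OF k(1)] by (simp add: form_eq_whom mult.commute)
  moreover have "p * y k \<noteq> 0" using k y[OF k(1)] by auto
  ultimately have pf: "form (tdeg p) p" unfolding form_eq_whom by (rule whom_factor[OF tdeg.weight_axioms])
  have yf: "form (e - tdeg p) (y i)" if "i < 3" for i
    using form_factor[of e "y i" p "tdeg p"] nf[OF that] y[OF that] pf p0 by simp
  have "f $ 0 * \<nu> $ 0 + f $ 1 * \<nu> $ 1 + f $ 2 * \<nu> $ 2 = 0"
    using nu(1) scalar_prod_3[OF nc, of f] by (simp add: syzygies_def)
  then have "p * (f $ 0 * y 0 + f $ 1 * y 1 + f $ 2 * y 2) = 0"
    using y[of 0] y[of 1] y[of 2] by (simp add: algebra_simps)
  then have "f $ 0 * y 0 + f $ 1 * y 1 + f $ 2 * y 2 = 0" using p0 by simp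
  then have "vec 3 y \<in> syzygies f" using f scalar_prod_3[of "vec 3 y" f] by (simp add: syzygies_def)
  moreover have "vec_form (e - tdeg p) (vec 3 y)" using yf by (auto simp: vec_form_def)
  moreover have "vec 3 y \<noteq> 0\<^sub>v 3"
  proof
    assume "vec 3 y = 0\<^sub>v 3"
    then have "vec 3 y $ k = 0" using k by simp
    then show False using k y[OF k(1)] by simp
  qed
  ultimately have "e \<le> e - tdeg p" by (rule min)
  then show False using tdeg_irreducible_pos[OF p(1)] by simp
qed

text \<open>Rank and nullity of \<open>phi\<close> in one degree: the kernel consists of the
  multiples of \<nu>, a copy of the ring shifted by \<open>e\<close>.\<close>

lemma (in bourbaki_setup) dim_bideal:
  assumes "d = 3"
  shows "fv.dim (syz_forms f c) = rdim TYPE(('n, 'k) mpoly) (c - e) + kv.dim {p \<in> bideal. form (c + e - 3) p}"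
proof -
  let ?T = "\<lambda>v. phi (vec 3 v)"
  have sub: "fv.subspace (syz_forms f c)"
    using subspace_tuples[of "[3, 3, 3]" "c + 3", where 'n='n and 'k='k]
    by (auto simp: fv.subspace_def syz_forms_def act_add act_scale act_def[of _ "\<lambda>_. 0"] zero_fun_def)
  have ker: "{v \<in> syz_forms f c. ?T v = 0} = (\<lambda>r j. if j < 3 then r * \<nu> $ j else 0) ` forms (c - e)"
  proof safe
    fix v assume v: "v \<in> syz_forms f c" "?T v = 0"
    then obtain r where r: "vec 3 v = r \<cdot>\<^sub>v \<nu>" using phi_kernel vec_in_syzygies[OF f(1)] by blast
    have vj: "v j = r * \<nu> $ j" if "j < 3" for j
      using arg_cong[OF r, of "\<lambda>w. w $ j"] that nu_carrier by simp
    obtain k where k: "k < 3" "\<nu> $ k \<noteq> 0" using primitive_neq_0[OF nu(3)] by blast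
    have "form c (v k)" using v(1) k(1) by (auto simp: syz_forms_iff numeral_3_eq_3 less_Suc_eq numeral_2_eq_2)
    then have "form (c - e) r" using form_factor[of c r "\<nu> $ k" e] vj[OF k(1)] nu(2) k by simp
    moreover have "v = (\<lambda>j. if j < 3 then r * \<nu> $ j else 0)"
      using vj v(1) by (auto simp: fun_eq_iff syz_forms_iff)
    ultimately show "v \<in> (\<lambda>r j. if j < 3 then r * \<nu> $ j else 0) ` forms (c - e)" by (auto simp: forms_def)
  next
    fix r :: "('n, 'k) mpoly" assume r: "r \<in> forms (c - e)"
    have rn: "r \<cdot>\<^sub>v \<nu> \<in> syzygies f" using syz_smult nu(1) by blast
    have e1: "vec 3 (\<lambda>j. if j < 3 then r * \<nu> $ j else 0) = r \<cdot>\<^sub>v \<nu>"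
      using nu_carrier by (intro eq_vecI) auto
    have "vec_form c (r \<cdot>\<^sub>v \<nu>)"
      using r nu(2) nu_carrier form_mult[of "c - e" r e] by (auto simp: vec_form_def forms_def)
    moreover have "(\<lambda>j. if j < 3 then (r \<cdot>\<^sub>v \<nu>) $ j else 0) = (\<lambda>j. if j < 3 then r * \<nu> $ j else 0)"
      using nu_carrier by (auto simp: fun_eq_iff)
    ultimately show "(\<lambda>j. if j < 3 then r * \<nu> $ j else 0) \<in> syz_forms f c"
      using syzygy_function(1)[OF f(1) rn, of c] by simp
    show "?T (\<lambda>j. if j < 3 then r * \<nu> $ j else 0) = 0"
      unfolding e1 using phi_kernel[OF rn] by blast
  qed
  have im: "?T ` syz_forms f c = {p \<in> bideal. form (c + e - 3) p}"
  proof safe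
    fix v assume v: "v \<in> syz_forms f c"
    show "?T v \<in> bideal" using vec_in_syzygies[OF f(1) v] by (auto simp: bideal_def)
    show "form (c + e - 3) (?T v)" using form_phi[OF vec_in_syzygies[OF f(1) v]] assms by simp
  next
    fix p assume p: "p \<in> bideal" "form (c + e - 3) p"
    then obtain w where w: "w \<in> syzygies f" "p = phi w" by (auto simp: bideal_def)
    have "phi (vcomp c w) = p" using phi_vcomp[OF w(1), of c] p(2) w(2) assms hcomp_form[OF p(2)] by simp
    moreover note syzygy_function[OF f(1) vcomp_syz[OF w(1), of c] vec_form_vcomp[of c w]]
    ultimately show "p \<in> ?T ` syz_forms f c" by (metis (no_types, lifting) imageI)
  qed
  obtain K where K: "finite K" "{v \<in> syz_forms f c. ?T v = 0} \<subseteq> fv.span K"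
    using syz_forms_finite_span[of f c] by blast
  obtain D where D: "finite D" "?T ` syz_forms f c \<subseteq> kv.span D"
    unfolding im using forms_finite_span[of "c + e - 3"] unfolding forms_def by blast
  have vadd: "vec 3 (x + y) = vec 3 x + vec 3 y" and vsc: "vec 3 (\<lambda>i. r * x i) = r \<cdot>\<^sub>v vec 3 x"
    for x y :: "nat \<Rightarrow> ('n, 'k) mpoly" and r
    by (auto intro: eq_vecI)
  have "fv.dim (syz_forms f c) = fv.dim {v \<in> syz_forms f c. ?T v = 0} + kv.dim (?T ` syz_forms f c)"
    by (rule fm.rank_nullity_on(2)[OF sub _ _ K D])
      (use vec_in_syzygies[OF f(1)] in \<open>auto simp: vadd vsc phi_add phi_smult\<close>)
  moreover have "fv.dim {v \<in> syz_forms f c. ?T v = 0} = rdim TYPE(('n, 'k) mpoly) (c - e)"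
  proof -
    let ?S = "\<lambda>r j. if j < (3::nat) then r * \<nu> $ j else 0"
    have inj: "{r \<in> forms (c - e). ?S r = 0} = {0}"
    proof safe
      fix r assume r: "?S r = 0"
      obtain k where k: "k < 3" "\<nu> $ k \<noteq> 0" using primitive_neq_0[OF nu(3)] by blast
      have "?S r k = 0" using fun_cong[OF r, of k] by simp
      then show "r = 0" using k by simp
    qed (auto simp: forms_def fun_eq_iff)
    have "?S ` forms (c - e) \<subseteq> syz_forms f c" unfolding ker[symmetric] by blast
    then obtain D where D: "finite D" "?S ` forms (c - e) \<subseteq> fv.span D"
      using syz_forms_finite_span[of f c] by blast
    have "kv.dim (forms (c - e) :: ('n, 'k) mpoly set) = kv.dim {r \<in> forms (c - e). ?S r = 0} + fv.dim (?S ` forms (c - e))"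
      by (rule mf.rank_nullity_on(2)[OF subspace_forms _ _ _ _ D, of "{}"])
        (use inj in \<open>auto simp: fun_eq_iff distrib_right mult.assoc\<close>)
    moreover have "kv.dim ({0} :: ('n, 'k) mpoly set) = 0" using kv.dim_le_card[of "{0}" "{}"] by simp
    ultimately show ?thesis unfolding ker inj rdim_def by simp
  qed
  ultimately show ?thesis unfolding im by simp
qed

section \<open>The numerical conditions on the resolution\<close>

lemma lookup_mult_0: "lookup (p * q) 0 = lookup p 0 * lookup q 0"
  for p q :: "('n::{finite,linorder}, 'k::idom) mpoly"
proof -
  have h: "lookup (hcomp 0 s) 0 = lookup s 0" for s :: "('n, 'k) mpoly" by (simp add: lookup_wcomp)
  have c: "hcomp 0 s = Const (lookup s 0)" for s :: "('n, 'k) mpoly"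
    using form_0_Const[OF form_hcomp[of 0 s]] h by simp
  have "hcomp (0 + 0) (p * q) = hcomp 0 p * hcomp 0 q" by (rule tdeg.wcomp_mult_bot) auto
  then have "lookup (p * q) 0 = lookup (Const (lookup p 0) * Const (lookup q 0) :: ('n, 'k) mpoly) 0" using h[of "p * q"] c by simp
  then show ?thesis by (simp add: mult_single)
qed

lemma hilbert_fun_int:
  fixes I :: "('n::{finite,linorder}, 'k::field) mpoly set"
  shows "int (hilbert_fun I i) = int (rdim TYPE(('n, 'k) mpoly) (int i)) - int (kv.dim {p \<in> I. form (int i) p})"
proof -
  obtain B where B: "finite B" "(forms (int i) :: ('n, 'k) mpoly set) \<subseteq> kv.span B" using forms_finite_span by blast
  have "kv.dim {p \<in> I. form (int i) p} \<le> rdim TYPE(('n, 'k) mpoly) (int i)"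
    unfolding rdim_def by (rule kv.dim_subset_finite[OF _ B]) (auto simp: forms_def)
  then show ?thesis by (simp add: hilbert_fun_def rdim_def forms_def of_nat_diff)
qed

text \<open>The definition of a Bourbaki ideal leaves the degree of the generators open. All
  monomials of elements of \<open>J\<close> have degree at least \<open>c\<close>, while
  \<open>g $ 0\<close> is a nonzero form of degree \<open>d\<close> in \<open>J\<close>.\<close>

lemma min_gens_degree_unique:
  fixes J :: "('n::finite, 'k::comm_ring_1) mpoly set"
  assumes "f \<in> carrier_vec 3" "min_gens c J f" "g \<in> carrier_vec 3" "min_gens d J g"
  shows "c \<le> d"
proof -
  let ?U = "{p :: ('n, 'k) mpoly. \<forall>m\<in>keys p. c \<le> int (mdeg m)}"
  have "is_ideal ?U" unfolding is_ideal_iff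
  proof (intro conjI ballI allI)
    fix x y assume xy: "x \<in> ?U" "y \<in> ?U"
    show "x + y \<in> ?U"
    proof safe
      fix m assume "m \<in> keys (x + y)"
      then have "m \<in> keys x \<or> m \<in> keys y" using Poly_Mapping.keys_add[of x y] by blast
      then show "c \<le> int (mdeg m)" using xy by blast
    qed
  next
    fix r x assume x: "x \<in> ?U"
    show "r * x \<in> ?U"
    proof safe
      fix m assume "m \<in> keys (r * x)"
      then obtain a b where "m = a + b" "b \<in> keys x" using keys_mult[of r x] by blast
      then show "c \<le> int (mdeg m)" using x by (force simp: mdeg_add)
    qed
  qed simp
  moreover have "set\<^sub>v f \<subseteq> ?U" using assms(1,2) unfolding set_vec_3[OF assms(1)]
    by (auto simp: min_gens_def form_def all_less_3)
  ultimately have "J \<subseteq> ?U" using assms(2) ideal.span_minimal[of "set\<^sub>v f" ?U] by (simp add: min_gens_def)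
  moreover have "g $ 0 \<in> J" using assms(3,4) ideal.span_superset[of "set\<^sub>v g"]
    unfolding min_gens_def set_vec_3[OF assms(3)] by blast
  ultimately have gU: "g $ 0 \<in> ?U" by blast
  have "0 < dim_vec g" using assms(3) by auto
  then have "g $ 0 \<notin> ideal_gen {g $ j | j. j < dim_vec g \<and> j \<noteq> 0}"
    by (rule assms(4)[unfolded min_gens_def, THEN conjunct2, THEN conjunct2, rule_format])
  then have "g $ 0 \<noteq> 0" by (rule contrapos_nn) (simp only: ideal.span_zero)
  then obtain m where m: "m \<in> keys (g $ 0)" using keys_empty_iff[of "g $ 0"] by blast
  have "form d (g $ 0)" using assms(3,4) by (auto simp: min_gens_def)
  then show ?thesis using m gU by (auto simp: form_def)
qed

text \<open>Two generating vectors occur: \<open>f\<close> is read off the first map of the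
  resolution, and \<open>g\<close> comes from the assumption of minimal generation.\<close>

locale cubic_resolution =
  fixes J :: "('n::{finite,linorder}, 'k::field_char_0) mpoly set" and f g :: "('n, 'k) mpoly vec"
    and M1 M2 :: "('n, 'k) mpoly mat" and d1 d2 d3 d4 e1 e2 :: int
  assumes card_n: "3 \<le> CARD('n)"
    and f: "f \<in> carrier_vec 3" "\<forall>i<3. form 3 (f $ i)"
    and g: "g \<in> carrier_vec 3" "min_gens 3 J g"
    and J: "J = ideal_gen (set\<^sub>v f)" "height J = 2"
    and res: "graded_free_resolution J [[3, 3, 3], [3 + d1, 3 + d2, 3 + d3, 3 + d4], [3 + d3 + e1, 3 + d4 + e2]] [row_mat f, M1, M2]"
    and minimal: "\<forall>p\<in>elements_mat M2. lookup p 0 = 0"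
    and ineqs: "1 \<le> d1" "d1 \<le> d2" "d2 \<le> d3" "d3 \<le> d4" "0 < e1" "0 < e2" "d3 + e1 \<le> d4 + e2"
begin

lemma primitive_J: "primitive J"
  using primitive_if_height_2[OF J(2)] .

lemma primitive_gens:
  assumes "h \<in> carrier_vec 3" "J = ideal_gen (set\<^sub>v h)" shows "primitive (entries3 h)"
  using primitive_ideal_gen[of "set\<^sub>v h", folded assms(2), OF primitive_J]
  unfolding set_vec_3[OF assms(1)] entries3_eq .

lemma dim_syz_forms_f:
  "int (fv.dim (syz_forms f c)) = int (rdim TYPE(('n, 'k) mpoly) (c - d1)) + int (rdim TYPE(('n, 'k) mpoly) (c - d2)) + int (rdim TYPE(('n, 'k) mpoly) (c - d3)) + int (rdim TYPE(('n, 'k) mpoly) (c - d4))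
     - int (rdim TYPE(('n, 'k) mpoly) (c - d3 - e1)) - int (rdim TYPE(('n, 'k) mpoly) (c - d4 - e2))"
  using dim_syzygies_resolution[OF res, of "c + 3"] unfolding syz_forms_def by (simp add: algebra_simps)

lemma dim_syz_forms_J:
  assumes "h \<in> carrier_vec 3" "\<forall>i<3. form 3 (h $ i)" "J = ideal_gen (set\<^sub>v h)"
  shows "int (fv.dim (syz_forms h c)) = 3 * int (rdim TYPE(('n, 'k) mpoly) c) - int (kv.dim {p \<in> J. form (c + 3) p})"
  using dim_row_ideal[OF graded_row_mat[OF assms(2)], of "c + 3"] row_ideal_row_mat[OF assms(1)] assms(3)
  unfolding syz_forms_def by simp

text \<open>The dimension depends only on \<open>J\<close>, so the twists of the resolution describe
  the syzygies of every vector \<open>h\<close> of cubic generators from which a Bourbaki ideal may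
  be formed.\<close>

lemma dim_syz_forms:
  assumes "h \<in> carrier_vec 3" "\<forall>i<3. form 3 (h $ i)" "J = ideal_gen (set\<^sub>v h)"
  shows "int (fv.dim (syz_forms h c)) = int (rdim TYPE(('n, 'k) mpoly) (c - d1)) + int (rdim TYPE(('n, 'k) mpoly) (c - d2)) + int (rdim TYPE(('n, 'k) mpoly) (c - d3)) + int (rdim TYPE(('n, 'k) mpoly) (c - d4))
     - int (rdim TYPE(('n, 'k) mpoly) (c - d3 - e1)) - int (rdim TYPE(('n, 'k) mpoly) (c - d4 - e2))"
  using dim_syz_forms_J[OF assms, of c] dim_syz_forms_J[OF f J(1), of c] dim_syz_forms_f[of c] by simp

text \<open>The numerator of the Hilbert series of \<open>R/J\<close>.\<close>

definition csJ :: "(int \<times> int) list" where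
  "csJ = [(1, 0), (-3, 3), (1, 3 + d1), (1, 3 + d2), (1, 3 + d3), (1, 3 + d4), (-1, 3 + d3 + e1), (-1, 3 + d4 + e2)]"

lemma hilbert_fun_J: "int (hilbert_fun J i) = (\<Sum>(c, a)\<leftarrow>csJ. c * int (rdim TYPE(('n, 'k) mpoly) (int i - a)))"
  using hilbert_fun_int[of J i] dim_syz_forms_J[OF f J(1), of "int i - 3"] dim_syz_forms_f[of "int i - 3"]
  by (simp add: csJ_def algebra_simps)

lemma of_int_sum_csx: "(of_int (\<Sum>(c, a)\<leftarrow>cs. c * int (rdim TYPE(('n, 'k) mpoly) (int i - a))) :: 'b::field_char_0) =
    (\<Sum>(c, a)\<leftarrow>cs. of_int c * of_nat (rdim TYPE(('n, 'k) mpoly) (int i - a)))"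
  by (induction cs) auto

lemma card_n': "CARD('n) = Suc (Suc (Suc (CARD('n) - 3)))"
  using card_n by simp

lemma moment_0_csJ: "moment 0 csJ = 0"
  by (simp add: moment_def csJ_def)

text \<open>The comparison list is the numerator (1 - t^3)^2 of a complete intersection of two
  cubics.\<close>

lemma moment_1_csJ: "moment 1 csJ = 0"
proof (rule moment_1_zero[OF card_n', where 'k='k and ds = "[(1, 0), (-2, 3), (1, 6)]"])
  fix i
  show "0 \<le> (\<Sum>(c, a)\<leftarrow>csJ. real_of_int c * real (rdim TYPE(('n, 'k) mpoly) (int i - a)))"
    unfolding of_int_sum_csx[symmetric] hilbert_fun_J[symmetric] by simp
  have "int (hilbert_fun J i) \<le> int (rdim TYPE(('n, 'k) mpoly) (int i)) - 2 * int (rdim TYPE(('n, 'k) mpoly) (int i - 3)) + int (rdim TYPE(('n, 'k) mpoly) (int i - 6))"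
    using hilbert_fun_int[of J i] ideal_forms_dim_ge[OF g primitive_J, of "int i"] by simp
  then have "real_of_int (int (hilbert_fun J i)) \<le> real_of_int (int (rdim TYPE(('n, 'k) mpoly) (int i)) - 2 * int (rdim TYPE(('n, 'k) mpoly) (int i - 3)) + int (rdim TYPE(('n, 'k) mpoly) (int i - 6)))"
    by (simp only: of_int_le_iff)
  then show "(\<Sum>(c, a)\<leftarrow>csJ. real_of_int c * real (rdim TYPE(('n, 'k) mpoly) (int i - a))) \<le> (\<Sum>(c, a)\<leftarrow>[(1, 0), (-2, 3), (1, 6)]. real_of_int c * real (rdim TYPE(('n, 'k) mpoly) (int i - a)))"
    unfolding of_int_sum_csx[symmetric] hilbert_fun_J[symmetric] by simp
qed (auto simp: moment_0_csJ, auto simp: moment_def)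

text \<open>In the first moment of \<open>csJ\<close> the terms \<open>d3\<close> and
  \<open>d4\<close> cancel, and \<open>d1 + d2 - 3 - e1 - e2\<close> remains.\<close>

lemma d_sum: "d1 + d2 = 3 + e1 + e2"
  using moment_1_csJ by (simp add: moment_def csJ_def)

section \<open>The generating syzygies and their relations\<close>

lemma graded: "graded_map [3, 3, 3] [3 + d1, 3 + d2, 3 + d3, 3 + d4] M1"
  "graded_map [3 + d1, 3 + d2, 3 + d3, 3 + d4] [3 + d3 + e1, 3 + d4 + e2] M2"
  and exact: "syzygies f = mat_image M1" "mat_kernel M1 = mat_image M2" "mat_kernel M2 = {0\<^sub>v (dim_col M2)}"
  using res kernel_row_mat[OF f(1)] by (auto simp: graded_free_resolution_def all_less_3 numeral_2_eq_2)

lemma dims: "M1 \<in> carrier_mat 3 4" "M2 \<in> carrier_mat 4 2"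
  using graded by (auto simp: graded_map_def)

abbreviation \<eta> :: "nat \<Rightarrow> ('n, 'k) mpoly vec" where
  "\<eta> j \<equiv> col M1 j"

lemma mult_M1: "u \<in> carrier_vec 4 \<Longrightarrow> M1 *\<^sub>v u = u $ 0 \<cdot>\<^sub>v \<eta> 0 + (u $ 1 \<cdot>\<^sub>v \<eta> 1 + (u $ 2 \<cdot>\<^sub>v \<eta> 2 + u $ 3 \<cdot>\<^sub>v \<eta> 3))"
proof (rule eq_vecI)
  assume u: "u \<in> carrier_vec 4"
  let ?w = "u $ 0 \<cdot>\<^sub>v \<eta> 0 + (u $ 1 \<cdot>\<^sub>v \<eta> 1 + (u $ 2 \<cdot>\<^sub>v \<eta> 2 + u $ 3 \<cdot>\<^sub>v \<eta> 3))"
  fix i assume "i < dim_vec ?w"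
  then have i: "i < 3" using dims(1) by simp
  have "{0..<4} = {0, 1, 2, 3 :: nat}" by auto
  then have "(M1 *\<^sub>v u) $ i = M1 $$ (i, 0) * u $ 0 + (M1 $$ (i, 1) * u $ 1 + (M1 $$ (i, 2) * u $ 2 + M1 $$ (i, 3) * u $ 3))"
    using u i dims(1) by (simp add: scalar_prod_def)
  then show "(M1 *\<^sub>v u) $ i = ?w $ i" using i dims(1) by (simp add: mult.commute)
qed (use dims(1) in simp)

lemma eta_unit: "j < 4 \<Longrightarrow> M1 *\<^sub>v unit_vec 4 j = \<eta> j"
  using dims(1) by (intro eq_vecI) auto

lemma eta_syz: "j < 4 \<Longrightarrow> \<eta> j \<in> syzygies f"
  unfolding exact(1) mat_image_def using dims(1) eta_unit[of j] by (auto intro!: exI[of _ "unit_vec 4 j"])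

lemma eta_form:
  "vec_form d1 (\<eta> 0)" "vec_form d2 (\<eta> 1)" "vec_form d3 (\<eta> 2)" "vec_form d4 (\<eta> 3)"
  using graded(1) by (auto simp: graded_map_def vec_form_def numeral_eq_Suc less_Suc_eq)

text \<open>Minimality of the resolution in usable form: no relation among the columns of
  \<open>M1\<close> has a coefficient with a constant term, so no column is redundant.\<close>

lemma kernel_M1_const: 
  assumes "u \<in> mat_kernel M1" "j < 4" shows "lookup (u $ j) 0 = 0"
proof -
  obtain y where y: "y \<in> carrier_vec 2" "u = M2 *\<^sub>v y"
    using assms(1) dims(2) unfolding exact(2) mat_image_def by auto
  have "lookup (M2 $$ (j, l)) 0 = 0" if "l < 2" for l
    using minimal elements_matI[OF dims(2) assms(2) that refl] by blast
  then show ?thesis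
    using y dims(2) assms(2) by (auto simp: scalar_prod_def lookup_sum lookup_mult_0 intro!: sum.neutral)
qed

lemma eta_0_neq_0: "\<eta> 0 \<noteq> 0\<^sub>v 3"
proof
  assume "\<eta> 0 = 0\<^sub>v 3"
  then have "M1 *\<^sub>v unit_vec 4 0 = 0\<^sub>v 3" using eta_unit[of 0] by simp
  then have "unit_vec 4 0 \<in> mat_kernel M1" using dims(1) by (auto simp: mat_kernel_def)
  from kernel_M1_const[OF this, of 0] show False by simp
qed

lemma homogeneous_syzygy:
  assumes "w \<in> syzygies f" "vec_form c w"
  obtains u where "u \<in> carrier_vec 4" "w = M1 *\<^sub>v u" "form (c - d1) (u $ 0)" "form (c - d2) (u $ 1)"
    "form (c - d3) (u $ 2)" "form (c - d4) (u $ 3)"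
proof -
  let ?a1 = "[3 + d1, 3 + d2, 3 + d3, 3 + d4]"
  obtain u0 where u0': "u0 \<in> carrier_vec 4" "w = M1 *\<^sub>v u0"
    using assms(1) dims(1) unfolding exact(1) mat_image_def by auto
  moreover have "length ?a1 = 4" by simp
  ultimately have u0: "u0 \<in> carrier_vec (length ?a1)" "w = M1 *\<^sub>v u0" by (simp_all only:)
  have wd: "dim_vec w = 3" using assms(1) f(1) by (auto simp: syzygies_def)
  have "form (c + 3 - [3, 3, 3] ! i) ((M1 *\<^sub>v u0) $ i)" if "i < length [3, 3, 3 :: int]" for i
  proof -
    have "[3, 3, 3 :: int] ! i = 3" using that by (auto simp: less_Suc_eq)
    then show ?thesis using that assms(2) wd unfolding u0(2)[symmetric] by (auto simp: vec_form_def)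
  qed
  from act_homogeneous_part[OF graded(1) u0(1) this]
  obtain v where v: "v \<in> tuples ?a1 (c + 3)" "\<forall>i<length [3, 3, 3 :: int]. act M1 v i = w $ i"
    unfolding u0(2)[symmetric] by blast
  have "M1 *\<^sub>v vec 4 v = w"
    using mult_vec_act[of M1 v] dims(1) v(2) wd by (intro eq_vecI) auto
  moreover have "\<forall>j<4. form (c + 3 - ?a1 ! j) (v j)" using v(1) by (auto simp: tuples_def)
  from this[rule_format, of 0] this[rule_format, of 1] this[rule_format, of 2] this[rule_format, of 3]
  have "form (c - d1) (v 0)" "form (c - d2) (v 1)" "form (c - d3) (v 2)" "form (c - d4) (v 3)" by auto
  ultimately show thesis using that[of "vec 4 v"] by simp
qed

lemma min_degree_f:
  assumes "w \<in> syzygies f" "vec_form c w" "w \<noteq> 0\<^sub>v 3" shows "d1 \<le> c"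
proof (rule ccontr)
  assume "\<not> d1 \<le> c"
  then have neg: "c - d1 < 0" "c - d2 < 0" "c - d3 < 0" "c - d4 < 0" using ineqs by auto
  obtain u where u: "u \<in> carrier_vec 4" "w = M1 *\<^sub>v u" "form (c - d1) (u $ 0)" "form (c - d2) (u $ 1)"
    "form (c - d3) (u $ 2)" "form (c - d4) (u $ 3)" using homogeneous_syzygy[OF assms(1,2)] by blast
  have "u $ 0 = 0" "u $ 1 = 0" "u $ 2 = 0" "u $ 3 = 0"
    using form_neg[OF u(3) neg(1)] form_neg[OF u(4) neg(2)] form_neg[OF u(5) neg(3)] form_neg[OF u(6) neg(4)] by auto
  then have "w = 0\<^sub>v 3" using mult_M1[OF u(1)] u(2) dims(1) by (intro eq_vecI) auto
  then show False using assms(3) by simp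
qed

section \<open>Degrees forced by divisibility\<close>

sublocale b0: bourbaki_setup f "\<eta> 0" 3 d1
proof
  show "f \<in> carrier_vec 3" "\<forall>i<3. form 3 (f $ i)" by (rule f)+
  show "primitive (entries3 f)" by (rule primitive_gens[OF f(1) J(1)])
  show nu: "\<eta> 0 \<in> syzygies f" using eta_syz by simp
  show "\<forall>i<3. form d1 (\<eta> 0 $ i)" using eta_form(1) dims(1) by (auto simp: vec_form_def)
  show "primitive (entries3 (\<eta> 0))"
    by (rule minimal_syzygy_primitive[OF f(1) nu eta_0_neq_0 eta_form(1)]) (use min_degree_f in blast)
qed

abbreviation G :: "nat \<Rightarrow> ('n, 'k) mpoly" where
  "G j \<equiv> b0.phi (\<eta> j)"

lemma phi_eta_0: "G 0 = 0"
  using b0.phi_kernel[OF b0.nu(1)] by (metis one_smult_vec)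

lemma phi_M1:
  assumes "u \<in> carrier_vec 4" shows "b0.phi (M1 *\<^sub>v u) = u $ 1 * G 1 + (u $ 2 * G 2 + u $ 3 * G 3)"
proof -
  have e: "\<eta> 0 \<in> syzygies f" "\<eta> 1 \<in> syzygies f" "\<eta> 2 \<in> syzygies f" "\<eta> 3 \<in> syzygies f" using eta_syz by auto
  have "u $ 0 \<cdot>\<^sub>v \<eta> 0 \<in> syzygies f" "u $ 1 \<cdot>\<^sub>v \<eta> 1 \<in> syzygies f" "u $ 2 \<cdot>\<^sub>v \<eta> 2 \<in> syzygies f" "u $ 3 \<cdot>\<^sub>v \<eta> 3 \<in> syzygies f"
    by (rule b0.syz_smult, rule e)+
  then show ?thesis
    unfolding mult_M1[OF assms] by (simp only: b0.phi_add b0.syz_add b0.phi_smult[OF e(1)] b0.phi_smult[OF e(2)] b0.phi_smult[OF e(3)] b0.phi_smult[OF e(4)] phi_eta_0) simp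
qed

lemma nu_combination:
  assumes "i < 3"
  obtains u where "\<eta> 0 $ i = u $ 1 * G 1 + (u $ 2 * G 2 + u $ 3 * G 3)"
    "form (3 - d2) (u $ 1)" "form (3 - d3) (u $ 2)" "form (3 - d4) (u $ 3)"
proof -
  have vf: "vec_form 3 (vec3 0 (f $ 2) (- f $ 1))" "vec_form 3 (vec3 (- f $ 2) 0 (f $ 0))" "vec_form 3 (vec3 (f $ 1) (- f $ 0) 0)"
    using f(2) whom_uminus[of _ 3] unfolding vec_form_def vec3_simps all_less_3 by (auto simp: form_eq_whom)
  have "\<forall>i<3. \<exists>w\<in>syzygies f. vec_form 3 w \<and> b0.phi w = \<eta> 0 $ i"
    unfolding all_less_3 using b0.phi_koszul vf by blast
  then obtain w where w: "w \<in> syzygies f" "vec_form 3 w" "b0.phi w = \<eta> 0 $ i" using assms by blast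
  obtain u where u: "u \<in> carrier_vec 4" "w = M1 *\<^sub>v u" "form (3 - d1) (u $ 0)" "form (3 - d2) (u $ 1)"
    "form (3 - d3) (u $ 2)" "form (3 - d4) (u $ 3)" using homogeneous_syzygy[OF w(1,2)] by blast
  then show thesis using that[of u] phi_M1[OF u(1)] w(3) by simp
qed

lemma d2_le_3: "d2 \<le> 3"
proof (rule ccontr)
  assume "\<not> d2 \<le> 3"
  then have neg: "3 - d2 < 0" "3 - d3 < 0" "3 - d4 < 0" using ineqs by auto
  have "\<eta> 0 $ i = 0" if "i < 3" for i
    using nu_combination[OF that] form_neg neg by (metis add_0 mult_zero_left)
  then show False using b0.primitive_neq_0[OF b0.nu(3)] by blast
qed

text \<open>By \<open>d_sum\<close> the sum \<open>d1 + d2\<close> is at least 5, while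
  \<open>d1 \<le> d2 \<le> 3\<close>.\<close>

lemma d12: "d1 = 2 \<or> d1 = 3" "d2 = 3"
  using d2_le_3 d_sum ineqs by auto

lemma G_form: "form (d2 + d1 - 3) (G 1)" "form (d3 + d1 - 3) (G 2)"
  using b0.form_phi[OF eta_syz eta_form(2)] b0.form_phi[OF eta_syz eta_form(3)] by auto

text \<open>Otherwise \<open>\<eta> 1\<close> would be a multiple of \<open>\<eta> 0\<close>, a
  relation with the constant coefficient -1.\<close>

lemma G1_neq_0: "G 1 \<noteq> 0"
proof
  assume "G 1 = 0"
  then obtain s where s: "\<eta> 1 = s \<cdot>\<^sub>v \<eta> 0" using b0.phi_kernel[OF eta_syz[of 1]] by auto
  define u where "u = vec 4 (\<lambda>i. if i = 0 then s else if i = 1 then - 1 else (0 :: ('n, 'k) mpoly))"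
  have "M1 *\<^sub>v u = u $ 0 \<cdot>\<^sub>v \<eta> 0 + (u $ 1 \<cdot>\<^sub>v \<eta> 1 + (u $ 2 \<cdot>\<^sub>v \<eta> 2 + u $ 3 \<cdot>\<^sub>v \<eta> 3))"
    by (rule mult_M1) (simp add: u_def)
  also have "\<dots> = 0\<^sub>v 3" unfolding s using dims(1) by (intro eq_vecI) (auto simp: u_def)
  finally have "u \<in> mat_kernel M1" using dims(1) by (auto simp: mat_kernel_def u_def)
  from kernel_M1_const[OF this, of 1] show False by (simp add: u_def lookup_one)
qed

lemma G1_dvd:
  assumes "\<And>i. i < 3 \<Longrightarrow> G 1 dvd a * \<eta> 0 $ i" shows "G 1 dvd a"
  by (rule primitive_dvd[OF b0.nu(3) G1_neq_0]) (use assms in \<open>auto simp: entries3_def\<close>)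

lemma tdeg_G1: "tdeg (G 1) = d1"
  using form_tdeg[OF G_form(1) G1_neq_0] d12 by simp

lemma d3_eq: "d3 = 3"
proof (rule ccontr)
  assume "d3 \<noteq> 3"
  then have neg: "3 - d3 < 0" "3 - d4 < 0" using ineqs d12 by auto
  have "G 1 dvd 1 * \<eta> 0 $ i" if "i < 3" for i
    using nu_combination[OF that] form_neg neg by (metis add_0_right dvd_triv_right mult_1_left mult_zero_left)
  then have "G 1 dvd 1" by (rule G1_dvd)
  then show False using is_unit_iff_tdeg[of "G 1"] tdeg_G1 d12 by auto
qed

lemma M2_form: "form (3 + d3 + e1 - (3 + d1)) (M2 $$ (0, 0))" "form (3 + d3 + e1 - (3 + d2)) (M2 $$ (1, 0))"
  "form (3 + d3 + e1 - (3 + d3)) (M2 $$ (2, 0))" "form (3 + d3 + e1 - (3 + d4)) (M2 $$ (3, 0))"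
  using graded(2) by (auto simp: graded_map_def numeral_eq_Suc less_Suc_eq)

text \<open>For larger \<open>d4\<close> the first column of \<open>M2\<close> would be a relation
  that does not involve \<open>\<eta> 3\<close>. Divisibility by \<open>G 1\<close> kills its
  coefficients one after the other, contrary to the injectivity of \<open>M2\<close>.\<close>

lemma d4_less: "d4 < 3 + e1"
proof (rule ccontr)
  assume "\<not> d4 < 3 + e1"
  then have d4: "3 + e1 \<le> d4" by simp
  \<comment> \<open>Since \<open>d2 = 3\<close>, the equation \<open>d_sum\<close> reads
    \<open>d1 = e1 + e2\<close>.\<close>
  have e1: "e1 < d1" using d_sum d12 ineqs by auto
  define A where "A = col M2 0"
  have A: "A \<in> carrier_vec 4" "\<And>j. j < 4 \<Longrightarrow> A $ j = M2 $$ (j, 0)" using dims(2) by (auto simp: A_def intro!: carrier_vecI)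
  have Au: "A = M2 *\<^sub>v unit_vec 2 0" using dims(2) by (intro eq_vecI) (auto simp: A_def)
  then have "A \<in> mat_kernel M1" unfolding exact(2) mat_image_def using dims(2) by auto
  then have MA: "M1 *\<^sub>v A = 0\<^sub>v 3" using dims(1) by (auto simp: mat_kernel_def)
  have "lookup (A $ 3) 0 = 0" by (rule kernel_M1_const[OF \<open>A \<in> mat_kernel M1\<close>]) simp
  \<comment> \<open>This coefficient has degree \<open>3 + e1 - d4\<close>, which is at most 0, and
    in degree 0 it would be a constant term.\<close>
  have A3: "A $ 3 = 0"
  proof (cases "3 + e1 < d4")
    case True
    then show ?thesis using form_neg[OF M2_form(4)] A(2)[of 3] d3_eq by simp
  next
    case False
    then have deg: "3 + d3 + e1 - (3 + d4) = 0" using d3_eq d4 by simp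
    have "form 0 (A $ 3)" using M2_form(4) A(2)[of 3] unfolding deg by simp
    then show ?thesis using form_0_Const[of "A $ 3"] \<open>lookup (A $ 3) 0 = 0\<close> by simp
  qed
  have rel: "A $ 1 * G 1 + A $ 2 * G 2 = 0"
  proof -
    have "b0.phi (0\<^sub>v 3) = 0" by (rule b0.phi_eqI) (simp add: b0.is_phi_def)
    then show ?thesis using phi_M1[OF A(1)] A3 unfolding MA by simp
  qed
  \<comment> \<open>As \<open>3 - d4 < 0\<close>, only \<open>G 1\<close> and \<open>G 2\<close>
    contribute to the entries of \<open>\<eta> 0\<close>, and \<open>rel\<close> turns
    \<open>A $ 2 * G 2\<close> into a multiple of \<open>G 1\<close>.\<close>
  have "G 1 dvd A $ 2 * \<eta> 0 $ i" if i: "i < 3" for i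
  proof -
    obtain u where u: "\<eta> 0 $ i = u $ 1 * G 1 + (u $ 2 * G 2 + u $ 3 * G 3)" "form (3 - d4) (u $ 3)"
      using nu_combination[OF i] by blast
    have "u $ 3 = 0" using form_neg[OF u(2)] d4 ineqs by simp
    then have "A $ 2 * \<eta> 0 $ i = A $ 2 * (u $ 1 * G 1 + u $ 2 * G 2)" using u(1) by simp
    also have "\<dots> = G 1 * (A $ 2 * u $ 1 - A $ 1 * u $ 2)" using rel by Groebner_Basis.algebra
    finally show ?thesis by simp
  qed
  then have "G 1 dvd A $ 2" by (rule G1_dvd)
  have A2: "A $ 2 = 0"
  proof (rule ccontr)
    assume "A $ 2 \<noteq> 0"
    then have "tdeg (G 1) \<le> tdeg (A $ 2)" using form_dvd_tdeg_le \<open>G 1 dvd A $ 2\<close> by blast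
    moreover have "tdeg (A $ 2) = e1" using form_tdeg[OF M2_form(3)] A(2)[of 2] \<open>A $ 2 \<noteq> 0\<close> by simp
    ultimately show False using tdeg_G1 e1 by simp
  qed
  then have A1: "A $ 1 = 0" using rel G1_neq_0 by simp
  have "A $ 0 \<cdot>\<^sub>v \<eta> 0 = 0\<^sub>v 3"
  proof -
    have "M1 *\<^sub>v A = A $ 0 \<cdot>\<^sub>v \<eta> 0" unfolding mult_M1[OF A(1)] A1 A2 A3 using dims(1) by (intro eq_vecI) auto
    then show ?thesis using MA by simp
  qed
  moreover obtain k where k: "k < 3" "\<eta> 0 $ k \<noteq> 0" using b0.primitive_neq_0[OF b0.nu(3)] by blast
  ultimately have "(A $ 0 \<cdot>\<^sub>v \<eta> 0) $ k = 0" by simp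
  then have A0: "A $ 0 = 0" using k dims(1) by simp
  have "A = 0\<^sub>v 4" using A0 A1 A2 A3 A(1) by (intro eq_vecI) (auto simp: numeral_eq_Suc less_Suc_eq)
  then have "unit_vec 2 0 \<in> mat_kernel M2" using Au dims(2) by (auto simp: mat_kernel_def)
  then have "unit_vec 2 0 = (0\<^sub>v 2 :: ('n, 'k) mpoly vec)" using exact(3) dims(2) by auto
  then have "unit_vec 2 0 $ 0 = (0\<^sub>v 2 :: ('n, 'k) mpoly vec) $ 0" by simp
  then show False by simp
qed

text \<open>What remains is \<open>e1 + e2 = d1\<close> and \<open>3 \<le> d4 < 3 + e1\<close>. For
  \<open>e1 = 2\<close> and \<open>e2 = 1\<close> the ordering of the last twists requires
  \<open>d4 \<ge> 4\<close>.\<close>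

lemma possible_degrees:
  "(d1, d2, d3, d4) = (2, 3, 3, 3) \<and> (e1, e2) = (1, 1) \<or>
   (d1, d2, d3, d4) = (3, 3, 3, 3) \<and> (e1, e2) = (1, 2) \<or>
   (d1, d2, d3, d4) = (3, 3, 3, 4) \<and> (e1, e2) = (2, 1)"
  using d12 d3_eq d4_less d_sum ineqs by auto

text \<open>Half the second moment of \<open>csJ\<close> in the three cases.\<close>

definition mult_J :: int where
  "mult_J = (if d1 = 2 then 4 else if d4 = 3 then 2 else 1)"

lemma quot_multiplicity_J: "quot_multiplicity J = of_int mult_J"
proof (rule quot_multiplicity_eqI[OF card_n'])
  fix i show "rat_of_nat (hilbert_fun J i) = (\<Sum>(c, a)\<leftarrow>csJ. rat_of_int c * rat_of_nat (rdim TYPE(('n, 'k) mpoly) (int i - a)))"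
    unfolding of_int_sum_csx[symmetric] hilbert_fun_J[symmetric] by simp
  show "moment 2 csJ = 2 * mult_J"
    using possible_degrees by (auto simp: moment_def csJ_def mult_J_def)
qed (rule moment_0_csJ, rule moment_1_csJ, simp add: mult_J_def)

section \<open>Independence of the generators\<close>

lemma min_degree:
  assumes "h \<in> carrier_vec 3" "\<forall>i<3. form 3 (h $ i)" "J = ideal_gen (set\<^sub>v h)"
    and w: "w \<in> syzygies h" "vec_form c w" "w \<noteq> 0\<^sub>v 3"
  shows "d1 \<le> c"
proof (rule ccontr)
  assume "\<not> d1 \<le> c"
  then have neg: "c - d1 < 0" "c - d2 < 0" "c - d3 < 0" "c - d4 < 0" "c - d3 - e1 < 0" "c - d4 - e2 < 0"
    using ineqs by auto
  have "fv.dim (syz_forms h c) = 0" using dim_syz_forms[OF assms(1-3), of c] neg by (simp add: rdim_neg)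
  then have "syz_forms h c \<subseteq> {0}" using fv.dim_0_imp syz_forms_finite_span by metis
  moreover note syzygy_function[OF assms(1) w(1,2)]
  ultimately have "w = vec 3 0" by (metis singletonD subsetD)
  then show False using w(3) by (simp add: zero_vec_def zero_fun_def)
qed

text \<open>In degree \<open>d1\<close> the first twist contributes the constants, and the relations
  start in higher degrees.\<close>

lemma min_degree_attained:
  assumes "h \<in> carrier_vec 3" "\<forall>i<3. form 3 (h $ i)" "J = ideal_gen (set\<^sub>v h)"
  obtains w where "w \<in> syzygies h" "vec_form d1 w" "w \<noteq> 0\<^sub>v 3"
proof -
  have r0: "rdim TYPE(('n, 'k) mpoly) 0 = 1" using rdim_binomial[of 0, where 'n='n and 'k='k] by simp
  have "rdim TYPE(('n, 'k) mpoly) (d1 - d3 - e1) = 0" "rdim TYPE(('n, 'k) mpoly) (d1 - d4 - e2) = 0" using ineqs by (auto intro!: rdim_neg)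
  then have "fv.dim (syz_forms h d1) \<noteq> 0" using dim_syz_forms[OF assms, of d1] r0 by auto
  then have "\<not> syz_forms h d1 \<subseteq> {0}"
    using fv.dim_le_card[of "syz_forms h d1" "{}"] by auto
  then obtain v where v: "v \<in> syz_forms h d1" "v \<noteq> 0" by blast
  then show thesis using that vec_in_syzygies[OF assms(1) v(1)] vec_eq_0_iff[OF v(1)] by blast
qed

lemma indeg_eq:
  assumes "h \<in> carrier_vec 3" "\<forall>i<3. form 3 (h $ i)" "J = ideal_gen (set\<^sub>v h)"
  shows "int (indeg (syzygies h)) = d1"
proof -
  have "indeg (syzygies h) = nat d1" unfolding indeg_def
  proof (rule Least_equality)
    obtain w where w: "w \<in> syzygies h" "vec_form d1 w" "w \<noteq> 0\<^sub>v 3" using min_degree_attained[OF assms] by blast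
    then have "dim_vec w = 3" using assms(1) by (auto simp: syzygies_def)
    then show "\<exists>v\<in>syzygies h. v \<noteq> 0\<^sub>v (dim_vec v) \<and> vec_form (int (nat d1)) v"
      using w ineqs(1) by (intro bexI[of _ w]) auto
  next
    fix y assume "\<exists>v\<in>syzygies h. v \<noteq> 0\<^sub>v (dim_vec v) \<and> vec_form (int y) v"
    then obtain v where v: "v \<in> syzygies h" "v \<noteq> 0\<^sub>v (dim_vec v)" "vec_form (int y) v" by blast
    then have "dim_vec v = 3" using assms(1) by (auto simp: syzygies_def)
    then have "d1 \<le> int y" using min_degree[OF assms v(1,3)] v(2) by simp
    then show "nat d1 \<le> y" by simp
  qed
  then show ?thesis using ineqs(1) by simp
qed

section \<open>The multiplicity of the Bourbaki ideal\<close>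

definition mult_B :: int where
  "mult_B = (if d1 = 2 then 3 else if d4 = 3 then 7 else 8)"

text \<open>The numerator of the Hilbert series of the ring modulo the Bourbaki ideal. The twists of
  the syzygies are shifted by \<open>d1 - 3\<close>; the term at \<open>2 * d1 - 3\<close> accounts
  for the multiples of \<nu> and cancels that of the first generator.\<close>

definition csB :: "(int \<times> int) list" where
  "csB = [(1, 0), (1, 2 * d1 - 3), (-1, d1 + d1 - 3), (-1, d2 + d1 - 3), (-1, d3 + d1 - 3), (-1, d4 + d1 - 3),
     (1, d3 + e1 + d1 - 3), (1, d4 + e2 + d1 - 3)]"

lemma bourbaki_setup_gens:
  assumes h: "h \<in> carrier_vec 3" "\<forall>i<3. form 3 (h $ i)" "J = ideal_gen (set\<^sub>v h)"
    and n: "\<nu> \<in> syzygies h" "\<nu> \<noteq> 0\<^sub>v 3" "vec_form d1 \<nu>"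
  shows "bourbaki_setup h \<nu> 3 d1"
proof
  show "h \<in> carrier_vec 3" "\<forall>i<3. form 3 (h $ i)" by (rule h)+
  show "primitive (entries3 h)" by (rule primitive_gens[OF h(1,3)])
  show "\<nu> \<in> syzygies h" by (rule n)
  have "dim_vec \<nu> = 3" using n(1) h(1) by (auto simp: syzygies_def)
  then show "\<forall>i<3. form d1 (\<nu> $ i)" using n(3) by (auto simp: vec_form_def)
  show "primitive (entries3 \<nu>)"
    by (rule minimal_syzygy_primitive[OF h(1) n]) (use min_degree[OF h] in blast)
qed

lemma bideal_properties:
  assumes h: "h \<in> carrier_vec 3" "\<forall>i<3. form 3 (h $ i)" "J = ideal_gen (set\<^sub>v h)"
    and n: "\<nu> \<in> syzygies h" "\<nu> \<noteq> 0\<^sub>v 3" "vec_form d1 \<nu>"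
  shows "1 \<notin> bourbaki_setup.bideal h \<nu>" "quot_multiplicity (bourbaki_setup.bideal h \<nu>) = of_int mult_B"
proof -
  interpret b: bourbaki_setup h \<nu> 3 d1 by (rule bourbaki_setup_gens[OF assms])
  show "1 \<notin> b.bideal"
  proof (rule b.one_notin_bideal)
    fix w assume w: "w \<in> syzygies h" "vec_form (3 - d1) w"
    \<comment> \<open>As \<open>d1 \<ge> 2\<close>, the degree \<open>3 - d1\<close> is smaller than
      the least degree \<open>d1\<close> of a nonzero syzygy.\<close>
    show "w = 0\<^sub>v 3"
      using min_degree[OF h w] d12 by force
  qed
  have hf: "int (hilbert_fun b.bideal i) = (\<Sum>(c, a)\<leftarrow>csB. c * int (rdim TYPE(('n, 'k) mpoly) (int i - a)))" for i
    using hilbert_fun_int[of b.bideal i] b.dim_bideal[OF refl, of "int i + 3 - d1"] dim_syz_forms[OF h, of "int i + 3 - d1"]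
    by (simp add: csB_def algebra_simps)
  show "quot_multiplicity b.bideal = of_int mult_B"
  proof (rule quot_multiplicity_eqI[OF card_n'])
    fix i show "rat_of_nat (hilbert_fun b.bideal i) = (\<Sum>(c, a)\<leftarrow>csB. rat_of_int c * rat_of_nat (rdim TYPE(('n, 'k) mpoly) (int i - a)))"
      unfolding of_int_sum_csx[symmetric] hf[symmetric] by simp
    show "moment 0 csB = 0" "moment 1 csB = 0" "moment 2 csB = 2 * mult_B"
      using possible_degrees by (auto simp: moment_def csB_def mult_B_def)
  qed (auto simp: mult_B_def)
qed

lemma gens_of_min_gens:
  assumes "h \<in> carrier_vec 3" "min_gens d J h"
  shows "d = 3" "\<forall>i<3. form 3 (h $ i)" "J = ideal_gen (set\<^sub>v h)"
proof -
  show d: "d = 3" using min_gens_degree_unique[OF assms g] min_gens_degree_unique[OF g assms] by simp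
  show "\<forall>i<3. form 3 (h $ i)" "J = ideal_gen (set\<^sub>v h)" using assms d by (auto simp: min_gens_def)
qed

lemma bourbaki_ideal_exists: "\<exists>I. bourbaki_ideal J I"
proof -
  note h = g(1) gens_of_min_gens(2,3)[OF g]
  obtain \<nu> where n: "\<nu> \<in> syzygies g" "vec_form d1 \<nu>" "\<nu> \<noteq> 0\<^sub>v 3" using min_degree_attained[OF h] by blast
  interpret b: bourbaki_setup g \<nu> 3 d1 by (rule bourbaki_setup_gens[OF h n(1,3,2)])
  have one: "1 \<notin> b.bideal" by (rule bideal_properties(1)[OF h n(1,3,2)])
  have "bourbaki_ideal J b.bideal"
    unfolding bourbaki_ideal_def
    using g n one b.homogeneous_bideal b.height_bideal b.unmixed_bideal b.quot_iso_bideal indeg_eq[OF h]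
    by (intro exI[of _ 3] bexI[of _ g] bexI[of _ \<nu>]) auto
  then show ?thesis by blast
qed

lemma bourbaki_ideal_multiplicity:
  assumes "bourbaki_ideal J I" shows "quot_multiplicity I = of_int mult_B"
proof -
  obtain d h \<nu> where h: "h \<in> carrier_vec 3" "\<nu> \<in> syzygies h" "min_gens d J h" "\<nu> \<noteq> 0\<^sub>v 3"
    "vec_form (int (indeg (syzygies h))) \<nu>" "height I = 2" "quot_iso_ideal (syzygies h) \<nu> I"
    using assms unfolding bourbaki_ideal_def by blast
  note h' = h(1) gens_of_min_gens(2,3)[OF h(1,3)]
  have n: "vec_form d1 \<nu>" using h(5) indeg_eq[OF h'] by simp
  interpret b: bourbaki_setup h \<nu> 3 d1 by (rule bourbaki_setup_gens[OF h' h(2,4) n])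
  have "I = b.bideal" by (rule b.quot_iso_unique[OF h(7,6)])
  then show ?thesis using bideal_properties(2)[OF h' h(2,4) n] by simp
qed

lemma bourbaki_degree_J:
  assumes "\<not> perfect_of_height_two J" shows "bourbaki_degree J = of_int mult_B"
proof -
  have "(THE b. \<exists>I. bourbaki_ideal J I \<and> b = quot_multiplicity I) = of_int mult_B"
    by (rule the_equality) (use bourbaki_ideal_exists bourbaki_ideal_multiplicity in auto)
  then show ?thesis using assms by (simp add: bourbaki_degree_def)
qed

end

section \<open>Comparison of resolutions\<close>

lemma graded_free_resolution_3:
  "graded_free_resolution J [a0, a1, a2] [M0, M1, M2] \<longleftrightarrow>
    graded_map [0] a0 M0 \<and> graded_map a0 a1 M1 \<and> graded_map a1 a2 M2 \<and> J = row_ideal M0 \<and>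
    mat_kernel M0 = mat_image M1 \<and> mat_kernel M1 = mat_image M2 \<and> mat_kernel M2 = {0\<^sub>v (dim_col M2)}"
  by (auto simp: graded_free_resolution_def All_less_Suc row_ideal_def)

lemma graded_free_resolution_2:
  "graded_free_resolution J [a0, a1] [M0, M1] \<longleftrightarrow>
    graded_map [0] a0 M0 \<and> graded_map a0 a1 M1 \<and> J = row_ideal M0 \<and>
    mat_kernel M0 = mat_image M1 \<and> mat_kernel M1 = {0\<^sub>v (dim_col M1)}"
  by (auto simp: graded_free_resolution_def All_less_Suc row_ideal_def)

lemma graded_map_carrier: "graded_map b a M \<Longrightarrow> M \<in> carrier_mat (length b) (length a)"
  by (simp add: graded_map_def)

lemma mat_lift:
  fixes A B :: "'a::comm_ring_1 mat"
  assumes "A \<in> carrier_mat n m" "B \<in> carrier_mat n k" "\<And>j. j < k \<Longrightarrow> col B j \<in> mat_image A"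
  obtains X where "X \<in> carrier_mat m k" "A * X = B"
proof -
  have "\<forall>j<k. \<exists>x. x \<in> carrier_vec m \<and> col B j = A *\<^sub>v x"
    using assms unfolding mat_image_def by auto
  then obtain x where x: "\<And>j. j < k \<Longrightarrow> x j \<in> carrier_vec m \<and> col B j = A *\<^sub>v x j" by metis
  define X where "X = mat m k (\<lambda>(i, j). x j $ i)"
  have X: "X \<in> carrier_mat m k" by (simp add: X_def)
  have cX: "col X j = x j" if "j < k" for j using x[OF that] that by (intro eq_vecI) (auto simp: X_def)
  have "A * X = B"
  proof (rule eq_matI)
    fix i j assume ij: "i < dim_row B" "j < dim_col B"
    then have "(A * X) $$ (i, j) = (A *\<^sub>v x j) $ i" using assms X cX by simp
    then show "(A * X) $$ (i, j) = B $$ (i, j)" using x[of j] ij assms(2) by (auto simp flip: index_col)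
  qed (use assms X in auto)
  then show thesis using that X by blast
qed

text \<open>The lifting step for chain maps and homotopies: a matrix killed by \<open>A\<close>
  factors through \<open>B\<close>.\<close>

lemma kernel_lift:
  fixes A B C :: "'a::comm_ring_1 mat"
  assumes "A \<in> carrier_mat n m" "B \<in> carrier_mat m k" "mat_kernel A = mat_image B"
    "C \<in> carrier_mat m l" "A * C = 0\<^sub>m n l"
  obtains X where "X \<in> carrier_mat k l" "B * X = C"
proof (rule mat_lift[OF assms(2,4)])
  fix j assume j: "j < l"
  have "A *\<^sub>v col C j = col (A * C) j" using assms(1,4) j by (intro eq_vecI) auto
  then have "A *\<^sub>v col C j = 0\<^sub>v n" unfolding assms(5) using j by simp
  moreover have "col C j \<in> carrier_vec m" using assms(4) by (auto intro: carrier_vecI)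
  ultimately show "col C j \<in> mat_image B" unfolding assms(3)[symmetric] using assms(1) by (auto simp: mat_kernel_def)
qed

lemma kernel_image_product:
  fixes A B :: "'a::comm_ring_1 mat"
  assumes "A \<in> carrier_mat n m" "B \<in> carrier_mat m k" "mat_kernel A = mat_image B"
  shows "A * B = 0\<^sub>m n k"
proof (rule eq_matI)
  fix i j assume ij: "i < dim_row (0\<^sub>m n k :: 'a mat)" "j < dim_col (0\<^sub>m n k :: 'a mat)"
  have "col B j = B *\<^sub>v unit_vec k j" using assms(2) ij by (intro eq_vecI) auto
  then have "col B j \<in> mat_image B" unfolding mat_image_def using assms(2) by auto
  then have "A *\<^sub>v col B j = 0\<^sub>v n" unfolding assms(3)[symmetric] using assms(1) by (auto simp: mat_kernel_def)
  then have "(A *\<^sub>v col B j) $ i = 0" using ij by simp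
  then show "(A * B) $$ (i, j) = (0\<^sub>m n k :: 'a mat) $$ (i, j)" using assms ij by simp
qed (use assms in auto)

lemma injective_product_zero:
  fixes A C :: "'a::comm_ring_1 mat"
  assumes "A \<in> carrier_mat n m" "mat_kernel A = {0\<^sub>v m}" "C \<in> carrier_mat m l" "A * C = 0\<^sub>m n l"
  shows "C = 0\<^sub>m m l"
proof (rule eq_matI)
  fix i j assume ij: "i < dim_row (0\<^sub>m m l :: 'a mat)" "j < dim_col (0\<^sub>m m l :: 'a mat)"
  have "A *\<^sub>v col C j = col (A * C) j" using assms(1,3) ij by (intro eq_vecI) auto
  then have "A *\<^sub>v col C j = 0\<^sub>v n" unfolding assms(4) using ij by simp
  moreover have "col C j \<in> carrier_vec m" using assms(3) by (auto intro: carrier_vecI)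
  ultimately have "col C j \<in> mat_kernel A" using assms(1) by (auto simp: mat_kernel_def)
  then have "col C j = 0\<^sub>v m" using assms(2) by simp
  then have "col C j $ i = 0" using ij by simp
  then show "C $$ (i, j) = (0\<^sub>m m l :: 'a mat) $$ (i, j)" using assms(3) ij by simp
qed (use assms in auto)

lemma row_ideal_lift:
  fixes A B :: "'a::comm_ring_1 mat"
  assumes "A \<in> carrier_mat 1 m" "B \<in> carrier_mat 1 k" "row_ideal B \<subseteq> row_ideal A"
  obtains X where "X \<in> carrier_mat m k" "A * X = B"
proof (rule mat_lift[OF assms(1,2)])
  fix j assume j: "j < k"
  have col: "col B j = B *\<^sub>v unit_vec k j" using assms(2) j by (intro eq_vecI) auto
  have "col B j \<in> mat_image B" unfolding col mat_image_def using assms(2) by auto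
  then have "col B j $ 0 \<in> row_ideal B" unfolding row_ideal_def by (rule imageI)
  then have "col B j $ 0 \<in> row_ideal A" using assms(3) by blast
  then obtain v where "v \<in> carrier_vec m" "col B j $ 0 = (A *\<^sub>v v) $ 0"
    using assms(1) by (auto simp: row_ideal_def mat_image_def)
  moreover from this have "col B j = A *\<^sub>v v" using assms(1,2) by (intro eq_vecI) auto
  ultimately show "col B j \<in> mat_image A" unfolding mat_image_def using assms(1) by auto
qed

text \<open>Both complexes resolve \<open>J\<close>, so the identity of the first one is homotopic to a map through the
  second one. As the second one vanishes at the last place, the last differential \<open>M2\<close> of the first
  has a left inverse, which is impossible when its entries have no constant terms.\<close>

lemma no_shorter_resolution:
  fixes J :: "('n::{finite,linorder}, 'k::field) mpoly set"
  assumes res: "graded_free_resolution J [a0, a1, a2] [M0, M1, M2]" "a2 \<noteq> []"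
    and minimal: "\<forall>p\<in>elements_mat M2. lookup p 0 = 0"
  shows "\<not> graded_free_resolution J [b0, b1] [N0, N1]"
proof
  assume res': "graded_free_resolution J [b0, b1] [N0, N1]"
  define n0 n1 n2 m0 m1 where n: "n0 = length a0" "n1 = length a1" "n2 = length a2" "m0 = length b0" "m1 = length b1"
  have M: "M0 \<in> carrier_mat 1 n0" "M1 \<in> carrier_mat n0 n1" "M2 \<in> carrier_mat n1 n2"
    and eM: "mat_kernel M0 = mat_image M1" "mat_kernel M1 = mat_image M2" "mat_kernel M2 = {0\<^sub>v n2}"
    and JM: "J = row_ideal M0"
    using res(1) unfolding graded_free_resolution_3 n by (auto dest!: graded_map_carrier)
  have N: "N0 \<in> carrier_mat 1 m0" "N1 \<in> carrier_mat m0 m1"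
    and eN: "mat_kernel N0 = mat_image N1" "mat_kernel N1 = {0\<^sub>v m1}"
    and JN: "J = row_ideal N0"
    using res' unfolding graded_free_resolution_2 n by (auto dest!: graded_map_carrier)
  have MM: "M0 * M1 = 0\<^sub>m 1 n1" "M1 * M2 = 0\<^sub>m n0 n2" and NN: "N0 * N1 = 0\<^sub>m 1 m1"
    using kernel_image_product M N eM eN by blast+
  obtain A0 where A0: "A0 \<in> carrier_mat m0 n0" "N0 * A0 = M0"
    using row_ideal_lift[OF N(1) M(1)] JM JN by blast
  obtain B0 where B0: "B0 \<in> carrier_mat n0 m0" "M0 * B0 = N0"
    using row_ideal_lift[OF M(1) N(1)] JM JN by blast
  have "N0 * (A0 * M1) = 0\<^sub>m 1 n1" using assoc_mult_mat[OF N(1) A0(1) M(2)] A0(2) MM by simp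
  then obtain A1 where A1: "A1 \<in> carrier_mat m1 n1" "N1 * A1 = A0 * M1"
    using kernel_lift[OF N(1,2) eN(1), of "A0 * M1" n1] A0 M by auto
  have "N1 * (A1 * M2) = A0 * (M1 * M2)"
    using assoc_mult_mat[OF N(2) A1(1) M(3)] assoc_mult_mat[OF A0(1) M(2,3)] A1(2) by simp
  also have "\<dots> = 0\<^sub>m m0 n2" using MM A0 by simp
  finally have A1M2: "A1 * M2 = 0\<^sub>m m1 n2"
    using injective_product_zero[OF N(2) eN(2)] A1(1) M(3) by auto
  have "M0 * (B0 * N1) = 0\<^sub>m 1 m1" using assoc_mult_mat[OF M(1) B0(1) N(2)] B0(2) NN by simp
  then obtain B1 where B1: "B1 \<in> carrier_mat n1 m1" "M1 * B1 = B0 * N1"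
    using kernel_lift[OF M(1,2) eM(1), of "B0 * N1" m1] B0 N by auto
  have BA: "B0 * A0 \<in> carrier_mat n0 n0" "B1 * A1 \<in> carrier_mat n1 n1" using B0 A0 B1 A1 by auto
  have "M0 * (B0 * A0) = M0" using assoc_mult_mat[OF M(1) B0(1) A0(1)] B0(2) A0(2) by simp
  then have "M0 * (B0 * A0 - 1\<^sub>m n0) = 0\<^sub>m 1 n0"
    using mult_minus_distrib_mat[OF M(1) BA(1) one_carrier_mat] M(1) by simp
  moreover have "B0 * A0 - 1\<^sub>m n0 \<in> carrier_mat n0 n0" by (rule minus_carrier_mat) simp
  ultimately obtain h0 where h0: "h0 \<in> carrier_mat n1 n0" "M1 * h0 = B0 * A0 - 1\<^sub>m n0"
    using kernel_lift[OF M(1,2) eM(1), of "B0 * A0 - 1\<^sub>m n0" n0] by blast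
  \<comment> \<open>This is the deviation of \<open>B1 * A1\<close> from the identity, corrected by
    \<open>h0\<close>. It is killed by \<open>M1\<close> and therefore factors through
    \<open>M2\<close>.\<close>
  define D where "D = B1 * A1 - 1\<^sub>m n1 - h0 * M1"
  have hM: "h0 * M1 \<in> carrier_mat n1 n1" and BA1: "B1 * A1 - 1\<^sub>m n1 \<in> carrier_mat n1 n1"
    using h0 M BA by (auto simp: minus_carrier_mat)
  have D: "D \<in> carrier_mat n1 n1" using hM by (auto simp: D_def minus_carrier_mat)
  have e1: "M1 * (B1 * A1) = (B0 * A0) * M1"
    using assoc_mult_mat[OF M(2) B1(1) A1(1)] assoc_mult_mat[OF B0(1) N(2) A1(1)] assoc_mult_mat[OF B0(1) A0(1) M(2)]
      B1(2) A1(2) by simp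
  have e2: "M1 * (h0 * M1) = (B0 * A0) * M1 - M1"
    using assoc_mult_mat[OF M(2) h0(1) M(2)] h0(2) minus_mult_distrib_mat[OF BA(1) one_carrier_mat M(2)] M(2) by simp
  have BAM: "(B0 * A0) * M1 \<in> carrier_mat n0 n1" using BA M by auto
  have "M1 * D = (B0 * A0) * M1 - M1 - ((B0 * A0) * M1 - M1)"
    unfolding D_def mult_minus_distrib_mat[OF M(2) BA1 hM] mult_minus_distrib_mat[OF M(2) BA(2) one_carrier_mat] e1 e2
    using M(2) by simp
  also have "\<dots> = 0\<^sub>m n0 n1" using BAM M(2) by (intro eq_matI) auto
  finally obtain h1 where h1: "h1 \<in> carrier_mat n2 n1" "M2 * h1 = D"
    using kernel_lift[OF M(2,3) eM(2) D] by blast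
  have "M2 * (h1 * M2) = D * M2" using assoc_mult_mat[OF M(3) h1(1) M(3)] h1(2) by simp
  also have "\<dots> = B1 * (A1 * M2) - M2 - h0 * (M1 * M2)"
    unfolding D_def minus_mult_distrib_mat[OF BA1 hM M(3)] minus_mult_distrib_mat[OF BA(2) one_carrier_mat M(3)]
      assoc_mult_mat[OF B1(1) A1(1) M(3)] assoc_mult_mat[OF h0(1) M(2,3)] using M(3) by simp
  also have "\<dots> = - M2" unfolding A1M2 MM using B1 h0 M(3) by (intro eq_matI) auto
  finally have "M2 * (h1 * M2) = - M2" .
  then have "M2 * (h1 * M2 + 1\<^sub>m n2) = 0\<^sub>m n1 n2"
    using mult_add_distrib_mat[OF M(3), of "h1 * M2" n2 "1\<^sub>m n2"] h1(1) M(3) by simp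
  moreover have hc: "h1 * M2 + 1\<^sub>m n2 \<in> carrier_mat n2 n2" by simp
  ultimately have z: "h1 * M2 + 1\<^sub>m n2 = 0\<^sub>m n2 n2"
    using injective_product_zero[OF M(3) eM(3)] by blast
  have n2: "0 < n2" using res(2) by (simp add: n)
  \<comment> \<open>The constant term of this entry is 1, since the entries of \<open>M2\<close>
    have none.\<close>
  have "(h1 * M2 + 1\<^sub>m n2) $$ (0, 0) = (0 :: ('n, 'k) mpoly)" unfolding z using n2 by simp
  then have s: "(\<Sum>j<n1. h1 $$ (0, j) * M2 $$ (j, 0)) + 1 = 0"
    using h1(1) M(3) n2 by (simp add: scalar_prod_def lessThan_atLeast0)
  have c: "lookup (M2 $$ (j, 0)) 0 = 0" if "j < n1" for j
    using minimal elements_matI[OF M(3) that n2 refl] by blast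
  have "lookup ((\<Sum>j<n1. h1 $$ (0, j) * M2 $$ (j, 0)) + 1) 0 = 1"
    using c by (simp add: lookup_add lookup_sum lookup_mult_0 lookup_one)
  then show False unfolding s by simp
qed

text \<open>This selects the branch of the Bourbaki degree that is computed from the Bourbaki
  ideal.\<close>

lemma not_perfect:
  fixes J :: "('n::{finite,linorder}, 'k::field) mpoly set"
  assumes "graded_free_resolution J [a0, a1, a2] [M0, M1, M2]" "a2 \<noteq> []"
    and "\<forall>p\<in>elements_mat M2. lookup p 0 = 0"
  shows "\<not> perfect_of_height_two J"
proof
  assume "perfect_of_height_two J"
  then have "proj_dim_quot J = 2" by (simp add: perfect_of_height_two_def)
  moreover have "\<exists>as Ms. length as = proj_dim_quot J \<and> graded_free_resolution J as Ms"
    unfolding proj_dim_quot_def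
    by (rule LeastI_ex) (use assms(1) in blast)
  ultimately obtain as Ms where as: "length as = 2" "graded_free_resolution J as Ms" by auto
  moreover have "length Ms = 2" using as by (simp add: graded_free_resolution_def)
  ultimately obtain b0 b1 N0 N1 where "as = [b0, b1]" "Ms = [N0, N1]"
    by (metis (no_types, opaque_lifting) One_nat_def Suc_1 length_0_conv length_Suc_conv)
  then show False using as no_shorter_resolution[OF assms] by blast
qed

definition admissible :: "('n, 'k::field) mpoly set \<Rightarrow> int \<Rightarrow> int \<Rightarrow> int \<Rightarrow> int \<Rightarrow> int \<Rightarrow> int \<Rightarrow> bool" where
  "admissible J \<delta>\<^sub>1 \<delta>\<^sub>2 \<delta>\<^sub>3 \<delta>\<^sub>4 \<epsilon>\<^sub>1 \<epsilon>\<^sub>2 \<longleftrightarrow>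
        (\<exists>f \<in> carrier_vec 3. min_gens 3 J f) \<and>
        height J = 2 \<and>
        1 \<le> \<delta>\<^sub>1 \<and> \<delta>\<^sub>1 \<le> \<delta>\<^sub>2 \<and> \<delta>\<^sub>2 \<le> \<delta>\<^sub>3 \<and> \<delta>\<^sub>3 \<le> \<delta>\<^sub>4 \<and>
        0 < \<epsilon>\<^sub>1 \<and> 0 < \<epsilon>\<^sub>2 \<and> \<delta>\<^sub>3 + \<epsilon>\<^sub>1 \<le> \<delta>\<^sub>4 + \<epsilon>\<^sub>2 \<and>
        (\<exists>Ms. minimal_graded_free_resolution J
           [[3, 3, 3],
            [3 + \<delta>\<^sub>1, 3 + \<delta>\<^sub>2, 3 + \<delta>\<^sub>3, 3 + \<delta>\<^sub>4],
            [3 + \<delta>\<^sub>3 + \<epsilon>\<^sub>1, 3 + \<delta>\<^sub>4 + \<epsilon>\<^sub>2]] Ms)"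

lemma admissible_values:
  fixes J :: "('n::{finite,linorder}, 'k::field_char_0) mpoly set"
  assumes "3 \<le> CARD('n)" "admissible J d1 d2 d3 d4 e1 e2"
  shows "((d1, d2, d3, d4), (e1, e2), quot_multiplicity J, bourbaki_degree J) \<in>
    {((2, 3, 3, 3), (1, 1), 4, 3), ((3, 3, 3, 3), (1, 2), 2, 7), ((3, 3, 3, 4), (2, 1), 1, 8)}"
proof -
  let ?as = "[[3, 3, 3], [3 + d1, 3 + d2, 3 + d3, 3 + d4], [3 + d3 + e1, 3 + d4 + e2]]"
  obtain g where g: "g \<in> carrier_vec 3" "min_gens 3 J g" using assms(2) by (auto simp: admissible_def)
  obtain Ms where Ms: "minimal_graded_free_resolution J ?as Ms" using assms(2) by (auto simp: admissible_def)
  then have res: "graded_free_resolution J ?as Ms" by (simp add: minimal_graded_free_resolution_def)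
  then have "length Ms = 3" by (simp add: graded_free_resolution_def)
  then obtain M0 M1 M2 where M: "Ms = [M0, M1, M2]"
    by (auto simp: numeral_3_eq_3 length_Suc_conv)
  have minimal: "\<forall>p\<in>elements_mat M2. lookup p 0 = 0"
    using Ms unfolding minimal_graded_free_resolution_def M by (auto dest!: spec[of _ 2])
  define f where "f = vec 3 (\<lambda>j. M0 $$ (0, j))"
  have gm: "graded_map [0] [3, 3, 3] M0" and JM: "J = row_ideal M0"
    using res unfolding M graded_free_resolution_3 by auto
  then have M0: "M0 = row_mat f"
    by (intro eq_matI) (auto simp: graded_map_def row_mat_def f_def)
  have fc: "f \<in> carrier_vec 3" by (simp add: f_def)
  have ff: "\<forall>i<3. form 3 (f $ i)"
    unfolding all_less_3 using gm by (simp add: f_def graded_map_def numeral_3_eq_3 numeral_2_eq_2 less_Suc_eq all_conj_distrib)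
  interpret cubic_resolution J f g M1 M2 d1 d2 d3 d4 e1 e2
    using assms g fc ff JM row_ideal_row_mat[OF fc] res minimal unfolding M M0
    by unfold_locales (auto simp: admissible_def)
  have np: "\<not> perfect_of_height_two J" using not_perfect[OF res[unfolded M] _ minimal] by simp
  show ?thesis
    using possible_degrees quot_multiplicity_J bourbaki_degree_J[OF np] by (auto simp: mult_J_def mult_B_def)
qed

section \<open>Divisibility by powers of variables\<close>

lemma keys_Xpow_mult:
  fixes t :: "('n, 'k::comm_ring_1) mpoly"
  assumes "m \<in> keys t" shows "Poly_Mapping.single x a + m \<in> keys (Xpow x a * t)"
proof -
  let ?s = "Poly_Mapping.single x a"
  have "Xpow x a * t = Xpow x a * (\<Sum>k\<in>keys t. Poly_Mapping.single k (lookup t k))"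
    using poly_mapping_sum_single[of t] by simp
  also have "\<dots> = (\<Sum>k\<in>keys t. Poly_Mapping.single (?s + k) (lookup t k))"
    by (simp add: sum_distrib_left mult_single)
  finally have "lookup (Xpow x a * t) (?s + m) = (\<Sum>k\<in>keys t. lookup t k when ?s + k = ?s + m)"
    by (simp add: lookup_sum lookup_single)
  also have "\<dots> = lookup t m" using assms by (simp add: when_def)
  finally show ?thesis using assms by (simp add: in_keys_iff)
qed

lemma Xpow_dvd_iff:
  fixes p :: "('n, 'k::comm_ring_1) mpoly"
  shows "Xpow x a dvd p \<longleftrightarrow> (\<forall>m\<in>keys p. a \<le> lookup m x)"
proof
  assume "Xpow x a dvd p"
  then obtain t where "p = Xpow x a * t" by blast
  then show "\<forall>m\<in>keys p. a \<le> lookup m x"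
    using keys_mult[of "Xpow x a" t] by (auto simp: lookup_add)
next
  assume *: "\<forall>m\<in>keys p. a \<le> lookup m x"
  have "Xpow x a dvd Poly_Mapping.single m (lookup p m)" if "m \<in> keys p" for m
  proof -
    have "Poly_Mapping.single x a + (m - Poly_Mapping.single x a) = m"
      using * that by (intro poly_mapping_eqI) (auto simp: lookup_add lookup_minus lookup_single when_def)
    then have "Poly_Mapping.single m (lookup p m) = Xpow x a * Poly_Mapping.single (m - Poly_Mapping.single x a) (lookup p m)"
      by (simp add: mult_single)
    then show ?thesis by (rule dvdI)
  qed
  then have "Xpow x a dvd (\<Sum>m\<in>keys p. Poly_Mapping.single m (lookup p m))" by (rule dvd_sum)
  then show "Xpow x a dvd p" by (rule back_subst[OF _ poly_mapping_sum_single[symmetric]])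
qed

lemma Xpow_dvd_cancel:
  fixes h :: "('n, 'k::comm_ring_1) mpoly"
  assumes "x \<noteq> z" "Xpow z k dvd Xpow x a * h" shows "Xpow z k dvd h"
  unfolding Xpow_dvd_iff
proof
  fix m assume "m \<in> keys h"
  then have "k \<le> lookup (Poly_Mapping.single x a + m) z"
    by (intro assms(2)[unfolded Xpow_dvd_iff, rule_format] keys_Xpow_mult)
  then show "k \<le> lookup m z" using assms(1) by (simp add: lookup_add lookup_single)
qed

text \<open>Membership in an ideal generated by powers of variables is decided monomial by monomial,
  and the factor in \<open>y\<close> leaves the exponents of \<open>x\<close> and \<open>z\<close>
  unchanged.\<close>

lemma Xpow_regular:
  fixes t :: "('n, 'k::comm_ring_1) mpoly"
  assumes "x \<noteq> y" "z \<noteq> y" "Xpow y c * t = Xpow x a * u + Xpow z b * v"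
  obtains u' v' where "t = Xpow x a * u' + Xpow z b * v'"
proof -
  have k: "a \<le> lookup m x \<or> b \<le> lookup m z" if "m \<in> keys t" for m
  proof -
    let ?m = "Poly_Mapping.single y c + m"
    have "?m \<in> keys (Xpow x a * u) \<or> ?m \<in> keys (Xpow z b * v)"
      using keys_Xpow_mult[OF that, of y c] Poly_Mapping.keys_add[of "Xpow x a * u" "Xpow z b * v"] unfolding assms(3) by blast
    then have "a \<le> lookup ?m x \<or> b \<le> lookup ?m z"
      using Xpow_dvd_iff[of x a "Xpow x a * u"] Xpow_dvd_iff[of z b "Xpow z b * v"] by auto
    then show ?thesis using assms(1,2) by (simp add: lookup_add lookup_single)
  qed
  \<comment> \<open>The terms of \<open>t\<close> divisible by the power of \<open>x\<close>; all
    other terms are divisible by the power of \<open>z\<close>.\<close>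
  define t1 where "t1 = (\<Sum>m\<in>{m \<in> keys t. a \<le> lookup m x}. Poly_Mapping.single m (lookup t m))"
  have l1: "lookup t1 m = (lookup t m when a \<le> lookup m x)" for m
    by (auto simp: t1_def lookup_sum lookup_single when_def in_keys_iff)
  have "Xpow x a dvd t1" unfolding Xpow_dvd_iff by (auto simp: in_keys_iff l1)
  moreover have "Xpow z b dvd t - t1" unfolding Xpow_dvd_iff
  proof
    fix m assume "m \<in> keys (t - t1)"
    then have "lookup t m \<noteq> 0" "\<not> a \<le> lookup m x"
      by (auto simp: in_keys_iff lookup_minus l1 when_def split: if_splits)
    then show "b \<le> lookup m z" using k[of m] by (simp add: in_keys_iff)
  qed
  ultimately obtain u' v' where "t1 = Xpow x a * u'" "t - t1 = Xpow z b * v'" by blast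
  then have "t = Xpow x a * u' + Xpow z b * v'" by (metis add.commute diff_add_cancel)
  then show thesis by (rule that)
qed

lemma form_Xpow: "form (int a) (Xpow x a)"
  by (auto simp: form_def mdeg_def)

lemma form_positive_const: "form d p \<Longrightarrow> 0 < d \<Longrightarrow> lookup p 0 = 0"
  unfolding form_def by (metis in_keys_iff less_irrefl mdeg_0 of_nat_0)

section \<open>Examples\<close>

text \<open>The syzygy \<open>\<eta>\<close> of degree \<open>p + q\<close> comes before or after the three Koszul syzygies, depending on
  \<open>eta_first\<close>, because the twists have to be increasing. The parameter \<open>kk\<close> only fixes the field.\<close>

locale cubic_example =
  fixes x y z :: "'n::{finite,linorder}" and p q :: nat and eta_first :: bool and kk :: "'k::field_char_0 itself"
  assumes distinct: "x \<noteq> y" "x \<noteq> z" "y \<noteq> z" and pq: "1 \<le> q" "q \<le> p" "p \<le> 2"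
begin

text \<open>The generators are the entries of A (P, Zp, 0) + B (0, Q, Zq), and the additional syzygy
  is the cross product of the two vectors (P, Zp, 0) and (0, Q, Zq). The factor \<open>D\<close>
  compares the two powers of \<open>z\<close>.\<close>

definition "A = (Xpow x (3 - p) :: ('n, 'k) mpoly)"
definition "P = (Xpow x p :: ('n, 'k) mpoly)"
definition "B = (Xpow y (3 - q) :: ('n, 'k) mpoly)"
definition "Q = (Xpow y q :: ('n, 'k) mpoly)"
definition "Zp = (Xpow z p :: ('n, 'k) mpoly)"
definition "Zq = (Xpow z q :: ('n, 'k) mpoly)"
definition "D = (Xpow z (p - q) :: ('n, 'k) mpoly)"

lemma Zp_eq: "Zp = Zq * D"
  using pq by (simp add: Zp_def Zq_def D_def Xpow_mult)

lemma neq_0: "A \<noteq> 0" "P \<noteq> 0" "B \<noteq> 0" "Q \<noteq> 0" "Zp \<noteq> 0" "Zq \<noteq> 0"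
  by (auto simp: A_def P_def B_def Q_def Zp_def Zq_def)

lemma AP: "A * P = Xpow x 3" and BQ: "B * Q = Xpow y 3"
  using pq by (auto simp: A_def P_def B_def Q_def Xpow_mult)

text \<open>As \<open>A\<close> and \<open>B\<close> are coprime, a syzygy has the products
  \<open>B * t\<close> and \<open>- A * t\<close> with the vectors (P, Zp, 0) and (0, Q, Zq).
  Subtracting Koszul syzygies makes \<open>t\<close> vanish, and a vector orthogonal to both is a
  multiple of their cross product.\<close>

lemma syzygies_generated:
  assumes "A * P * w0 + (A * Zp + B * Q) * w1 + B * Zq * w2 = 0"
  obtains c u0 u1 u2 where
    "w0 = c * (Zp * Zq) + (u1 * (B * Zq) - u2 * (A * Zp + B * Q))"
    "w1 = - c * (P * Zq) + (u2 * (A * P) - u0 * (B * Zq))"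
    "w2 = c * (P * Q) + (u0 * (A * Zp + B * Q) - u1 * (A * P))"
proof -
  have 1: "A * (P * w0 + Zp * w1) = B * (- (Q * w1 + Zq * w2))" using assms by Groebner_Basis.algebra
  then have "B dvd P * w0 + Zp * w1"
    using Xpow_dvd_cancel[OF distinct(1), of "3 - q" "3 - p" "P * w0 + Zp * w1"] unfolding A_def B_def by (metis dvd_triv_left)
  then obtain t where t: "P * w0 + Zp * w1 = B * t" by blast
  have "B * (Q * w1 + Zq * w2) = B * (- A * t)" using 1 t by Groebner_Basis.algebra
  then have t': "Q * w1 + Zq * w2 = - A * t" using mult_left_cancel[OF neq_0(3)] by blast
  obtain s r where sr: "t = P * s + Zp * r"
    using Xpow_regular[OF distinct(1) distinct(3)[symmetric], of "3 - q" t p w0 p w1] t unfolding B_def P_def Zp_def by metis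
  have "Xpow x 3 * s = Q * (- w1) + Zq * (- w2 - A * D * r)"
    using t' sr Zp_eq unfolding AP[symmetric] by Groebner_Basis.algebra
  then obtain s1 s2 where s: "s = Q * s1 + Zq * s2"
    using Xpow_regular[OF distinct(1)[symmetric] distinct(2)[symmetric], of 3 s q "- w1" q "- w2 - A * D * r"]
    unfolding Q_def Zq_def by metis
  define v0 where "v0 = w0 - s2 * (B * Zq) - s1 * (A * Zp + B * Q)"
  define v1 where "v1 = w1 + s1 * (A * P)"
  define v2 where "v2 = w2 + s2 * (A * P)"
  have e1: "P * v0 = Zp * (B * r - v1)" unfolding v0_def v1_def using t sr s by Groebner_Basis.algebra
  have e2: "Q * v1 = Zq * (- v2 - A * D * r)" unfolding v1_def v2_def using t' sr s Zp_eq by Groebner_Basis.algebra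
  have "Zp dvd v0" using Xpow_dvd_cancel[OF distinct(2), of p p v0] e1 unfolding P_def Zp_def by (metis dvd_triv_left)
  then obtain g0 where g0: "v0 = Zp * g0" by blast
  have "Zp * (P * g0) = Zp * (B * r - v1)" using e1 g0 by Groebner_Basis.algebra
  then have g0': "P * g0 = B * r - v1" using mult_left_cancel[OF neq_0(5)] by blast
  have "Zq dvd v1" using Xpow_dvd_cancel[OF distinct(3), of q q v1] e2 unfolding Q_def Zq_def by (metis dvd_triv_left)
  then obtain g1 where g1: "v1 = Zq * g1" by blast
  have "B * r = P * g0 + Zq * g1" using g0' g1 by Groebner_Basis.algebra
  then obtain r1 r2 where r: "r = P * r1 + Zq * r2"
    using Xpow_regular[OF distinct(1) distinct(3)[symmetric], of "3 - q" r p g0 q g1] unfolding B_def P_def Zq_def by metis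
  \<comment> \<open>For these coefficients the Koszul part has the same \<open>t\<close> as
    \<open>w\<close>: both give \<open>P * (Q * s1 + Zq * s2) + Zp * (P * r1 + Zq * r2)\<close>,
    because \<open>Zp = Zq * D\<close>.\<close>
  define u0 where "u0 = - r2"
  define u1 where "u1 = s2 + D * r1"
  define u2 where "u2 = - s1"
  define x0 where "x0 = w0 - (u1 * (B * Zq) - u2 * (A * Zp + B * Q))"
  define x1 where "x1 = w1 - (u2 * (A * P) - u0 * (B * Zq))"
  define x2 where "x2 = w2 - (u0 * (A * Zp + B * Q) - u1 * (A * P))"
  have f1: "P * x0 = Zp * (- x1)"
    unfolding x0_def x1_def u0_def u1_def u2_def using t sr s r Zp_eq by Groebner_Basis.algebra
  have f2: "Q * x1 = Zq * (- x2)"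
    unfolding x1_def x2_def u0_def u1_def u2_def using t' sr s r Zp_eq by Groebner_Basis.algebra
  have "P dvd x1"
  proof -
    have "P dvd Zp * (- x1)" using f1 by (metis dvd_triv_left)
    then have "P dvd - x1" unfolding P_def Zp_def by (rule Xpow_dvd_cancel[OF distinct(2)[symmetric]])
    then show ?thesis by simp
  qed
  then obtain g where g: "x1 = P * g" by blast
  have "P * x0 = P * (- Zp * g)" using f1 g by Groebner_Basis.algebra
  then have x0: "x0 = - Zp * g" using mult_left_cancel[OF neq_0(2)] by blast
  have "Zq dvd g"
  proof -
    have "Q * (P * g) = Zq * (- x2)" using f2 g by simp
    then have "Zq dvd Q * (P * g)" by (metis dvd_triv_left)
    then have "Zq dvd P * g" unfolding Q_def Zq_def by (rule Xpow_dvd_cancel[OF distinct(3)])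
    then show ?thesis unfolding P_def Zq_def by (rule Xpow_dvd_cancel[OF distinct(2)])
  qed
  then obtain c where c: "g = Zq * c" by blast
  have "Zq * x2 = Zq * (- (P * Q * c))" using f2 g c by Groebner_Basis.algebra
  then have x2: "x2 = - (P * Q * c)" using mult_left_cancel[OF neq_0(6)] by blast
  show thesis
    by (rule that[of "- c" u1 u2 u0]; use x0 x2 g c in \<open>simp add: x0_def x1_def x2_def algebra_simps\<close>)
qed

text \<open>The product of the relation with the vector (P, Zp, 0) shows that (u0, u1, u2) is
  orthogonal to (Zp Zq, - P Zq, P Q). Hence it is a combination of (P, Zp, 0) and (0, Q, Zq), and
  this determines \<open>c\<close>.\<close>

lemma relations_generated:
  assumes "c * (Zp * Zq) + (u1 * (B * Zq) - u2 * (A * Zp + B * Q)) = 0"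
    "- c * (P * Zq) + (u2 * (A * P) - u0 * (B * Zq)) = 0"
    "c * (P * Q) + (u0 * (A * Zp + B * Q) - u1 * (A * P)) = 0"
  obtains s t where "u0 = P * t" "u1 = Q * s + Zp * t" "u2 = Zq * s" "c = A * s - B * t"
proof -
  have "B * (u0 * (Zp * Zq) - u1 * (P * Zq) + u2 * (P * Q)) = B * 0"
    using assms by Groebner_Basis.algebra
  then have 1: "u0 * (Zp * Zq) - u1 * (P * Zq) + u2 * (P * Q) = 0" using mult_left_cancel[OF neq_0(3)] by blast
  have "P * (Q * u2) = Zq * (u1 * P - u0 * Zp)" using 1 by Groebner_Basis.algebra
  then have "Zq dvd P * (Q * u2)" by (metis dvd_triv_left)
  then have "Zq dvd Q * u2" unfolding P_def Zq_def by (rule Xpow_dvd_cancel[OF distinct(2)])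
  then have "Zq dvd u2" unfolding Q_def Zq_def by (rule Xpow_dvd_cancel[OF distinct(3)])
  then obtain s where s: "u2 = Zq * s" by blast
  have "Zq * (u0 * Zp - u1 * P) = Zq * (- (P * Q * s))" using 1 s by Groebner_Basis.algebra
  then have 2: "u0 * Zp - u1 * P = - (P * Q * s)" using mult_left_cancel[OF neq_0(6)] by blast
  have "Zp * u0 = P * (u1 - Q * s)" using 2 by Groebner_Basis.algebra
  then have "P dvd Zp * u0" by (metis dvd_triv_left)
  then have "P dvd u0" unfolding P_def Zp_def by (rule Xpow_dvd_cancel[OF distinct(2)[symmetric]])
  then obtain t where t: "u0 = P * t" by blast
  have "P * u1 = P * (Q * s + Zp * t)" using 2 t by Groebner_Basis.algebra
  then have u1: "u1 = Q * s + Zp * t" using mult_left_cancel[OF neq_0(2)] by blast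
  have "(P * Zq) * c = (P * Zq) * (A * s - B * t)" using assms(2) s t u1 by Groebner_Basis.algebra
  moreover have "P * Zq \<noteq> 0" using neq_0 by simp
  ultimately have "c = A * s - B * t" using mult_left_cancel by blast
  then show thesis using that t u1 s by blast
qed

section \<open>The resolution of the example\<close>

definition f :: "('n, 'k) mpoly vec" where
  "f = vec3 (A * P) (A * Zp + B * Q) (B * Zq)"

definition J :: "('n, 'k) mpoly set" where
  "J = ideal_gen (set\<^sub>v f)"

definition eta :: "('n, 'k) mpoly vec" where
  "eta = vec3 (Zp * Zq) (- (P * Zq)) (P * Q)"

definition koszul :: "('n, 'k) mpoly vec list" where
  "koszul = [vec3 0 (- f $ 2) (f $ 1), vec3 (f $ 2) 0 (- f $ 0), vec3 (- f $ 1) (f $ 0) 0]"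

definition M1 :: "('n, 'k) mpoly mat" where
  "M1 = mat 3 4 (\<lambda>(i, j). ((if eta_first then eta # koszul else koszul @ [eta]) ! j) $ i)"

definition M2 :: "('n, 'k) mpoly mat" where
  "M2 = mat 4 2 (\<lambda>(i, j). (if eta_first then [[A, 0, Q, Zq], [- B, P, Zp, 0]] else [[0, Q, Zq, A], [P, Zp, 0, - B]]) ! j ! i)"

text \<open>The column of \<open>M1\<close> that holds the Koszul syzygy number \<open>k\<close>,
  and for \<open>k = 3\<close> the column of \<open>eta\<close>.\<close>

definition pos :: "nat \<Rightarrow> nat" where
  "pos k = (if eta_first then [1, 2, 3, 0] ! k else k)"

lemma pos_cases: "pos 0 < 4" "pos 1 < 4" "pos 2 < 4" "pos 3 < 4"
  by (auto simp: pos_def)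

text \<open>The coefficient \<open>c\<close> belongs to \<open>eta\<close>, the others to the Koszul
  syzygies, independently of the order of the columns.\<close>

definition comb :: "('n, 'k) mpoly \<Rightarrow> ('n, 'k) mpoly \<Rightarrow> ('n, 'k) mpoly \<Rightarrow> ('n, 'k) mpoly \<Rightarrow> ('n, 'k) mpoly vec" where
  "comb c u0 u1 u2 = vec3 (c * (Zp * Zq) + (u1 * (B * Zq) - u2 * (A * Zp + B * Q)))
     (- c * (P * Zq) + (u2 * (A * P) - u0 * (B * Zq)))
     (c * (P * Q) + (u0 * (A * Zp + B * Q) - u1 * (A * P)))"

lemma set_4: "{0..<4} = {0, 1, 2, 3 :: nat}"
  by auto

lemma M1_mult:
  assumes "u \<in> carrier_vec 4"
  shows "M1 *\<^sub>v u = comb (u $ pos 3) (u $ pos 0) (u $ pos 1) (u $ pos 2)"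
proof (rule vec_3_eqI)
  let ?c = "if eta_first then eta # koszul else koszul @ [eta]"
  have M: "(M1 *\<^sub>v u) $ i = ?c ! 0 $ i * u $ 0 + (?c ! 1 $ i * u $ 1 + (?c ! 2 $ i * u $ 2 + ?c ! 3 $ i * u $ 3))"
    if "i < 3" for i
    using assms that by (simp add: M1_def scalar_prod_def set_4)
  have M0: "(M1 *\<^sub>v u) $ 0 = ?c ! 0 $ 0 * u $ 0 + (?c ! 1 $ 0 * u $ 1 + (?c ! 2 $ 0 * u $ 2 + ?c ! 3 $ 0 * u $ 3))"
    by (rule M) simp
  have M1: "(M1 *\<^sub>v u) $ 1 = ?c ! 0 $ 1 * u $ 0 + (?c ! 1 $ 1 * u $ 1 + (?c ! 2 $ 1 * u $ 2 + ?c ! 3 $ 1 * u $ 3))"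
    by (rule M) simp
  have M2: "(M1 *\<^sub>v u) $ 2 = ?c ! 0 $ 2 * u $ 0 + (?c ! 1 $ 2 * u $ 1 + (?c ! 2 $ 2 * u $ 2 + ?c ! 3 $ 2 * u $ 3))"
    by (rule M) simp
  show "(M1 *\<^sub>v u) $ 0 = comb (u $ pos 3) (u $ pos 0) (u $ pos 1) (u $ pos 2) $ 0"
    unfolding M0 comb_def pos_def eta_def koszul_def f_def
    by (cases eta_first) (simp_all add: algebra_simps)
  show "(M1 *\<^sub>v u) $ 1 = comb (u $ pos 3) (u $ pos 0) (u $ pos 1) (u $ pos 2) $ 1"
    unfolding M1 comb_def pos_def eta_def koszul_def f_def
    by (cases eta_first) (simp_all add: algebra_simps)
  show "(M1 *\<^sub>v u) $ 2 = comb (u $ pos 3) (u $ pos 0) (u $ pos 1) (u $ pos 2) $ 2"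
    unfolding M2 comb_def pos_def eta_def koszul_def f_def
    by (cases eta_first) (simp_all add: algebra_simps)
qed (auto simp: comb_def M1_def intro!: carrier_vecI)

lemma M2_mult:
  assumes "w \<in> carrier_vec 2"
  shows "(M2 *\<^sub>v w) $ pos 0 = P * w $ 1" "(M2 *\<^sub>v w) $ pos 1 = Q * w $ 0 + Zp * w $ 1"
    "(M2 *\<^sub>v w) $ pos 2 = Zq * w $ 0" "(M2 *\<^sub>v w) $ pos 3 = A * w $ 0 - B * w $ 1"
proof -
  let ?c = "if eta_first then [[A, 0, Q, Zq], [- B, P, Zp, 0]] else [[0, Q, Zq, A], [P, Zp, 0, - B]]"
  have M: "(M2 *\<^sub>v w) $ i = ?c ! 0 ! i * w $ 0 + ?c ! 1 ! i * w $ 1" if "i < 4" for i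
    using assms that by (simp add: M2_def scalar_prod_def numeral_2_eq_2)
  show "(M2 *\<^sub>v w) $ pos 0 = P * w $ 1"
    unfolding M[OF pos_cases(1)] unfolding pos_def by (cases eta_first) simp_all
  show "(M2 *\<^sub>v w) $ pos 1 = Q * w $ 0 + Zp * w $ 1"
    unfolding M[OF pos_cases(2)] unfolding pos_def by (cases eta_first) simp_all
  show "(M2 *\<^sub>v w) $ pos 2 = Zq * w $ 0"
    unfolding M[OF pos_cases(3)] unfolding pos_def by (cases eta_first) simp_all
  show "(M2 *\<^sub>v w) $ pos 3 = A * w $ 0 - B * w $ 1"
    unfolding M[OF pos_cases(4)] unfolding pos_def by (cases eta_first) simp_all
qed

lemma pos_all: "(\<And>k. k < 4 \<Longrightarrow> R (pos k)) \<Longrightarrow> j < 4 \<Longrightarrow> R j"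
proof -
  assume R: "\<And>k. k < 4 \<Longrightarrow> R (pos k)" and j: "j < 4"
  have "R (pos 0)" "R (pos 1)" "R (pos 2)" "R (pos 3)" by (rule R, simp)+
  moreover have "j = 0 \<or> j = 1 \<or> j = 2 \<or> j = 3" using j by auto
  ultimately show "R j" unfolding pos_def
    by (cases eta_first) (auto simp: numeral_3_eq_3 numeral_2_eq_2)
qed

lemma f_carrier: "f \<in> carrier_vec 3"
  by (simp add: f_def)

lemma syz_iff: "w \<in> syzygies f \<longleftrightarrow> w \<in> carrier_vec 3 \<and>
    A * P * w $ 0 + (A * Zp + B * Q) * w $ 1 + B * Zq * w $ 2 = 0"
  using scalar_prod_3[of w f] by (auto simp: syzygies_def f_def)

lemma comb_syz: "comb c u0 u1 u2 \<in> syzygies f"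
proof -
  have *: "A * P * (c * (Zp * Zq) + (u1 * (B * Zq) - u2 * (A * Zp + B * Q)))
     + (A * Zp + B * Q) * (- c * (P * Zq) + (u2 * (A * P) - u0 * (B * Zq)))
     + B * Zq * (c * (P * Q) + (u0 * (A * Zp + B * Q) - u1 * (A * P))) = 0" by Groebner_Basis.algebra
  show ?thesis unfolding syz_iff comb_def vec3_simps using * by simp
qed

lemma exact_0: "mat_kernel (row_mat f) = mat_image M1"
  unfolding kernel_row_mat[OF f_carrier]
proof safe
  fix w assume "w \<in> syzygies f"
  then have w: "w \<in> carrier_vec 3" "A * P * w $ 0 + (A * Zp + B * Q) * w $ 1 + B * Zq * w $ 2 = 0"
    unfolding syz_iff by auto
  obtain c u0 u1 u2 where
    "w $ 0 = c * (Zp * Zq) + (u1 * (B * Zq) - u2 * (A * Zp + B * Q))"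
    "w $ 1 = - c * (P * Zq) + (u2 * (A * P) - u0 * (B * Zq))"
    "w $ 2 = c * (P * Q) + (u0 * (A * Zp + B * Q) - u1 * (A * P))"
    by (rule syzygies_generated[OF w(2)])
  then have "w = comb c u0 u1 u2"
    using w(1) unfolding comb_def by (intro vec_3_eqI) (simp_all only: vec3_simps)
  moreover define u where "u = vec 4 (\<lambda>j. if j = pos 0 then u0 else if j = pos 1 then u1 else if j = pos 2 then u2 else c)"
  have "u \<in> carrier_vec 4" "u $ pos 0 = u0" "u $ pos 1 = u1" "u $ pos 2 = u2" "u $ pos 3 = c"
    by (auto simp: u_def pos_def)
  ultimately have "w = M1 *\<^sub>v u" using M1_mult by simp
  then show "w \<in> mat_image M1" unfolding mat_image_def using \<open>u \<in> carrier_vec 4\<close> by (auto simp: M1_def)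
next
  fix w assume "w \<in> mat_image M1"
  then show "w \<in> syzygies f" unfolding mat_image_def using M1_mult comb_syz by (auto simp: M1_def)
qed

lemma exact_1: "mat_kernel M1 = mat_image M2"
proof safe
  fix u assume "u \<in> mat_kernel M1"
  then have u: "u \<in> carrier_vec 4" "M1 *\<^sub>v u = 0\<^sub>v 3" by (auto simp: mat_kernel_def M1_def)
  then have c: "comb (u $ pos 3) (u $ pos 0) (u $ pos 1) (u $ pos 2) = 0\<^sub>v 3" using M1_mult by simp
  have z: "0\<^sub>v 3 $ 0 = (0 :: ('n, 'k) mpoly)" "0\<^sub>v 3 $ 1 = (0 :: ('n, 'k) mpoly)" "0\<^sub>v 3 $ 2 = (0 :: ('n, 'k) mpoly)"
    by auto
  obtain s t where st: "u $ pos 0 = P * t" "u $ pos 1 = Q * s + Zp * t" "u $ pos 2 = Zq * s" "u $ pos 3 = A * s - B * t"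
    by (rule relations_generated[OF arg_cong[OF c, of "\<lambda>v. v $ 0", unfolded comb_def vec3_simps z]
        arg_cong[OF c, of "\<lambda>v. v $ 1", unfolded comb_def vec3_simps z]
        arg_cong[OF c, of "\<lambda>v. v $ 2", unfolded comb_def vec3_simps z]])
  define w where "w = vec 2 (\<lambda>j. if j = 0 then s else t)"
  have w: "w \<in> carrier_vec 2" "w $ 0 = s" "w $ 1 = t" by (auto simp: w_def)
  have "u $ j = (M2 *\<^sub>v w) $ j" if "j < 4" for j
    by (rule pos_all[OF _ that]) (use st M2_mult[OF w(1)] w(2,3) in \<open>auto simp: numeral_eq_Suc less_Suc_eq\<close>)
  then have "u = M2 *\<^sub>v w" using u(1) by (intro eq_vecI) (auto simp: M2_def)
  then show "u \<in> mat_image M2" unfolding mat_image_def using w(1) by (auto simp: M2_def)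
next
  fix u assume "u \<in> mat_image M2"
  then obtain w where w: "w \<in> carrier_vec 2" "u = M2 *\<^sub>v w" by (auto simp: mat_image_def M2_def)
  have u: "u \<in> carrier_vec 4" using w by (auto simp: M2_def intro: carrier_vecI)
  have "comb (A * s - B * t) (P * t) (Q * s + Zp * t) (Zq * s) = 0\<^sub>v 3" for s t
    by (rule vec_3_eqI; simp add: comb_def algebra_simps)
  then have "M1 *\<^sub>v u = 0\<^sub>v 3" using M1_mult[OF u] M2_mult[OF w(1)] w(2) by simp
  then show "u \<in> mat_kernel M1" using u by (auto simp: mat_kernel_def M1_def)
qed

lemma exact_2: "mat_kernel M2 = {0\<^sub>v (dim_col M2)}"
proof safe
  fix w assume "w \<in> mat_kernel M2"
  then have w: "w \<in> carrier_vec 2" "M2 *\<^sub>v w = 0\<^sub>v 4" by (auto simp: mat_kernel_def M2_def)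
  have "P * w $ 1 = 0" "Zq * w $ 0 = 0" using M2_mult[OF w(1)] w(2) pos_cases by auto
  then have "w $ 0 = 0" "w $ 1 = 0" using neq_0 by auto
  then show "w = 0\<^sub>v (dim_col M2)" using w(1) by (intro eq_vecI) (auto simp: M2_def less_Suc_eq numeral_2_eq_2)
qed (auto simp: mat_kernel_def M2_def)

lemma monomial_forms: "form (3 - int p) A" "form (int p) P" "form (3 - int q) B" "form (int q) Q" "form (int p) Zp" "form (int q) Zq"
  using form_Xpow[of "3 - p" x] form_Xpow[of "3 - q" y] form_Xpow[of p x] form_Xpow[of q y] form_Xpow[of p z] form_Xpow[of q z] pq
  by (auto simp: A_def P_def B_def Q_def Zp_def Zq_def of_nat_diff)

lemma form_uminus: "form c s \<Longrightarrow> form c (- s)" for s :: "('n, 'k) mpoly"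
  by (simp add: form_eq_whom whom_uminus)

lemma f_forms: "form 3 (f $ 0)" "form 3 (f $ 1)" "form 3 (f $ 2)"
proof -
  note m = monomial_forms
  show "form 3 (f $ 0)" "form 3 (f $ 1)" "form 3 (f $ 2)"
    using form_mult[OF m(1,2)] form_mult[OF m(1,5)] form_mult[OF m(3,4)] form_mult[OF m(3,6)]
    by (auto simp: f_def intro: form_add)
qed

lemma eta_forms: "form (int p + int q) (eta $ 0)" "form (int p + int q) (eta $ 1)" "form (int p + int q) (eta $ 2)"
proof -
  note m = monomial_forms
  show "form (int p + int q) (eta $ 0)" "form (int p + int q) (eta $ 1)" "form (int p + int q) (eta $ 2)"
    using form_mult[OF m(5,6)] form_uminus[OF form_mult[OF m(2,6)]] form_mult[OF m(2,4)]
    by (auto simp: eta_def)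
qed

definition a1 :: "int list" where
  "a1 = (if eta_first then [3 + int p + int q, 6, 6, 6] else [6, 6, 6, 3 + int p + int q])"

definition a2 :: "int list" where
  "a2 = [6 + int q, 6 + int p]"

lemma graded_M1: "graded_map [3, 3, 3] a1 M1"
  unfolding graded_map_def M1_def a1_def koszul_def
  using f_forms eta_forms form_uminus[OF f_forms(1)] form_uminus[OF f_forms(2)] form_uminus[OF f_forms(3)]
  by (cases eta_first) (auto simp: less_Suc_eq numeral_3_eq_3 numeral_2_eq_2 vec3_simps(4)[unfolded numeral_2_eq_2])

lemma graded_M2: "graded_map a1 a2 M2"
  unfolding graded_map_def M2_def a1_def a2_def using monomial_forms form_uminus[OF monomial_forms(3)]
  by (cases eta_first) (auto simp: less_Suc_eq numeral_3_eq_3 numeral_2_eq_2)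

lemma resolution: "graded_free_resolution J [[3, 3, 3], a1, a2] [row_mat f, M1, M2]"
proof -
  have "\<forall>i<3. form 3 (f $ i)" unfolding all_less_3 using f_forms by auto
  then show ?thesis unfolding graded_free_resolution_3 
    using graded_row_mat[of 3 f] graded_M1 graded_M2 exact_0 exact_1 exact_2 row_ideal_row_mat[OF f_carrier]
    by (auto simp: J_def)
qed

lemma graded_map_const:
  assumes "graded_map b a M" "\<And>i j. i < length b \<Longrightarrow> j < length a \<Longrightarrow> b ! i < a ! j" "s \<in> elements_mat M"
  shows "lookup s 0 = 0"
proof -
  obtain i j where "i < length b" "j < length a" "s = M $$ (i, j)"
    using assms(1,3) by (auto simp: graded_map_def elim!: elements_matD dest!: elements_matD)
  then show ?thesis using assms(1,2) form_positive_const[of "a ! j - b ! i" s] by (auto simp: graded_map_def)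
qed

lemma M1_const: "s \<in> elements_mat M1 \<Longrightarrow> lookup s 0 = 0"
  by (rule graded_map_const[OF graded_M1]) (use pq in \<open>auto simp: a1_def less_Suc_eq numeral_2_eq_2\<close>)

lemma M2_const: "s \<in> elements_mat M2 \<Longrightarrow> lookup s 0 = 0"
  by (rule graded_map_const[OF graded_M2]) (use pq in \<open>auto simp: a1_def a2_def less_Suc_eq numeral_2_eq_2\<close>)

lemma minimal_resolution: "minimal_graded_free_resolution J [[3, 3, 3], a1, a2] [row_mat f, M1, M2]"
  unfolding minimal_graded_free_resolution_def
  using resolution M1_const M2_const by (auto simp: less_Suc_eq)

section \<open>Minimality of the generators and height of the example\<close>

lemma syzygy_const:
  assumes "w \<in> syzygies f" "i < 3" shows "lookup (w $ i) 0 = 0"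
proof -
  obtain u where u: "u \<in> carrier_vec 4" "w = M1 *\<^sub>v u"
    using assms(1) exact_0 unfolding kernel_row_mat[OF f_carrier] mat_image_def by (auto simp: M1_def)
  have M: "M1 \<in> carrier_mat 3 4" by (simp add: M1_def)
  have "lookup (M1 $$ (i, j)) 0 = 0" if "j < 4" for j
    using M1_const elements_matI[OF M assms(2) that refl] by blast
  then show ?thesis using u M assms(2) by (auto simp: scalar_prod_def lookup_sum lookup_mult_0 intro!: sum.neutral)
qed

text \<open>A redundant generator would give a syzygy with the entry -1, contrary to
  \<open>syzygy_const\<close>.\<close>

lemma generators_minimal: "min_gens 3 J f"
  unfolding min_gens_def
proof (intro conjI allI impI)
  fix i assume "i < dim_vec f"
  then have i: "i < 3" by (simp add: f_def)
  then have i': "i = 0 \<or> i = 1 \<or> i = 2" by auto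
  show "form 3 (f $ i)" using i' f_forms by auto
  let ?S = "{f $ 0 * w 0 + f $ 1 * w 1 + f $ 2 * w 2 | w. w i = 0}"
  have "is_ideal ?S" unfolding is_ideal_iff
  proof (intro conjI ballI allI)
    have "0 = f $ 0 * (\<lambda>_. 0) 0 + f $ 1 * (\<lambda>_. 0) 1 + f $ 2 * (\<lambda>_. 0) (2::nat)" by simp
    then show "0 \<in> ?S" by (intro CollectI exI[of _ "\<lambda>_. 0"]) auto
    fix a b assume "a \<in> ?S" "b \<in> ?S"
    then obtain v w where "v i = 0" "w i = 0" "a = f $ 0 * v 0 + f $ 1 * v 1 + f $ 2 * v 2"
      "b = f $ 0 * w 0 + f $ 1 * w 1 + f $ 2 * w 2" by blast
    then show "a + b \<in> ?S" by (intro CollectI exI[of _ "\<lambda>j. v j + w j"]) (auto simp: algebra_simps)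
  next
    fix r a assume "a \<in> ?S"
    then obtain v where "v i = 0" "a = f $ 0 * v 0 + f $ 1 * v 1 + f $ 2 * v 2" by blast
    then show "r * a \<in> ?S" by (intro CollectI exI[of _ "\<lambda>j. r * v j"]) (auto simp: algebra_simps)
  qed
  moreover have "{f $ j | j. j < dim_vec f \<and> j \<noteq> i} \<subseteq> ?S"
  proof safe
    fix j assume j: "j < dim_vec f" "j \<noteq> i"
    then have "j = 0 \<or> j = 1 \<or> j = 2" by (auto simp: f_def)
    then show "\<exists>w. f $ j = f $ 0 * w 0 + f $ 1 * w 1 + f $ 2 * w 2 \<and> w i = 0"
      using j(2) by (intro exI[of _ "\<lambda>k. if k = j then 1 else 0"]) auto
  qed
  ultimately have sub: "ideal_gen {f $ j | j. j < dim_vec f \<and> j \<noteq> i} \<subseteq> ?S"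
    by (rule ideal.span_minimal[rotated])
  show "f $ i \<notin> ideal_gen {f $ j | j. j < dim_vec f \<and> j \<noteq> i}"
  proof
    assume "f $ i \<in> ideal_gen {f $ j | j. j < dim_vec f \<and> j \<noteq> i}"
    then obtain w where w: "f $ i = f $ 0 * w 0 + f $ 1 * w 1 + f $ 2 * w 2" "w i = 0" using sub by blast
    define v where "v = vec 3 (\<lambda>j. if j = i then - 1 else w j)"
    have "f $ 0 * v $ 0 + f $ 1 * v $ 1 + f $ 2 * v $ 2 = f $ 0 * w 0 + f $ 1 * w 1 + f $ 2 * w 2 - f $ i"
      using i' w(2) by (auto simp: v_def)
    then have "v \<in> syzygies f" using w(1) f_carrier scalar_prod_3[of v f] by (simp add: syzygies_def v_def)
    then have "lookup (v $ i) 0 = 0" using syzygy_const i by blast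
    then show False using i by (simp add: v_def lookup_one)
  qed
qed (simp add: J_def)

text \<open>A common irreducible factor divides a power of \<open>x\<close>, hence \<open>x\<close>,
  hence the summand \<open>A * Zp\<close> of the second generator. So it also divides a power of
  \<open>y\<close>, but \<open>x\<close> does not divide \<open>y\<close>.\<close>

lemma primitive_f: "primitive {f $ 0, f $ 1, f $ 2}"
  unfolding primitive_def
proof (intro notI, elim exE conjE)
  fix s assume s: "irreducible s" "\<forall>t\<in>{f $ 0, f $ 1, f $ 2}. s dvd t"
  have pw: "s dvd Xpow v 1" if "s dvd Xpow v n" for v n
    using that
  proof (induction n)
    case 0
    then show ?case using s(1) irreducible_not_unit by auto
  next
    case (Suc n)
    have "Xpow v (Suc n) = Xpow v 1 * (Xpow v n :: ('n, 'k) mpoly)" unfolding Xpow_mult by simp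
    then show ?case using Suc irreducible_prime_dvd[OF s(1)] by metis
  qed
  have "s dvd Xpow x 3" using s(2) by (auto simp: f_def AP)
  then have sx: "s dvd Xpow x 1" by (rule pw)
  \<comment> \<open>Since \<open>p \<le> 2\<close>, the power \<open>A\<close> contains at least one
    factor \<open>x\<close>.\<close>
  have "A = Xpow x 1 * Xpow x (2 - p)" 
  proof -
    have "3 - p = 1 + (2 - p)" using pq by simp
    then show ?thesis unfolding A_def Xpow_mult by (rule arg_cong)
  qed
  then have "s dvd A * Zp" using sx by (metis dvd_mult2)
  moreover have "s dvd A * Zp + B * Q" using s(2) by (auto simp: f_def)
  ultimately have "s dvd B * Q" using dvd_add_right_iff by blast
  then have sy: "s dvd Xpow y 1" unfolding BQ by (rule pw)
  obtain t where t: "Xpow x 1 = s * t" using sx by blast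
  have "tdeg (Xpow x 1 :: ('n, 'k) mpoly) = 1" using form_tdeg[OF form_Xpow[of 1 x]] by simp
  moreover have nz: "s \<noteq> 0" "t \<noteq> 0" using t Xpow_neq_0[of x 1] by (metis mult_zero_left, metis mult_zero_right)
  ultimately have "tdeg s + tdeg t = 1" using tdeg_mult[OF nz] t by simp
  then have "tdeg t = 0" using tdeg_irreducible_pos[OF s(1)] tdeg_nonneg[OF nz(2)] by linarith
  then have "t dvd 1" using is_unit_iff_tdeg nz by blast
  then obtain r where "1 = t * r" by blast
  then have "Xpow x 1 * r = s" unfolding t by (metis mult.assoc mult.right_neutral)
  then have "Xpow x 1 dvd s" by (metis dvd_triv_left)
  then have "Xpow x 1 dvd (Xpow y 1 :: ('n, 'k) mpoly)" using sy dvd_trans by blast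
  then show False using distinct(1) unfolding Xpow_dvd_iff by (simp add: lookup_single)
qed

text \<open>The upper bound comes from a prime ideal above \<open>J\<close> that contains no nonzero
  polynomial in the remaining variables, the lower bound from the absence of a common
  factor.\<close>

lemma height_J: "height J = 2"
proof -
  define wt where "wt = (\<lambda>m :: 'n \<Rightarrow>\<^sub>0 nat. lookup m x + lookup m y)"
  interpret wt: weight wt by standard (simp add: wt_def lookup_add)
  \<comment> \<open>The kernel of the substitution of 0 for \<open>x\<close> and \<open>y\<close>,
    that is, the prime ideal generated by these two variables.\<close>
  define R where "R = {s :: ('n, 'k) mpoly. wcomp wt 0 s = 0}"
  have mult: "wcomp wt 0 (s * t) = wcomp wt 0 s * wcomp wt 0 t" for s t :: "('n, 'k) mpoly"
    using wt.wcomp_mult_bot[of s 0 t 0] by simp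
  have one: "wcomp wt 0 (1 :: ('n, 'k) mpoly) = 1"
    by (rule poly_mapping_eqI) (auto simp: lookup_wcomp lookup_one when_def wt_def)
  have prime: "prime_ideal R"
    unfolding prime_ideal_def is_ideal_iff
  proof (intro conjI ballI allI impI)
    have "1 \<notin> R" using one by (simp add: R_def)
    then show "R \<noteq> UNIV" by auto
  qed (auto simp: R_def wcomp_add mult)
  have in_R: "s \<in> R" if "\<And>m. m \<in> keys s \<Longrightarrow> 1 \<le> lookup m x \<or> 1 \<le> lookup m y" for s :: "('n, 'k) mpoly"
  proof -
    have "0 < wt m" if "m \<in> keys s" for m
      using \<open>\<And>m. m \<in> keys s \<Longrightarrow> 1 \<le> lookup m x \<or> 1 \<le> lookup m y\<close>[OF that] by (auto simp: wt_def)
    then have "wcomp wt 0 s = 0" by (intro wcomp_eq_0) auto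
    then show ?thesis by (simp add: R_def)
  qed
  have X: "Xpow x (Suc n) \<in> R" "Xpow y (Suc n) \<in> R" for n
    by (auto intro!: in_R)
  have A: "A \<in> R" and B: "B \<in> R" using X[of "2 - p"] X[of "2 - q"] pq unfolding A_def B_def by (auto simp: Suc_diff_le numeral_eq_Suc)
  have Rid: "is_ideal R" using prime by (simp add: prime_ideal_def)
  have mR: "s * t \<in> R" if "s \<in> R" for s t using that Rid unfolding is_ideal_iff by (metis mult.commute)
  have "set\<^sub>v f \<subseteq> R" unfolding set_vec_3[OF f_carrier] using A B mR Rid
    by (auto simp: f_def is_ideal_iff)
  then have JR: "J \<subseteq> R" unfolding J_def by (rule ideal.span_minimal) (rule Rid)
  have "R \<inter> polys (- {x, y}) \<subseteq> {0}"
  proof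
    fix s assume s: "s \<in> R \<inter> polys (- {x, y})"
    have "wt m = 0" if "m \<in> keys s" for m
    proof -
      have "keys m \<subseteq> - {x, y}" using s that by (auto simp: polys_def)
      then have "x \<notin> keys m" "y \<notin> keys m" by auto
      then show ?thesis by (simp add: wt_def in_keys_iff)
    qed
    then have "whom wt 0 s" by (simp add: whom_def)
    then show "s \<in> {0}" using wcomp_whom[of wt 0 s 0] s by (simp add: R_def)
  qed
  moreover have "card (- {x, y}) + 2 = CARD('n)"
  proof -
    have "card {x, y} = 2" using distinct by simp
    then show ?thesis using card_mono[of "UNIV :: 'n set" "{x, y}"] by (simp add: Compl_eq_Diff_UNIV card_Diff_subset)
  qed
  ultimately have "prime_height R \<le> enat 2" by (intro prime_height_le_if_polys) auto
  then have "height J \<le> 2" using height_le[OF prime JR] by (simp add: numeral_eq_enat)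
  moreover have "{f $ 0, f $ 1, f $ 2} \<subseteq> J"
    unfolding J_def set_vec_3[OF f_carrier] by (rule ideal.span_superset)
  then have "2 \<le> height J" using height_ge_2 primitive_mono[OF primitive_f] by blast
  ultimately show ?thesis by simp
qed

lemma admissible_J:
  assumes "a1 = [3 + d1, 3 + d2, 3 + d3, 3 + d4]" "a2 = [3 + d3 + e1, 3 + d4 + e2]"
    "1 \<le> d1" "d1 \<le> d2" "d2 \<le> d3" "d3 \<le> d4" "0 < e1" "0 < e2" "d3 + e1 \<le> d4 + e2"
  shows "admissible J d1 d2 d3 d4 e1 e2"
  unfolding admissible_def
  using f_carrier generators_minimal height_J minimal_resolution assms by auto

end

section \<open>The three cases occur\<close>

lemma admissible_exists:
  assumes "3 \<le> CARD('n::{finite,linorder})"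
  shows "\<exists>J :: ('n, 'k::field_char_0) mpoly set. admissible J 2 3 3 3 1 1"
    "\<exists>J :: ('n, 'k) mpoly set. admissible J 3 3 3 3 1 2"
    "\<exists>J :: ('n, 'k) mpoly set. admissible J 3 3 3 4 2 1"
proof -
  obtain Z :: "'n set" where "card Z = 3" using obtain_subset_with_card_n[OF assms] by blast
  then obtain x y z :: 'n where d: "x \<noteq> y" "x \<noteq> z" "y \<noteq> z" unfolding card_3_iff by blast
  interpret e1: cubic_example x y z "Suc 0" "Suc 0" True "TYPE('k)" by standard (use d in auto)
  interpret e2: cubic_example x y z 2 "Suc 0" False "TYPE('k)" by standard (use d in auto)
  interpret e3: cubic_example x y z 2 2 False "TYPE('k)" by standard (use d in auto)
  show "\<exists>J :: ('n, 'k) mpoly set. admissible J 2 3 3 3 1 1"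
    by (rule exI, rule e1.admissible_J) (auto simp: e1.a1_def e1.a2_def)
  show "\<exists>J :: ('n, 'k) mpoly set. admissible J 3 3 3 3 1 2"
    by (rule exI, rule e2.admissible_J) (auto simp: e2.a1_def e2.a2_def)
  show "\<exists>J :: ('n, 'k) mpoly set. admissible J 3 3 3 4 2 1"
    by (rule exI, rule e3.admissible_J) (auto simp: e3.a1_def e3.a2_def)
qed

theorem proposition3p15:
  assumes "CARD('n::{finite, linorder}) \<ge> 3"
  shows "{((\<delta>\<^sub>1, \<delta>\<^sub>2, \<delta>\<^sub>3, \<delta>\<^sub>4), (\<epsilon>\<^sub>1, \<epsilon>\<^sub>2), quot_multiplicity J, bourbaki_degree J) |
      (J :: ('n, 'k::{alg_closed_field, field_char_0}) mpoly set)
      (\<delta>\<^sub>1::int) (\<delta>\<^sub>2::int) (\<delta>\<^sub>3::int) (\<delta>\<^sub>4::int) (\<epsilon>\<^sub>1::int) (\<epsilon>\<^sub>2::int).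
        (\<exists>f \<in> carrier_vec 3. min_gens 3 J f) \<and>
        height J = 2 \<and>
        1 \<le> \<delta>\<^sub>1 \<and> \<delta>\<^sub>1 \<le> \<delta>\<^sub>2 \<and> \<delta>\<^sub>2 \<le> \<delta>\<^sub>3 \<and> \<delta>\<^sub>3 \<le> \<delta>\<^sub>4 \<and>
        0 < \<epsilon>\<^sub>1 \<and> 0 < \<epsilon>\<^sub>2 \<and> \<delta>\<^sub>3 + \<epsilon>\<^sub>1 \<le> \<delta>\<^sub>4 + \<epsilon>\<^sub>2 \<and>
        (\<exists>Ms. minimal_graded_free_resolution J
           [[3, 3, 3],
            [3 + \<delta>\<^sub>1, 3 + \<delta>\<^sub>2, 3 + \<delta>\<^sub>3, 3 + \<delta>\<^sub>4],
            [3 + \<delta>\<^sub>3 + \<epsilon>\<^sub>1, 3 + \<delta>\<^sub>4 + \<epsilon>\<^sub>2]] Ms)}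
    = {((2, 3, 3, 3), (1, 1), 4, 3),
       ((3, 3, 3, 3), (1, 2), 2, 7),
       ((3, 3, 3, 4), (2, 1), 1, 8)}"
    (is "?L = ?R")
proof -
  have L: "?L = {((\<delta>\<^sub>1, \<delta>\<^sub>2, \<delta>\<^sub>3, \<delta>\<^sub>4), (\<epsilon>\<^sub>1, \<epsilon>\<^sub>2), quot_multiplicity J, bourbaki_degree J) |
      (J :: ('n, 'k) mpoly set) \<delta>\<^sub>1 \<delta>\<^sub>2 \<delta>\<^sub>3 \<delta>\<^sub>4 \<epsilon>\<^sub>1 \<epsilon>\<^sub>2. admissible J \<delta>\<^sub>1 \<delta>\<^sub>2 \<delta>\<^sub>3 \<delta>\<^sub>4 \<epsilon>\<^sub>1 \<epsilon>\<^sub>2}"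
    unfolding admissible_def ..
  have card: "3 \<le> CARD('n)" using assms .
  have vals: "(quot_multiplicity J, bourbaki_degree J) = (\<mu>, \<beta>)"
    if "admissible J d1 d2 d3 d4 e1 e2" "((d1, d2, d3, d4), (e1, e2), \<mu>, \<beta>) \<in> ?R"
    for J :: "('n, 'k) mpoly set" and d1 d2 d3 d4 e1 e2 \<mu> \<beta>
    using admissible_values[OF card that(1)] that(2) by auto
  have 1: "t \<in> ?L" if t: "t \<in> ?R" for t
  proof -
    obtain d1 d2 d3 d4 e1 e2 \<mu> \<beta> where t': "t = ((d1, d2, d3, d4), (e1, e2), \<mu>, \<beta>)" by (metis surj_pair)
    have "\<exists>J :: ('n, 'k) mpoly set. admissible J d1 d2 d3 d4 e1 e2"
      using t admissible_exists[OF card, where 'k='k] unfolding t' by auto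
    then obtain J :: "('n, 'k) mpoly set" where J: "admissible J d1 d2 d3 d4 e1 e2" by blast
    have v: "(quot_multiplicity J, bourbaki_degree J) = (\<mu>, \<beta>)"
      by (rule vals[OF J]) (use t t' in simp)
    show ?thesis unfolding L t'
      by (rule CollectI, rule exI[of _ J], (rule exI)+, rule conjI[rotated], rule J) (use v in simp)
  qed
  have 2: "t \<in> ?R" if "t \<in> ?L" for t
  proof -
    from that obtain J :: "('n, 'k) mpoly set" and d1 d2 d3 d4 e1 e2
      where t: "t = ((d1, d2, d3, d4), (e1, e2), quot_multiplicity J, bourbaki_degree J)" and J: "admissible J d1 d2 d3 d4 e1 e2"
      unfolding L by (elim CollectE exE conjE)
    show ?thesis unfolding t by (rule admissible_values[OF card J])
  qed
  show ?thesis by (rule subset_antisym) (rule subsetI, erule 2, rule subsetI, erule 1)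
qed

end
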